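(* Let $n=2^r\cdot 5$ with $r$ a positive integer. Assume that $(x_0,\dots,x_4)\in G^5$ satisfies $(\tan x_0)^2=(\tan x_1)(\tan x_2)(\tan x_3)(\tan x_4)$ with $0<x_i<\frac{\pi}{2}$ for each $0\le i\le 4$, that $\max\{\operatorname{den}(x_i)\mid 0\le i\le 2\}=n$, and that $\operatorname{den}(x_i)\mid n$ for each $0\le i\le 4$. Then there is a permutation $\sigma$ of $\{1,2,3,4\}$ such that one of the following holds: (a) there are rationals $s,t$ with $0<s<\frac12$, $0<t\le\frac14$ and $x_0=x_{\sigma(1)}=x_{\sigma(2)}=s\pi$, $x_{\sigma(3)}=t\pi$, $x_{\sigma(4)}=(\frac12-t)\pi$; (b) there are rationals $s,t$ with $0<s\le t\le\frac14$ and $x_0=\frac{\pi}{4}$, $x_{\sigma(1)}=s\pi$, $x_{\sigma(2)}=(\frac12-s)\pi$, $x_{\sigma(3)}=t\pi$, $x_{\sigma(4)}=(\frac12-t)\pi$; (c) $(x_0,x_{\sigma(1)},x_{\sigma(2)},x_{\sigma(3)},x_{\sigma(4)})=(\frac18,\frac1{40},\frac7{40},\frac9{40},\frac{17}{40})\pi$; (d) $(x_0,x_{\sigma(1)},x_{\sigma(2)},x_{\sigma(3)},x_{\sigma(4)})=(\frac38,\frac3{40},\frac{11}{40},\frac{13}{40},\frac{19}{40})\pi$.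
   Context: $G:=\mathbb{Q}\pi$; for nonzero $g\in G$, $\operatorname{den}(g)$ is the denominator of $g/\pi$ in lowest terms. *)

theory Defs
  imports Complex_Main "HOL-Combinatorics.Permutations"
begin

definition G :: "real set" where
  "G = range (\<lambda>q :: rat. of_rat q * pi)"

text \<open>
  \<^term>\<open>quotient_of\<close> returns numerator and positive denominator in lowest terms.
  Outside \<^term>\<open>G\<close> the description below is unspecified.
\<close>

definition den :: "real \<Rightarrow> nat" where
  "den g = nat (snd (quotient_of (THE q :: rat. of_rat q = g / pi)))"

lemma den_of_rat: "den (of_rat q * pi) = nat (snd (quotient_of q))"
  by (simp add: den_def)

lemma den_Fract:
  assumes "b > 0" "coprime a b"
  shows "den (of_int a / of_int b * pi) = nat b"
proof -
  have "of_int a / of_int b = (of_rat (Fract a b) :: real)"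
    using assms by (simp add: of_rat_rat)
  then show ?thesis
    using assms by (simp add: den_of_rat quotient_of_Fract Rat.normalize_def)
qed

end

theory Submission
  imports Defs "HOL-Computational_Algebra.Polynomial_Factorial" "HOL-Number_Theory.Residues"
begin

text \<open>
  Let \<open>z\<close> run over the six angles \<open>pi / 2 - x\<^sub>0\<close> (twice) and \<open>x\<^sub>1, \<dots>, x\<^sub>4\<close>; the product of their tangents is 1.
  Irreducibility of cyclotomic polynomials gives \<open>\<Sum> ln \<bar>tan (u * z)\<bar> = 0\<close> for all \<open>u\<close> coprime to 10.
  Taking \<open>u = 1 + 5 * 2 ^ (j - 1)\<close>, which changes the sign of \<open>ln \<bar>tan z\<bar>\<close> exactly at the angles whose denominator has
  2-adic valuation \<open>j\<close> and fixes those of lower valuation, one may treat each \<open>j\<close> separately.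

  For \<open>j \<ge> 3\<close> put \<open>h = 2 ^ (j - 3)\<close>. The units modulo \<open>5 * 2 ^ j\<close> up to sign are a product of cyclic groups of orders
  \<open>2 * h\<close> and 4, and the first one acts on the values \<open>ln \<bar>tan z\<bar>\<close> through the domain \<open>\<int>[w]\<close>, \<open>w ^ h = -1\<close>. Every
  component under the second group is nonzero, so up to \<open>z \<mapsto> pi / 2 - z\<close> the only relations come from the
  quintuplication formula \<open>tan (5 * x) = \<Prod>m<5. tan (x + m * pi / 5)\<close>. Six terms leave room for it only if \<open>j = 3\<close>,
  which yields the two sporadic solutions. In all other cases the six angles split into complementary pairs.
\<close>

hide_const (open) Module.smult UnivPoly.coeff UnivPoly.monom

section \<open>Conjugates of roots of unity\<close>

text \<open>Nonvanishing of such components usually comes from values of L-functions at 1. It is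
  elementary here because few components matter: \<open>X ^ h + 1\<close> is irreducible for
  \<open>h\<close> a power of 2, so under the cyclic group generated by \<open>g\<close> no nonzero
  element of \<open>Z[w]\<close> kills a component that has a single nonzero value. Only the four
  characters of the group generated by \<open>d\<close> remain, and for these explicit trigonometric
  arguments suffice. The quintuplication formula is itself a relation between six terms at every
  level: one angle from each of the four classes of units, and two multiples of 5 whose exponents
  differ by \<open>h + 1\<close>. Counting terms therefore cannot exclude it; the repeated angle
  \<open>pi / 2 - x 0\<close> does. The two multiples of 5 coincide exactly if \<open>2 * h\<close>
  divides \<open>h + 1\<close>, that is, if \<open>h = 1\<close>, and the two possible exponents
  modulo 2 then give the two sporadic solutions.\<close>

abbreviation ipoly :: "int poly \<Rightarrow> complex \<Rightarrow> complex" where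
  "ipoly P \<equiv> poly (map_poly of_int P)"

lemma ipoly_simps:
  "ipoly 0 z = 0" "ipoly 1 z = 1" "ipoly (pCons a P) z = of_int a + z * ipoly P z"
  "ipoly (P + Q) z = ipoly P z + ipoly Q z" "ipoly (P - Q) z = ipoly P z - ipoly Q z"
  "ipoly (P * Q) z = ipoly P z * ipoly Q z" "ipoly (smult a P) z = of_int a * ipoly P z"
  "ipoly (monom a n) z = of_int a * z ^ n" "ipoly (P ^ n) z = ipoly P z ^ n"
  "ipoly (pcompose P Q) z = ipoly P (ipoly Q z)"
proof -
  show *: "ipoly 0 z = 0" "ipoly 1 z = 1" 
    by (simp_all)
  show p: "ipoly (pCons a P) z = of_int a + z * ipoly P z" for a P z
    by (simp add: map_poly_pCons)
  show a: "ipoly (P + Q) z = ipoly P z + ipoly Q z" for P Q z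
    by (induction P Q rule: poly_induct2) (simp_all add: p algebra_simps)
  show s: "ipoly (smult a P) z = of_int a * ipoly P z" for a P z
    by (induction P) (simp_all add: p algebra_simps)
  show "ipoly (P - Q) z = ipoly P z - ipoly Q z" for P Q
    using a[of P "smult (-1) Q" z] s[of "-1" Q z] by simp
  show m: "ipoly (P * Q) z = ipoly P z * ipoly Q z" for P Q z
    by (induction P) (simp_all add: p a s algebra_simps)
  show "ipoly (monom a n) z = of_int a * z ^ n"
    by (simp add: map_poly_monom poly_monom)
  show "ipoly (P ^ n) z = ipoly P z ^ n"
    by (induction n) (simp_all add: * m)
  show "ipoly (pcompose P Q) z = ipoly P (ipoly Q z)"
    by (induction P) (simp_all add: * p a m pcompose_pCons)
qed

text \<open>The Frobenius congruence modulo \<open>p\<close> in the ring generated by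
  \<open>z\<close>. The quotient is exhibited as the value of an integer polynomial, which keeps
  track of that ring without constructing it.\<close>

lemma ipoly_frobenius:
  assumes p: "prime p"
  shows "\<exists>Q. ipoly P (z ^ p) = ipoly P z ^ p + of_nat p * ipoly Q z"
proof (induction P)
  case 0
  show ?case using p by (intro exI[of _ 0]) (simp add: ipoly_simps prime_gt_0_nat)
next
  case (pCons a P)
  then obtain Q where Q: "ipoly P (z ^ p) = ipoly P z ^ p + of_nat p * ipoly Q z" by blast
  have "int p dvd a ^ p - a"
  proof -
    have "[a ^ p = a] (mod int p)"
    proof (cases "int p dvd a")
      case True
      then show ?thesis using p
        by (meson cong_0_iff cong_sym cong_trans dvd_power prime_gt_0_nat dvd_trans)
    next
      case False
      define b where "b = nat (a mod int p)"
      have b: "int b = a mod int p" using p prime_gt_0_nat[OF p] by (simp add: b_def)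
      have "\<not> p dvd b" using False b by (metis dvd_mod_iff dvd_refl int_dvd_int_iff)
      then have "[b ^ (p - 1) = 1] (mod p)" using fermat_theorem p by blast
      then have "[b ^ (p - 1) * b = 1 * b] (mod p)" by (rule cong_scalar_right)
      moreover have "b ^ (p - 1) * b = b ^ p" using prime_gt_0_nat[OF p]
        by (metis power_minus_mult)
      ultimately have "[b ^ p = b] (mod p)" by simp
      then have "[int b ^ p = int b] (mod int p)" by (metis cong_int_iff of_nat_power)
      moreover have "[int b = a] (mod int p)" by (simp add: b cong_def)
      ultimately show ?thesis by (meson cong_pow cong_sym cong_trans)
    qed
    then show ?thesis by (simp add: cong_iff_dvd_diff)
  qed
  then obtain c where "a ^ p - a = int p * c" by (rule dvdE)
  then have c: "a ^ p = a + int p * c" by simp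
  have "\<exists>R. \<forall>k\<in>{1..<p}. p choose k = p * R k"
    by (rule bchoice) (use dvd_choose_prime p in \<open>force simp: dvd_def\<close>)
  then obtain R where R: "\<And>k. k \<in> {1..<p} \<Longrightarrow> p choose k = p * R k" by blast
  let ?S = "\<Sum>k\<in>{1..<p}. monom (int (R k)) (p - k) * P ^ (p - k) * [:a ^ k:]"
  have sumS: "ipoly (sum f A) z = (\<Sum>k\<in>A. ipoly (f k) z)" for f and A :: "nat set"
    by (induction A rule: infinite_finite_induct) (simp_all add: ipoly_simps)
  let ?A = "of_int a :: complex" and ?B = "z * ipoly P z"
  have "(?A + ?B) ^ p = (\<Sum>k\<le>p. of_nat (p choose k) * ?A ^ k * ?B ^ (p - k))"
    by (rule binomial_ring)
  also have "{..p} = insert 0 (insert p {1..<p})" using prime_gt_0_nat[OF p] by auto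
  also have "(\<Sum>k\<in>\<dots>. of_nat (p choose k) * ?A ^ k * ?B ^ (p - k)) =
     ?B ^ p + (?A ^ p + (\<Sum>k\<in>{1..<p}. of_nat (p choose k) * ?A ^ k * ?B ^ (p - k)))"
    using prime_gt_0_nat[OF p] by simp
  also have "(\<Sum>k\<in>{1..<p}. of_nat (p choose k) * ?A ^ k * ?B ^ (p - k)) = of_nat p * ipoly ?S z"
    unfolding sumS sum_distrib_left
    by (rule sum.cong) (simp_all add: R ipoly_simps power_mult_distrib mult_ac)
  finally have E: "(?A + ?B) ^ p = ?B ^ p + (?A ^ p + of_nat p * ipoly ?S z)" .
  have A: "?A ^ p = ?A + of_nat p * of_int c"
    using arg_cong[OF c, of "of_int :: int \<Rightarrow> complex"] by simp
  show ?case
    by (rule exI[of _ "monom 1 p * Q - [:c:] - ?S"])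
       (use Q E A in \<open>simp add: ipoly_simps algebra_simps power_mult_distrib\<close>)
qed

text \<open>By Gauss's lemma, the primitive part of an annihilator of least degree divides every
  annihilator over the integers and not only over the rationals. Since it divides
  \<open>X ^ M - 1\<close>, its leading coefficient is a unit.\<close>

lemma monic_minimal_ipoly:
  assumes w: "w ^ M = 1" and M: "M > 0"
  obtains f where "f \<noteq> 0" "ipoly f w = 0" "lead_coeff f = 1 \<or> lead_coeff f = -1"
    "\<And>P. ipoly P w = 0 \<Longrightarrow> f dvd P"
proof -
  let ?X = "monom 1 M - 1 :: int poly"
  have X0: "?X \<noteq> 0" using M by (metis degree_1 degree_monom_eq eq_iff_diff_eq_0 less_numeral_extra(3) zero_neq_one)
  have Xw: "ipoly ?X w = 0" using w by (simp add: ipoly_simps)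
  define f0 where "f0 = (ARG_MIN degree P. P \<noteq> 0 \<and> ipoly P w = 0)"
  have f0: "f0 \<noteq> 0" "ipoly f0 w = 0" and min0: "\<And>P. P \<noteq> 0 \<Longrightarrow> ipoly P w = 0 \<Longrightarrow> degree f0 \<le> degree P"
    using arg_min_nat_lemma[of "\<lambda>P. P \<noteq> 0 \<and> ipoly P w = 0" ?X degree] X0 Xw
    unfolding f0_def by auto
  define f where "f = primitive_part f0"
  have ff0: "smult (content f0) f = f0" by (simp add: f_def)
  have f: "f \<noteq> 0" using f0 by (simp add: f_def)
  have fw: "ipoly f w = 0" using f0 ipoly_simps(7)[of "content f0" f w] ff0 by simp
  have df: "degree f = degree f0" by (simp add: f_def)
  have cf: "content f = 1" using f0 by (simp add: f_def)
  have dvd: "f dvd P" if P: "ipoly P w = 0" for P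
  proof -
    obtain q r where qr: "pseudo_divmod P f = (q, r)" by (cases "pseudo_divmod P f")
    define k where "k = lead_coeff f ^ (Suc (degree P) - degree f)"
    have k: "smult k P = f * q + r" "r = 0 \<or> degree r < degree f"
      using pseudo_divmod[OF f qr] by (auto simp: k_def)
    have "ipoly r w = 0" using arg_cong[OF k(1), of "\<lambda>P. ipoly P w"] P fw by (simp add: ipoly_simps)
    then have "r = 0" using k(2) min0[of r] df by fastforce
    then have kP: "smult k P = f * q" using k by simp
    have k0: "k \<noteq> 0" using f by (simp add: k_def)
    have "content q = normalize k * content P"
      using arg_cong[OF kP, of content] cf by (simp add: content_mult)
    then have "k dvd content q" by simp
    then have "[:k:] dvd q" by (simp add: const_poly_dvd_iff_dvd_content)
    then obtain q' where "q = [:k:] * q'" by (rule dvdE)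
    then have q': "q = smult k q'" by simp
    have "smult k P = smult k (f * q')" using kP q' by simp
    then have "smult k (P - f * q') = 0" by (simp add: smult_diff_right)
    then have "P = f * q'" using k0 by simp
    then show ?thesis by simp
  qed
  obtain g where g: "?X = f * g" using dvd[OF Xw] by (rule dvdE)
  have "lead_coeff ?X = 1"
  proof -
    have "degree ?X = M"
      using M degree_add_eq_left[of "-1" "monom 1 M :: int poly"] by (simp add: degree_monom_eq)
    then show ?thesis using M by simp
  qed
  then have "lead_coeff f * lead_coeff g = 1" using g by (metis lead_coeff_mult)
  then have "lead_coeff f = 1 \<or> lead_coeff f = -1"
    using pos_zmult_eq_1_iff_lemma by blast
  then show ?thesis using that f fw dvd by blast
qed

text \<open>
  Dedekind's argument: let \<open>X ^ M - 1 = f * g\<close> with \<open>f\<close> minimal at \<open>w\<close>. If \<open>f (w ^ p) \<noteq> 0\<close>, then \<open>g (w ^ p) = 0\<close>,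
  and differentiating shows that \<open>M\<close> equals \<open>f (w ^ p)\<close> times an element of \<open>\<int>[w]\<close>. By the Frobenius congruence
  \<open>p\<close> divides \<open>f (w ^ p)\<close>, hence \<open>M\<close>.
\<close>

lemma root_of_unity_conj_prime:
  assumes w: "w ^ M = 1" and M: "M > 0" and p: "prime p" "\<not> p dvd M" and P: "ipoly P w = 0"
  shows "ipoly P (w ^ p) = 0"
proof -
  obtain f where f: "f \<noteq> 0" "ipoly f w = 0" "lead_coeff f = 1 \<or> lead_coeff f = -1"
    and dvd: "\<And>P. ipoly P w = 0 \<Longrightarrow> f dvd P" using monic_minimal_ipoly[OF w M] by metis
  let ?X = "monom 1 M - 1 :: int poly"
  obtain g where g: "?X = f * g" using dvd[of ?X] w by (auto simp: ipoly_simps)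
  have degf: "degree f > 0"
  proof (rule ccontr)
    assume "\<not> degree f > 0"
    then obtain c where "f = [:c:]" by (metis degree_eq_zeroE neq0_conv)
    then show False using f by (simp add: ipoly_simps)
  qed
  have "ipoly f (w ^ p) = 0"
  proof (rule ccontr)
    assume nz: "ipoly f (w ^ p) \<noteq> 0"
    have wp: "(w ^ p) ^ M = 1" by (metis w power_commutes power_mult power_one mult.commute)
    have "ipoly f (w ^ p) * ipoly g (w ^ p) = 0"
      using arg_cong[OF g, of "\<lambda>P. ipoly P (w ^ p)"] wp by (simp add: ipoly_simps)
    with nz have gz: "ipoly g (w ^ p) = 0" by simp
    obtain Q where Q: "ipoly f (w ^ p) = of_nat p * ipoly Q w"
      using ipoly_frobenius[OF p(1), of f w] f prime_gt_0_nat[OF p(1)] by (auto simp: power_0_left)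
    have D: "monom (int M) (M - 1) = f * pderiv g + pderiv f * g"
      using arg_cong[OF g, of pderiv] by (simp add: pderiv_diff pderiv_monom pderiv_mult mult_ac)
    have "ipoly (monom (int M) (M - 1)) (w ^ p) = ipoly (f * pderiv g + pderiv f * g) (w ^ p)"
      by (simp only: D)
    then have "of_nat M * (w ^ p) ^ (M - 1) = ipoly f (w ^ p) * ipoly (pderiv g) (w ^ p)"
      by (simp add: ipoly_simps gz)
    then have e1: "of_nat M * ((w ^ p) ^ (M - 1) * w ^ p) = of_nat p * (ipoly Q w * (ipoly (pderiv g) (w ^ p) * w ^ p))"
      using Q by simp
    have e2: "(w ^ p) ^ (M - 1) * w ^ p = 1" using wp M by (metis power_minus_mult)
    have "of_nat M = of_nat p * (ipoly Q w * (ipoly (pderiv g) (w ^ p) * w ^ p))"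
      using e1 unfolding e2 by simp
    then have eq: "of_nat M = of_nat p * ipoly (Q * (pcompose (pderiv g) (monom 1 p) * monom 1 p)) w"
      by (simp add: ipoly_simps)
    \<comment> \<open>Divisibility by \<open>p\<close> in \<open>Z[w]\<close> has to become
      divisibility in the integers. As the leading coefficient of \<open>f\<close> is a unit,
      \<open>k\<close> is a sign and \<open>S\<close> has a remainder of degree below that of
      \<open>f\<close>; powers of \<open>w\<close> below this degree are independent, so constant
      coefficients may be compared.\<close>
    define S where "S = Q * (pcompose (pderiv g) (monom 1 p) * monom 1 p)"
    obtain q r where qr: "pseudo_divmod S f = (q, r)" by (cases "pseudo_divmod S f")
    define k where "k = lead_coeff f ^ (Suc (degree S) - degree f)"
    have k: "smult k S = f * q + r" "r = 0 \<or> degree r < degree f"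
      using pseudo_divmod[OF f(1) qr] by (auto simp: k_def)
    have k1: "k = 1 \<or> k = -1" using f(3) unfolding k_def by (metis power_one minus_one_power_iff)
    have "of_int k * ipoly S w = ipoly r w"
      using arg_cong[OF k(1), of "\<lambda>P. ipoly P w"] f(2) by (simp add: ipoly_simps)
    then have "of_int k * of_nat M = of_nat p * ipoly r w" using eq unfolding S_def[symmetric] by (simp add: algebra_simps)
    then have "ipoly ([:k * int M:] - smult (int p) r) w = 0" by (simp add: ipoly_simps)
    then have "f dvd [:k * int M:] - smult (int p) r" by (rule dvd)
    moreover have "degree ([:k * int M:] - smult (int p) r) < degree f"
      using k(2) degf by (intro degree_diff_less) auto
    ultimately have "[:k * int M:] - smult (int p) r = 0"
      by (metis dvd_imp_degree_le leD)
    then have "[:k * int M:] = smult (int p) r" by simp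
    then have "k * int M = int p * coeff r 0" by (metis coeff_pCons_0 coeff_smult)
    then have "int p dvd k * int M" by simp
    then have "int p dvd int M" using k1 by auto
    then show False using p(2) by simp
  qed
  moreover have "f dvd P" by (rule dvd[OF P])
  ultimately show ?thesis by (auto simp: ipoly_simps elim!: dvdE)
qed

lemma root_of_unity_conj:
  assumes w: "w ^ M = 1" and M: "M > 0" and u: "coprime u M" and P: "ipoly P w = 0"
  shows "ipoly P (w ^ u) = 0"
proof (cases "u = 0")
  case True
  then have "M = 1" using u by simp
  then show ?thesis using True w P by simp
next
  case False
  then show ?thesis using u w P
  proof (induction u arbitrary: w rule: prime_divisors_induct)
    case zero then show ?case by simp
  next
    case (unit x) then show ?case by simp
  next
    case (factor p x)
    have x: "x \<noteq> 0" "coprime x M" "\<not> p dvd M"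
      using factor by (auto simp: coprime_mult_left_iff dest: coprime_absorb_left not_prime_unit)
    have "(w ^ p) ^ M = 1" by (metis factor.prems(3) power_commutes power_mult power_one mult.commute)
    with factor.IH[of "w ^ p"] x root_of_unity_conj_prime[OF factor.prems(3) M _ x(3) factor.prems(4)] factor.hyps
    show ?case by (simp add: power_mult)
  qed
qed

section \<open>Roots of -1 with exponent a power of 2\<close>

text \<open>Such a \<open>w\<close> has order exactly \<open>2 ^ Suc m\<close>: from
  \<open>w ^ (2 ^ e * t) = 1\<close> with \<open>t\<close> odd and \<open>e \<le> m\<close>, raising
  to the power \<open>2 ^ (m - e)\<close> would give \<open>(-1) ^ t = 1\<close>.\<close>

lemma power_eq_minus_one_inj:
  fixes w :: complex
  assumes w: "w ^ (2 ^ m) = -1" and eq: "w ^ u = w ^ v" and uv: "u < 2 ^ Suc m" "v < 2 ^ Suc m"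
  shows "u = v"
proof -
  have *: False if less: "u < v" and that: "v < 2 ^ Suc m" "w ^ u = w ^ v" for u v :: nat
  proof -
    have w0: "w \<noteq> 0" using w by (auto simp: power_0_left)
    have "w ^ u * w ^ (v - u) = w ^ u * 1" using less that(2) by (metis le_add_diff_inverse less_imp_le mult_1_right power_add)
    then have t1: "w ^ (v - u) = 1" using w0 by simp
    obtain t where "v - u = 2 ^ multiplicity 2 (v - u) * t" "odd t"
      by (rule multiplicity_decompose'[of "v - u" 2]) (use less in auto)
    then obtain e where t: "v - u = 2 ^ e * t" "odd t" by blast
    have "2 ^ e \<le> v - u" using t less by (metis dvd_triv_left dvd_imp_le zero_less_diff)
    then have "(2::nat) ^ e < 2 ^ Suc m" using that by linarith
    then have "e \<le> m" by (metis less_Suc_eq_le nat_power_less_imp_less zero_less_numeral)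
    then have e: "2 ^ e * t * 2 ^ (m - e) = 2 ^ m * t"
      by (metis le_add_diff_inverse mult.assoc mult.commute power_add)
    have "(w ^ (v - u)) ^ (2 ^ (m - e)) = (w ^ (2 ^ m)) ^ t"
      unfolding power_mult[symmetric] t(1) e ..
    then show False using t1 w t(2) by simp
  qed
  show ?thesis using *[of u v] *[of v u] eq uv by (metis nat_neq_iff)
qed

lemma card_roots_minus_one:
  fixes w :: complex
  assumes w: "w ^ (2 ^ m) = -1"
  shows "(\<lambda>l. w ^ (2 * l + 1)) ` {..<2 ^ m} = {z. z ^ (2 ^ m) = -1}" "card {z :: complex. z ^ (2 ^ m) = -1} = 2 ^ m"
proof -
  let ?h = "2 ^ m :: nat" and ?f = "\<lambda>l. w ^ (2 * l + 1)"
  have inj: "inj_on ?f {..<?h}"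
    by (rule inj_onI) (use power_eq_minus_one_inj[OF w] in fastforce)
  have sub: "?f ` {..<?h} \<subseteq> {z. z ^ ?h = -1}"
  proof safe
    fix l
    have "(w ^ (2 * l + 1)) ^ ?h = (w ^ ?h) ^ (2 * l + 1)" by (metis power_commutes power_mult mult.commute)
    then show "(w ^ (2 * l + 1)) ^ ?h = -1" using w by simp
  qed
  define p :: "complex poly" where "p = monom 1 ?h + 1"
  have "degree p = ?h" unfolding p_def by (simp add: degree_add_eq_left degree_monom_eq)
  then have p0: "p \<noteq> 0" by (metis degree_0 power_not_zero zero_neq_numeral)
  have R: "{z. z ^ ?h = -1} = {z. poly p z = 0}"
    by (auto simp: p_def poly_monom eq_neg_iff_add_eq_0)
  have fin: "finite {z :: complex. z ^ ?h = -1}" unfolding R using p0 by (rule poly_roots_finite)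
  have le: "card {z :: complex. z ^ ?h = -1} \<le> ?h"
    using card_poly_roots_bound[OF p0] \<open>degree p = ?h\<close> R by simp
  have "card (?f ` {..<?h}) = ?h" using inj by (simp add: card_image)
  then show "?f ` {..<?h} = {z. z ^ ?h = -1}" using fin sub le by (intro card_seteq) auto
  then show "card {z :: complex. z ^ ?h = -1} = ?h" using \<open>card (?f ` {..<?h}) = ?h\<close> by simp
qed

lemma ex_root_minus_one: "\<exists>w :: complex. w ^ (2 ^ m) = -1"
  by (intro exI[of _ "cis (pi / 2 ^ m)"]) (simp add: DeMoivre)

lemma poly_zero_on_roots_minus_one:
  fixes p :: "complex poly"
  assumes deg: "\<And>k. k \<ge> 2 ^ m \<Longrightarrow> coeff p k = 0" and z: "\<And>z. z ^ (2 ^ m) = -1 \<Longrightarrow> poly p z = 0"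
  shows "p = 0"
proof (rule ccontr)
  assume p: "p \<noteq> 0"
  obtain w :: complex where w: "w ^ (2 ^ m) = -1" using ex_root_minus_one by blast
  have "2 ^ m = card {z :: complex. z ^ (2 ^ m) = -1}" using card_roots_minus_one(2)[OF w] by simp
  also have "\<dots> \<le> card {z. poly p z = 0}" using z p by (intro card_mono poly_roots_finite) auto
  also have "\<dots> \<le> degree p" using card_poly_roots_bound[OF p] .
  finally have "2 ^ m \<le> degree p" .
  then show False using deg p by (metis leading_coeff_0_iff)
qed

lemma ipoly_sum: "ipoly (\<Sum>i\<in>I. P i) z = (\<Sum>i\<in>I. ipoly (P i) z)"
  by (induction I rule: infinite_finite_induct) (simp_all add: ipoly_simps)

text \<open>In effect the irreducibility of \<open>X ^ (2 ^ m) + 1\<close>: each root is an odd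
  power of any other, and odd exponents are coprime to the order.\<close>

lemma root_minus_one_conj:
  fixes v w :: complex
  assumes "v ^ (2 ^ m) = -1" "w ^ (2 ^ m) = -1" "ipoly P v = 0"
  shows "ipoly P w = 0"
proof -
  obtain l where l: "w = v ^ (2 * l + 1)"
    using card_roots_minus_one(1)[OF assms(1)] assms(2) by blast
  have "v ^ (2 * 2 ^ m) = 1" using assms(1) by (metis mult.commute power_mult power2_minus power_one)
  then show ?thesis unfolding l using assms(3)
    by (intro root_of_unity_conj[where M = "2 * 2 ^ m"]) (auto simp flip: power_Suc)
qed

text \<open>
  Projecting \<open>f\<close> to an eigenvector of the shift (eigenvalue \<open>1 / v\<close>, for a root \<open>v\<close> at which the projection of
  \<open>f\<close> survives) turns the relation into an integer polynomial vanishing at \<open>1 / v\<close>, hence at every conjugate.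
\<close>

lemma negacyclic_relation:
  fixes f :: "nat \<Rightarrow> complex" and n :: "'i \<Rightarrow> int" and w :: complex
  assumes f: "\<And>k. f (k + 2 ^ m) = - f k" and f0: "f 0 \<noteq> 0"
    and rel: "\<And>k. (\<Sum>i\<in>I. of_int (n i) * f (k + a i)) = 0"
    and w: "w ^ (2 ^ m) = -1"
  shows "(\<Sum>i\<in>I. of_int (n i) * w ^ a i) = 0"
proof -
  let ?h = "2 ^ m :: nat"
  define q where "q = (\<Sum>k<?h. monom (f k) k)"
  have cq: "coeff q k = (if k < ?h then f k else 0)" for k
    by (simp add: q_def coeff_sum sum.delta')
  have "q \<noteq> 0" using cq[of 0] f0 by auto
  then obtain v where v: "v ^ ?h = -1" "poly q v \<noteq> 0"
    using poly_zero_on_roots_minus_one[of m q] cq by auto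
  have v0: "v \<noteq> 0" using v(1) by (auto simp: power_0_left)
  define \<psi> where "\<psi> k = (\<Sum>l<?h. v ^ l * f (k + l))" for k
  have \<psi>0: "\<psi> 0 \<noteq> 0" using v(2) by (simp add: \<psi>_def q_def poly_sum poly_monom mult.commute)
  have step: "v * \<psi> (Suc k) = \<psi> k" for k
  proof -
    obtain h' where h': "?h = Suc h'" by (metis not0_implies_Suc power_not_zero zero_neq_numeral)
    have "v * \<psi> (Suc k) = (\<Sum>l<?h. v ^ Suc l * f (k + Suc l))"
      by (simp add: \<psi>_def sum_distrib_left mult_ac)
    also have "\<dots> = (\<Sum>l<Suc h'. v ^ Suc l * f (k + Suc l)) " by (simp add: h')
    also have "\<dots> = (\<Sum>l<h'. v ^ Suc l * f (k + Suc l)) + v ^ ?h * f (k + ?h)" by (simp only: sum.lessThan_Suc h')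
    also have "\<dots> = (\<Sum>l<h'. v ^ Suc l * f (k + Suc l)) + f k" using v f by simp
    also have "\<dots> = \<psi> k" unfolding \<psi>_def h' sum.lessThan_Suc_shift by simp
    finally show ?thesis .
  qed
  have \<psi>: "\<psi> a = inverse v ^ a * \<psi> 0" for a
  proof (induction a)
    case (Suc a)
    have "\<psi> (Suc a) = inverse v * \<psi> a" using step[of a] v0 by (simp add: field_simps)
    then show ?case using Suc by simp
  qed simp
  have "(\<Sum>i\<in>I. of_int (n i) * \<psi> (a i)) = (\<Sum>i\<in>I. \<Sum>l<?h. v ^ l * (of_int (n i) * f (l + a i)))"
    by (simp add: \<psi>_def sum_distrib_left mult_ac add_ac)
  also have "\<dots> = (\<Sum>l<?h. v ^ l * (\<Sum>i\<in>I. of_int (n i) * f (l + a i)))"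
    unfolding sum_distrib_left by (rule sum.swap)
  also have "\<dots> = 0" by (simp add: rel)
  finally have "(\<Sum>i\<in>I. of_int (n i) * \<psi> (a i)) = 0" .
  then have "(\<Sum>i\<in>I. of_int (n i) * inverse v ^ a i) * \<psi> 0 = 0"
    by (subst (asm) \<psi>) (simp add: sum_distrib_right mult.assoc)
  then have "ipoly (\<Sum>i\<in>I. monom (n i) (a i)) (inverse v) = 0"
    using \<psi>0 by (simp add: ipoly_sum ipoly_simps)
  moreover have "inverse v ^ ?h = -1" using v by (simp add: power_inverse)
  ultimately have "ipoly (\<Sum>i\<in>I. monom (n i) (a i)) w = 0" using w root_minus_one_conj by blast
  then show ?thesis by (simp add: ipoly_sum ipoly_simps)
qed

text \<open>The powers of \<open>w\<close> below \<open>2 ^ m\<close> are linearly independent over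
  the integers, so a sum of powers vanishes only if its terms cancel in opposite pairs.\<close>

lemma vanishing_sum_roots:
  fixes w :: complex
  assumes I: "finite I" and a: "\<And>i. i \<in> I \<Longrightarrow> a i < 2 * 2 ^ m"
    and w: "w ^ (2 ^ m) = -1" and sum0: "(\<Sum>i\<in>I. w ^ a i) = 0" and e: "e < 2 ^ m"
  shows "card {i \<in> I. a i = e} = card {i \<in> I. a i = e + 2 ^ m}"
proof -
  let ?h = "2 ^ m :: nat"
  \<comment> \<open>Exponents from \<open>2 ^ m\<close> on are folded back by
    \<open>w ^ (2 ^ m) = -1\<close>, so that \<open>P\<close> has degree below
    \<open>2 ^ m\<close>.\<close>
  define t where "t i = (if a i < ?h then monom 1 (a i) else monom (-1) (a i - ?h) :: int poly)" for i
  define P where "P = (\<Sum>i\<in>I. t i)"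
  have "ipoly (t i) w = w ^ a i" if "i \<in> I" for i
  proof (cases "a i < ?h")
    case False
    then have "w ^ a i = w ^ ?h * w ^ (a i - ?h)" by (simp flip: power_add)
    then show ?thesis using w False by (simp add: t_def ipoly_simps)
  qed (simp add: t_def ipoly_simps)
  then have Pw: "ipoly P w = 0" using sum0 by (simp add: P_def ipoly_sum)
  have ct: "coeff (t i) k = (if a i = k then 1 else 0) - (if a i = k + ?h then 1 else 0)" if "k < ?h" for i k
    using that by (auto simp: t_def)
  have deg: "coeff P k = 0" if "k \<ge> ?h" for k
    unfolding P_def coeff_sum
  proof (intro sum.neutral ballI)
    fix i assume "i \<in> I"
    then show "coeff (t i) k = 0" using that a[of i] by (auto simp: t_def)
  qed
  have "map_poly of_int P = (0 :: complex poly)"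
    by (rule poly_zero_on_roots_minus_one[of m])
       (use deg root_minus_one_conj[OF w _ Pw] in \<open>auto simp: coeff_map_poly\<close>)
  then have "coeff P e = 0" by (metis coeff_0 coeff_map_poly of_int_0 of_int_eq_0_iff)
  moreover have "coeff P e = int (card {i \<in> I. a i = e}) - int (card {i \<in> I. a i = e + ?h})"
    using I by (simp add: P_def coeff_sum ct[OF e] sum_subtractf flip: sum.inter_filter)
  ultimately show ?thesis by simp
qed

section \<open>Tangents\<close>

definition log_tan :: "real \<Rightarrow> real" where "log_tan x = ln \<bar>tan x\<bar>"

lemma log_tan_minus: "log_tan (- x) = log_tan x"
  by (simp add: log_tan_def)

lemma log_tan_add_int_pi: "log_tan (x + of_int m * pi) = log_tan x"
proof -
  have "sin (x + of_int m * pi) = (if even m then 1 else -1) * sin x"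
    "cos (x + of_int m * pi) = (if even m then 1 else -1) * cos x"
    by (auto simp: sin_add cos_add sin_zero_iff_int2 cos_npi_int mult.commute)
  then have "\<bar>tan (x + of_int m * pi)\<bar> = \<bar>tan x\<bar>" by (auto simp: tan_def)
  then show ?thesis by (simp add: log_tan_def)
qed

lemma log_tan_add_half_pi: "log_tan (x + pi / 2) = - log_tan x"
proof -
  have "sin (x + pi / 2) = cos x" "cos (x + pi / 2) = - sin x"
    by (simp_all add: sin_add cos_add)
  then have "tan (x + pi / 2) = - inverse (tan x)" by (simp add: tan_def)
  \<comment> \<open>If \<open>tan x = 0\<close>, both sides are \<open>0\<close> by the conventions
    for \<open>inverse 0\<close> and \<open>ln 0\<close>.\<close>
  then show ?thesis by (cases "tan x = 0") (simp_all add: log_tan_def ln_inverse)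
qed

lemma log_tan_half_pi_minus: "log_tan (pi / 2 - x) = - log_tan x"
proof -
  have "pi / 2 - x = - x + pi / 2" by simp
  then show ?thesis by (simp only: log_tan_add_half_pi log_tan_minus)
qed

lemma sin_cos_eq_0_int:
  assumes "sin (pi * of_int k / of_int N) = 0 \<or> cos (pi * of_int k / of_int N) = 0" "N > 0"
  shows "N dvd 2 * k"
proof -
  have "sin (2 * (pi * of_int k / of_int N)) = 0" using assms(1) unfolding sin_double by auto
  then obtain m :: int where "2 * (pi * of_int k / of_int N) = of_int m * pi"
    by (auto simp: sin_zero_iff_int2)
  then have "of_int (2 * k) = (of_int (m * N) :: real)" using assms(2) by (simp add: field_simps)
  then have "2 * k = m * N" by linarith
  then show ?thesis by simp
qed

lemma log_tan_cong:
  assumes "[k = l] (mod N)" "N > 0"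
  shows "log_tan (pi * of_int k / of_int N) = log_tan (pi * of_int l / of_int N)"
proof -
  obtain m where "k = l + N * m" using assms(1) by (metis cong_iff_lin cong_sym)
  then have "pi * of_int k / of_int N = pi * of_int l / of_int N + of_int m * pi"
    using assms(2) by (simp add: field_simps)
  then show ?thesis by (simp add: log_tan_add_int_pi)
qed

lemma sq_sin_cos_cong:
  assumes "[k = l] (mod N)" "N > 0"
  shows "(cos (pi * of_int k / of_int N))\<^sup>2 = (cos (pi * of_int l / of_int N))\<^sup>2" (is ?c)
    and "(sin (pi * of_int k / of_int N))\<^sup>2 = (sin (pi * of_int l / of_int N))\<^sup>2" (is ?s)
proof -
  obtain m where "k = l + N * m" using assms(1) by (metis cong_iff_lin cong_sym)
  then have *: "pi * of_int k / of_int N = pi * of_int l / of_int N + pi * of_int m"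
    using assms(2) by (simp add: field_simps)
  show ?c unfolding * cos_add by (simp add: power_mult_distrib cos_npi_int)
  then show ?s by (simp add: sin_squared_eq)
qed

section \<open>Multiples of pi / 5 and the quintuplication formula\<close>

lemma sin_cos_5:
  fixes x :: real
  shows "sin (5 * x) = sin x * (4 * (cos (2 * x))\<^sup>2 + 2 * cos (2 * x) - 1)"
    and "cos (5 * x) = cos x * (4 * (cos (2 * x))\<^sup>2 - 2 * cos (2 * x) - 1)"
proof -
  have c4: "cos (4 * x) = 2 * (cos (2 * x))\<^sup>2 - 1" using cos_double_cos[of "2 * x"] by simp
  have s4: "sin (4 * x) = 2 * sin (2 * x) * cos (2 * x)" using sin_double[of "2 * x"] by simp
  have c: "cos x * cos x = 1/2 + cos (2 * x) / 2" "sin x * sin x = 1/2 - cos (2 * x) / 2"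
    using cos_double_cos[of x] cos_double_sin[of x] unfolding power2_eq_square by linarith+
  define C where "C = cos (2 * x)"
  note s2 = sin_double[of x]
  have "sin (5 * x) = sin (4 * x) * cos x + cos (4 * x) * sin x"
    using sin_add[of "4 * x" x] by simp
  also have "\<dots> = sin x * (4 * C * (cos x * cos x) + 2 * C\<^sup>2 - 1)"
    unfolding s4 c4 s2 C_def[symmetric] by (simp add: algebra_simps)
  also have "\<dots> = sin x * (4 * C\<^sup>2 + 2 * C - 1)"
    unfolding c C_def[symmetric] by (simp add: algebra_simps power2_eq_square)
  finally show "sin (5 * x) = sin x * (4 * (cos (2 * x))\<^sup>2 + 2 * cos (2 * x) - 1)"
    unfolding C_def .
  have "cos (5 * x) = cos (4 * x) * cos x - sin (4 * x) * sin x"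
    using cos_add[of "4 * x" x] by simp
  also have "\<dots> = cos x * (2 * C\<^sup>2 - 1 - 4 * C * (sin x * sin x))"
    unfolding s4 c4 s2 C_def[symmetric] by (simp add: algebra_simps)
  also have "\<dots> = cos x * (4 * C\<^sup>2 - 2 * C - 1)"
    unfolding c C_def[symmetric] by (simp add: algebra_simps power2_eq_square)
  finally show "cos (5 * x) = cos x * (4 * (cos (2 * x))\<^sup>2 - 2 * cos (2 * x) - 1)"
    unfolding C_def .
qed

text \<open>Both conjugates of the squared cosine of \<open>pi / 5\<close> satisfy this quadratic,
  so later computations do not depend on which multiple \<open>c\<close> occurs.\<close>

lemma cos_fifth:
  assumes c: "\<not> 5 dvd (c :: int)"
  defines "X \<equiv> (cos (pi * of_int c / 5))\<^sup>2"
  shows "16 * X\<^sup>2 - 12 * X + 1 = 0"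
proof -
  let ?y = "pi * of_int c / 5"
  have "sin ?y \<noteq> 0"
  proof
    assume "sin ?y = 0"
    then have "5 dvd 2 * c" using sin_cos_eq_0_int[of c 5] by simp
    then show False using c by presburger
  qed
  moreover have "sin (5 * ?y) = 0" by (simp add: sin_zero_iff_int2 mult.commute)
  ultimately have "4 * (cos (2 * ?y))\<^sup>2 + 2 * cos (2 * ?y) - 1 = 0"
    unfolding sin_cos_5 by simp
  moreover have "cos (2 * ?y) = 2 * X - 1" unfolding X_def by (rule cos_double_cos)
  ultimately have "4 * (2 * X - 1)\<^sup>2 + 2 * (2 * X - 1) - 1 = 0" by (simp only:)
  then show ?thesis by (simp add: power2_eq_square algebra_simps)
qed

lemma tan_add_mult_tan_diff:
  fixes x y :: real
  shows
  "tan (x + y) * tan (x - y) = (cos (2 * y) - cos (2 * x)) / (cos (2 * y) + cos (2 * x))"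
proof -
  have 2: "(x + y) - (x - y) = 2 * y" "(x + y) + (x - y) = 2 * x" by simp_all
  have "cos (2 * y) - cos (2 * x) = 2 * (sin (x + y) * sin (x - y))"
    "cos (2 * y) + cos (2 * x) = 2 * (cos (x + y) * cos (x - y))"
    using cos_diff[of "x + y" "x - y", unfolded 2] cos_add[of "x + y" "x - y", unfolded 2] by simp_all
  then show ?thesis by (simp add: tan_def)
qed

text \<open>Pairing opposite shifts leaves \<open>(a - c) * (b - c)\<close> over
  \<open>(a + c) * (b + c)\<close>, where \<open>a\<close> and \<open>b\<close> are the two roots of
  \<open>4 * t\<^sup>2 + 2 * t - 1\<close>. Up to the factor 4 these are the quadratic factors of
  \<open>sin (5 * x)\<close> and \<open>cos (5 * x)\<close>.\<close>

lemma tan_5_prod: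
  "tan x * (tan (x + pi / 5) * tan (x - pi / 5)) * (tan (x + 2 * pi / 5) * tan (x - 2 * pi / 5)) = tan (5 * x)"
proof -
  define a where "a = cos (2 * pi / 5)"
  define b where "b = cos (4 * pi / 5)"
  define c where "c = cos (2 * x)"
  have b: "b = 2 * a\<^sup>2 - 1" unfolding a_def b_def using cos_double_cos[of "2 * pi / 5"] by simp
  have "sin (5 * (pi / 5)) = 0" by simp
  moreover have "sin (pi / 5) \<noteq> 0" by (simp add: sin_gt_zero order_less_imp_not_eq2)
  ultimately have a: "4 * a\<^sup>2 + 2 * a - 1 = 0"
    unfolding sin_cos_5[of "pi / 5"] a_def by simp
  have ab: "a + b = - 1/2" "a * b = - 1/4"
  proof -
    show "a + b = - 1/2" using a b by simp
    then have b': "b = - 1/2 - a" by simp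
    show "a * b = - 1/4" unfolding b' using a by (simp add: power2_eq_square algebra_simps)
  qed
  have n: "4 * ((a - c) * (b - c)) = 4 * c\<^sup>2 + 2 * c - 1" "4 * ((a + c) * (b + c)) = 4 * c\<^sup>2 - 2 * c - 1"
  proof -
    have "4 * ((a - c) * (b - c)) = 4 * (a * b) - 4 * c * (a + b) + 4 * c\<^sup>2"
      "4 * ((a + c) * (b + c)) = 4 * (a * b) + 4 * c * (a + b) + 4 * c\<^sup>2"
      by (simp_all add: power2_eq_square algebra_simps)
    then show "4 * ((a - c) * (b - c)) = 4 * c\<^sup>2 + 2 * c - 1" "4 * ((a + c) * (b + c)) = 4 * c\<^sup>2 - 2 * c - 1"
      unfolding ab by simp_all
  qed
  have "tan x * (tan (x + pi / 5) * tan (x - pi / 5)) * (tan (x + 2 * pi / 5) * tan (x - 2 * pi / 5))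
    = tan x * ((a - c) / (a + c)) * ((b - c) / (b + c))"
    unfolding tan_add_mult_tan_diff by (simp add: a_def b_def c_def)
  also have "\<dots> = tan x * ((4 * ((a - c) * (b - c))) / (4 * ((a + c) * (b + c))))"
    by simp
  also have "\<dots> = tan (5 * x)" unfolding n tan_def sin_cos_5 c_def[symmetric] by simp
  finally show ?thesis .
qed

lemma ln_abs_mult: "a \<noteq> 0 \<Longrightarrow> b \<noteq> 0 \<Longrightarrow> ln \<bar>a * b\<bar> = ln \<bar>a\<bar> + ln \<bar>b :: real\<bar>"
  by (simp add: abs_mult ln_mult)

lemma ln_abs_div: "a \<noteq> 0 \<Longrightarrow> b \<noteq> 0 \<Longrightarrow> ln \<bar>a / b\<bar> = ln \<bar>a\<bar> - ln \<bar>b :: real\<bar>"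
  by (simp add: ln_div)

lemma log_tan_5:
  assumes "tan (5 * x) \<noteq> 0"
  shows "log_tan (5 * x) = (\<Sum>m\<in>{0..<5::int}. log_tan (x + of_int m * pi / 5))"
proof -
  note P = tan_5_prod[of x]
  \<comment> \<open>As \<open>tan\<close> is \<open>0\<close> at its poles by convention, the
    nonzero product excludes poles and zeros alike.\<close>
  have nz: "tan x \<noteq> 0" "tan (x + pi / 5) \<noteq> 0" "tan (x - pi / 5) \<noteq> 0"
    "tan (x + 2 * pi / 5) \<noteq> 0" "tan (x - 2 * pi / 5) \<noteq> 0" using assms unfolding P[symmetric] by auto
  have "log_tan (5 * x) = log_tan x + log_tan (x + pi / 5) + log_tan (x - pi / 5) + log_tan (x + 2 * pi / 5) + log_tan (x - 2 * pi / 5)"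
    unfolding log_tan_def P[symmetric] using nz by (simp add: ln_abs_mult)
  moreover have "log_tan (x - pi / 5) = log_tan (x + 4 * pi / 5)" "log_tan (x - 2 * pi / 5) = log_tan (x + 3 * pi / 5)"
    using log_tan_add_int_pi[of "x - pi / 5" 1] log_tan_add_int_pi[of "x - 2 * pi / 5" 1] by (simp_all add: algebra_simps)
  moreover have "{0..<5::int} = {0,1,2,3,4}" by auto
  ultimately show ?thesis by simp
qed

lemma abs_eq_abs_cases: "\<bar>a\<bar> = \<bar>b :: real\<bar> \<Longrightarrow> a = b \<or> a = - b"
  by linarith

section \<open>Separating products and quotients of two tangents\<close>

text \<open>With \<open>P\<close> and \<open>C\<close> the cosines of difference and sum,
  \<open>tan x * tan x' = (P - C) / (P + C)\<close>, and equal absolute values force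
  \<open>P * C' = C * Q\<close> or \<open>P * Q = C * C'\<close>. Squares are used because sums and
  differences of the angles will be known only up to multiples of \<open>pi\<close>.\<close>

lemma tan_mult_tan_ne:
  fixes x x' y y' :: real
  assumes nz: "cos x \<noteq> 0" "cos x' \<noteq> 0" "cos y \<noteq> 0" "cos y' \<noteq> 0"
    and M: "(cos (x + x'))\<^sup>2 = M" "(cos (y + y'))\<^sup>2 = M" "M \<noteq> 0"
    and PQ: "(cos (x - x'))\<^sup>2 \<noteq> (cos (y - y'))\<^sup>2" "(cos (x - x'))\<^sup>2 * (cos (y - y'))\<^sup>2 \<noteq> M\<^sup>2"
  shows "\<bar>tan x * tan x'\<bar> \<noteq> \<bar>tan y * tan y'\<bar>"
proof
  define C where "C = cos (x + x')"
  define P where "P = cos (x - x')"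
  define C' where "C' = cos (y + y')"
  define Q where "Q = cos (y - y')"
  have e: "2 * (cos x * cos x') = P + C" "2 * (sin x * sin x') = P - C"
    "2 * (cos y * cos y') = Q + C'" "2 * (sin y * sin y') = Q - C'"
    by (simp_all add: P_def C_def Q_def C'_def cos_add cos_diff)
  have nz': "P + C \<noteq> 0" "Q + C' \<noteq> 0" using nz by (simp_all flip: e)
  assume "\<bar>tan x * tan x'\<bar> = \<bar>tan y * tan y'\<bar>"
  moreover have "tan x * tan x' = (P - C) / (P + C)" "tan y * tan y' = (Q - C') / (Q + C')"
    by (simp_all add: tan_def flip: e)
  ultimately have "\<bar>(P - C) / (P + C)\<bar> = \<bar>(Q - C') / (Q + C')\<bar>" by simp
  then have "(P - C) / (P + C) = (Q - C') / (Q + C') \<or> (P - C) / (P + C) = - ((Q - C') / (Q + C'))"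
    by (rule abs_eq_abs_cases)
  then have "(P - C) * (Q + C') = (Q - C') * (P + C) \<or> (P - C) * (Q + C') = - ((Q - C') * (P + C))"
    using nz' by (simp add: field_simps)
  then have "P * C' = C * Q \<or> P * Q = C * C'" by (auto simp: algebra_simps)
  then have "P\<^sup>2 * C'\<^sup>2 = C\<^sup>2 * Q\<^sup>2 \<or> P\<^sup>2 * Q\<^sup>2 = C\<^sup>2 * C'\<^sup>2" by (metis power_mult_distrib)
  then show False using M PQ unfolding C_def[symmetric] C'_def[symmetric] P_def[symmetric] Q_def[symmetric]
    by (auto simp: power2_eq_square)
qed

text \<open>The analogue for quotients: with \<open>S\<close> and \<open>P\<close> the sines of sum
  and difference, \<open>tan x / tan x' = (S + P) / (S - P)\<close>.\<close>

lemma log_tan_diff_ne: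
  assumes nz: "cos x \<noteq> 0" "cos x' \<noteq> 0" "cos y \<noteq> 0" "cos y' \<noteq> 0"
    "sin x \<noteq> 0" "sin x' \<noteq> 0" "sin y \<noteq> 0" "sin y' \<noteq> 0"
    and PQ: "(sin (x - x'))\<^sup>2 * (sin (y + y'))\<^sup>2 \<noteq> (sin (x + x'))\<^sup>2 * (sin (y - y'))\<^sup>2"
     "(sin (x + x'))\<^sup>2 * (sin (y + y'))\<^sup>2 \<noteq> (sin (x - x'))\<^sup>2 * (sin (y - y'))\<^sup>2"
  shows "log_tan x - log_tan x' \<noteq> log_tan y - log_tan y'"
proof
  define S where "S = sin (x + x')"
  define P where "P = sin (x - x')"
  define S' where "S' = sin (y + y')"
  define Q where "Q = sin (y - y')"
  have e: "2 * (sin x * cos x') = S + P" "2 * (cos x * sin x') = S - P"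
    "2 * (sin y * cos y') = S' + Q" "2 * (cos y * sin y') = S' - Q"
    by (simp_all add: P_def S_def Q_def S'_def sin_add sin_diff)
  have nz': "S - P \<noteq> 0" "S' - Q \<noteq> 0" "S + P \<noteq> 0" "S' + Q \<noteq> 0" using nz by (simp_all flip: e)
  have "tan x / tan x' = (S + P) / (S - P)" "tan y / tan y' = (S' + Q) / (S' - Q)"
    by (simp_all add: tan_def flip: e)
  moreover have "log_tan x - log_tan x' = ln \<bar>tan x / tan x'\<bar>" "log_tan y - log_tan y' = ln \<bar>tan y / tan y'\<bar>"
    unfolding log_tan_def by (rule ln_abs_div[symmetric]; use nz in \<open>simp add: tan_def\<close>)+
  moreover assume "log_tan x - log_tan x' = log_tan y - log_tan y'"
  ultimately have "\<bar>(S + P) / (S - P)\<bar> = \<bar>(S' + Q) / (S' - Q)\<bar>" using nz' by simp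
  then have "(S + P) / (S - P) = (S' + Q) / (S' - Q) \<or> (S + P) / (S - P) = - ((S' + Q) / (S' - Q))"
    by (rule abs_eq_abs_cases)
  then have "(S + P) * (S' - Q) = (S' + Q) * (S - P) \<or> (S + P) * (S' - Q) = - ((S' + Q) * (S - P))"
    using nz' by (simp add: field_simps)
  then have "P * S' = S * Q \<or> S * S' = P * Q" by (auto simp: algebra_simps)
  then have "P\<^sup>2 * S'\<^sup>2 = S\<^sup>2 * Q\<^sup>2 \<or> S\<^sup>2 * S'\<^sup>2 = P\<^sup>2 * Q\<^sup>2" by (metis power_mult_distrib)
  then show False using PQ unfolding S_def S'_def P_def Q_def by auto
qed

section \<open>Conjugating multiplicative relations between tangents\<close>

text \<open>\<open>tan z\<close> equals \<open>- \<i> * (c - 1) / (c + 1)\<close> with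
  \<open>c = cis (2 * z)\<close>. Squaring removes \<open>\<i>\<close>, which need not be a power of
  the root of unity in use, and leaves integer coefficients.\<close>

lemma tan_sq_cis:
  assumes "cos z \<noteq> 0"
  shows "of_real ((tan z)\<^sup>2) * (cis (2 * z) + 1)\<^sup>2 = - (cis (2 * z) - 1)\<^sup>2" "cis (2 * z) + 1 \<noteq> 0"
proof -
  have p: "cis (2 * z) + 1 = cis z * of_real (2 * cos z)"
    by (simp add: complex_eq_iff cos_double_cos sin_double power2_eq_square)
  have m: "cis (2 * z) - 1 = cis z * (\<i> * of_real (2 * sin z))"
    by (simp add: complex_eq_iff cos_double_sin sin_double power2_eq_square)
  have "tan z * cos z = sin z" using assms by (simp add: tan_def)
  then have "(of_real (tan z) :: complex) * of_real (cos z) = of_real (sin z)" by (metis of_real_mult)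
  then have "of_real (tan z) * (cis (2 * z) + 1) = - \<i> * (cis (2 * z) - 1)"
    unfolding p m by (simp add: mult_ac)
  then have "(of_real (tan z) * (cis (2 * z) + 1))\<^sup>2 = (- \<i> * (cis (2 * z) - 1))\<^sup>2" by simp
  then show "of_real ((tan z)\<^sup>2) * (cis (2 * z) + 1)\<^sup>2 = - (cis (2 * z) - 1)\<^sup>2"
    by (simp add: power_mult_distrib)
  show "cis (2 * z) + 1 \<noteq> 0" using assms unfolding p by simp
qed

lemma tan_relation_conj:
  fixes k :: "'i \<Rightarrow> nat"
  assumes I: "finite I" and M: "M > 0" and u: "coprime u M"
    and z: "\<And>i. i \<in> I \<Longrightarrow> z i = pi * of_nat (k i) / of_nat M"
    and c: "\<And>i. i \<in> I \<Longrightarrow> cos (z i) \<noteq> 0" "\<And>i. i \<in> I \<Longrightarrow> cos (of_nat u * z i) \<noteq> 0"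
    and rel: "(\<Prod>i\<in>I. (tan (z i))\<^sup>2) = 1"
  shows "(\<Prod>i\<in>I. (tan (of_nat u * z i))\<^sup>2) = 1"
proof -
  define w where "w = cis (2 * pi / of_nat M)"
  have w: "w ^ M = 1" using M by (simp add: w_def DeMoivre)
  have wk: "cis (2 * (of_nat v * z i)) = (w ^ v) ^ k i" if "i \<in> I" for v i
    unfolding w_def by (simp add: z[OF that] DeMoivre power_mult[symmetric] mult_ac)
  \<comment> \<open>The relation with denominators cleared. Its value at \<open>w ^ v\<close>
    belongs to the angles \<open>v * z i\<close>, and the cleared denominators are nonzero as long
    as no cosine vanishes.\<close>
  define P where "P = (\<Prod>i\<in>I. (monom 1 (k i) + 1)\<^sup>2) - (\<Prod>i\<in>I. - ((monom 1 (k i) - 1)\<^sup>2) :: int poly)"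
  have prod: "ipoly (\<Prod>i\<in>I. F i) x = (\<Prod>i\<in>I. ipoly (F i) x)" for F x
    using I by (induction I rule: finite_induct) (simp_all add: ipoly_simps)
  have um: "ipoly (- F) x = - ipoly F x" for F x using ipoly_simps(5)[of 0 F x] by simp
  have Pw: "ipoly P (w ^ v) = (\<Prod>i\<in>I. (cis (2 * (of_nat v * z i)) + 1)\<^sup>2) - (\<Prod>i\<in>I. - ((cis (2 * (of_nat v * z i)) - 1)\<^sup>2))" for v
    unfolding P_def by (simp add: prod ipoly_simps um wk cong: prod.cong)
  have key: "(\<Prod>i\<in>I. - ((cis (2 * (of_nat v * z i)) - 1)\<^sup>2)) = of_real (\<Prod>i\<in>I. (tan (of_nat v * z i))\<^sup>2) * (\<Prod>i\<in>I. (cis (2 * (of_nat v * z i)) + 1)\<^sup>2)"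
    and nz: "(\<Prod>i\<in>I. (cis (2 * (of_nat v * z i)) + 1)\<^sup>2) \<noteq> 0"
    if v: "\<And>i. i \<in> I \<Longrightarrow> cos (of_nat v * z i) \<noteq> 0" for v
    using tan_sq_cis[OF v] I by (simp_all add: of_real_prod prod.distrib[symmetric])
  let ?X = "of_real (\<Prod>i\<in>I. (tan (of_nat u * z i))\<^sup>2) :: complex"
  let ?Y = "\<Prod>i\<in>I. (cis (2 * (of_nat u * z i)) + 1)\<^sup>2"
  have "ipoly P (w ^ 1) = 0" unfolding Pw using key[of 1] c(1) rel by simp
  then have "ipoly P (w ^ u) = 0" using root_of_unity_conj[OF w M u] by simp
  moreover have "ipoly P (w ^ u) = (1 - ?X) * ?Y"
    using key[OF c(2)] unfolding Pw by (simp add: left_diff_distrib)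
  ultimately have "(1 - ?X) * ?Y = 0" by simp
  moreover have "?Y \<noteq> 0" by (rule nz[OF c(2)])
  ultimately have "?X = 1" by (simp only: mult_eq_0_iff) simp
  then show ?thesis by (simp only: of_real_eq_1_iff)
qed

section \<open>Relations at a fixed 2-adic level\<close>

lemma coprime_10_iff: "coprime (v :: int) 10 \<longleftrightarrow> odd v \<and> \<not> 5 dvd v"
proof -
  have "prime (5::int)" by simp
  then have "coprime v 5 \<longleftrightarrow> \<not> 5 dvd v"
    by (metis coprime_commute prime_imp_coprime not_coprimeI dvd_refl not_prime_unit)
  moreover have "(10::int) = 2 * 5" by simp
  ultimately show ?thesis by (metis coprime_mult_right_iff coprime_right_2_iff_odd)
qed

lemma five_power_twopower: "[5 ^ (2 ^ i) = 1 + 2 ^ (i + 2)] (mod (2 :: int) ^ (i + 3))"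
proof (induction i)
  case (Suc i)
  then obtain q where q: "5 ^ (2 ^ i) = 1 + 2 ^ (i + 2) + 2 ^ (i + 3) * (q :: int)"
    by (metis cong_iff_lin cong_sym)
  define r where "r = 1 + 2 * q"
  have q': "5 ^ (2 ^ i) = 1 + 2 ^ (i + 2) * r" unfolding q r_def by (simp add: algebra_simps power_add)
  have "(5::int) ^ (2 ^ Suc i) = (1 + 2 ^ (i + 2) * r)\<^sup>2" unfolding q'[symmetric] by (simp flip: power_mult add: mult.commute)
  also have "\<dots> = 1 + 2 ^ (Suc i + 2) + 2 ^ (Suc i + 3) * (q + 2 ^ i * r\<^sup>2)"
    by (simp add: r_def power2_eq_square algebra_simps power_add)
  finally show ?case by (simp add: cong_def)
qed (simp add: cong_def)

text \<open>Up to sign, \<open>5\<close> generates the units modulo a power of 2. When the modulus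
  doubles and the quotient \<open>q\<close> is odd, raising the exponent by \<open>2 ^ i\<close>
  makes the correction, because \<open>5 ^ (2 ^ i)\<close> is \<open>1 + 2 ^ (i + 2)\<close> modulo
  \<open>2 ^ (i + 3)\<close>.\<close>

lemma odd_cong_five_power:
  assumes "odd (k :: int)"
  shows "\<exists>a < 2 ^ i. \<exists>s \<in> {1, -1}. [s * k = 5 ^ a] (mod 2 ^ (i + 2))"
proof (induction i)
  case 0
  have "[k = 1] (mod 4) \<or> [- k = 1] (mod 4)" using assms unfolding cong_def by presburger
  then show ?case by auto
next
  case (Suc i)
  then obtain a s where a: "a < 2 ^ i" and s: "s \<in> {1, -1}" and "[s * k = 5 ^ a] (mod 2 ^ (i + 2))" by blast
  then obtain q where q: "s * k = 5 ^ a + 2 ^ (i + 2) * q" by (metis cong_iff_lin cong_sym)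
  show ?case
  proof (cases "even q")
    case True
    then have "[s * k = 5 ^ a] (mod 2 ^ (Suc i + 2))" unfolding q by (auto simp: cong_iff_dvd_diff elim!: evenE)
    then show ?thesis using a s by (intro exI[of _ a]) auto
  next
    case False
    then obtain q' where q': "q = 2 * q' + 1" by (rule oddE)
    obtain c where c: "5 ^ (2 ^ i) = 1 + 2 ^ (i + 2) + 2 ^ (i + 3) * (c :: int)"
      using five_power_twopower[of i] by (metis cong_iff_lin cong_sym)
    have "odd ((5 :: int) ^ a)" by simp
    then obtain t where t: "(5 :: int) ^ a = 2 * t + 1" by (rule oddE)
    have "s * k - 5 ^ (a + 2 ^ i) = 2 ^ (i + 2) * q - 5 ^ a * 2 ^ (i + 2) - 2 ^ (i + 3) * (c * 5 ^ a)"
      unfolding q power_add[of 5 a] c by (simp add: algebra_simps)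
    also have "\<dots> = 2 ^ (Suc i + 2) * (q' - t - c * 5 ^ a)"
      unfolding q' t by (simp add: algebra_simps power_add)
    finally have "[s * k = 5 ^ (a + 2 ^ i)] (mod 2 ^ (Suc i + 2))"
      by (simp add: cong_iff_dvd_diff)
    then show ?thesis using a s by (intro exI[of _ "a + 2 ^ i"]) auto
  qed
qed

text \<open>
  Modulo \<open>5 * 2 ^ j\<close> the units up to sign are generated by \<open>g\<close>, of order \<open>2 * h\<close> with \<open>h = 2 ^ (j - 3)\<close>, and
  \<open>d\<close>, of order 4; multiplication by \<open>g ^ h\<close> shifts an odd multiple of \<open>pi / (5 * 2 ^ j)\<close> by \<open>pi / 2\<close>.
\<close>

locale level =
  fixes j :: nat and g d :: int
  assumes j: "3 \<le> j"
    and g: "[g = 5] (mod 2 ^ j)" "[g = 1] (mod 5)"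
    and d: "[d = 1] (mod 2 ^ j)" "[d = 2] (mod 5)"
begin

abbreviation N :: int where "N \<equiv> 5 * 2 ^ j"
abbreviation h :: nat where "h \<equiv> 2 ^ (j - 3)"

definition T :: "int \<Rightarrow> real" where "T k = log_tan (pi * of_int k / of_int N)"

text \<open>Every odd residue is, up to sign, \<^term>\<open>e b * g ^ a\<close>; the class \<open>b = 4\<close> collects the multiples of 5.\<close>

definition e :: "nat \<Rightarrow> int" where "e b = (if b < 4 then d ^ b else 5)"

lemma cong_N: "[a = b] (mod 2 ^ j) \<Longrightarrow> [a = b] (mod 5) \<Longrightarrow> [a = b] (mod N)"
  using coprime_cong_mult[of a b 5 "2 ^ j"] by simp

lemma cong_N_D:
  assumes "[a = b] (mod N)" shows "[a = b] (mod 2 ^ j)" "[a = b] (mod 5)"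
  using assms by (meson cong_dvd_modulus dvd_triv_left dvd_triv_right)+

lemma two_power_j: "(2::int) ^ j = 8 * 2 ^ (j - 3)" "(2::int) ^ (j - 1) = 4 * 2 ^ (j - 3)"
proof -
  obtain i where "j = i + 3" using j by (metis le_add_diff_inverse2)
  then show "(2::int) ^ j = 8 * 2 ^ (j - 3)" "(2::int) ^ (j - 1) = 4 * 2 ^ (j - 3)"
    by (simp_all add: power_add)
qed

lemma even_g_d: "coprime g 10" "coprime d 10"
proof -
  have "(2::int) dvd 2 ^ j" using j by simp
  then have "[g = 5] (mod 2)" "[d = 1] (mod 2)" using g d by (meson cong_dvd_modulus)+
  then show "coprime g 10" "coprime d 10" unfolding coprime_10_iff using g(2) d(2)
    by (auto simp: cong_def)
qed

lemma T_cong: "[k = l] (mod N) \<Longrightarrow> T k = T l"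
  unfolding T_def by (rule log_tan_cong) simp_all

lemma T_minus: "T (- k) = T k"
  using log_tan_minus[of "pi * of_int k / of_int N"] by (simp add: T_def)

lemma T_half: "T (k + 5 * 2 ^ (j - 1)) = - T k"
proof -
  have "pi * of_int (k + 5 * 2 ^ (j - 1)) / of_int N = pi * of_int k / of_int N + pi / 2"
    unfolding two_power_j by (simp add: field_simps)
  then show ?thesis unfolding T_def by (simp only: log_tan_add_half_pi)
qed

lemma g_power_h: "[g ^ h = 1 + 5 * 2 ^ (j - 1)] (mod N)"
proof (rule cong_N)
  have "[g ^ h = 5 ^ h] (mod 2 ^ j)" using g(1) by (rule cong_pow)
  also have "[5 ^ h = 1 + 2 ^ (j - 1)] (mod (2::int) ^ j)"
    using five_power_twopower[of "j - 3"] j by (simp add: Suc_diff_le numeral_eq_Suc flip: Suc_diff_le)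
  also have "[1 + 2 ^ (j - 1) = 1 + 5 * 2 ^ (j - 1)] (mod (2::int) ^ j)"
    unfolding cong_iff_dvd_diff two_power_j by simp
  finally show "[g ^ h = 1 + 5 * 2 ^ (j - 1)] (mod 2 ^ j)" .
  have "[g ^ h = 1 ^ h] (mod 5)" using g(2) by (rule cong_pow)
  then show "[g ^ h = 1 + 5 * 2 ^ (j - 1)] (mod 5)" by (simp add: cong_def mod_add_eq)
qed

lemma odd_add_half: 
  assumes "odd k" "[x = 1 + 5 * 2 ^ (j - 1)] (mod N)" shows "[x * k = k + 5 * 2 ^ (j - 1)] (mod N)"
proof -
  obtain q where q: "k = 2 * q + 1" using assms(1) by (rule oddE)
  have "[x * k = (1 + 5 * 2 ^ (j - 1)) * k] (mod N)" using assms(2) by (rule cong_scalar_right)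
  moreover have "(1 + 5 * 2 ^ (j - 1)) * k = k + 5 * 2 ^ (j - 1) + N * q"
    unfolding q two_power_j by (simp add: algebra_simps)
  ultimately show ?thesis by (simp add: cong_def)
qed

lemma T_g_power_h: "odd k \<Longrightarrow> T (g ^ h * k) = - T k"
  using T_cong[OF odd_add_half[OF _ g_power_h]] T_half by simp

lemma d_power_4: "[d ^ 4 = 1] (mod N)"
proof (rule cong_N)
  show "[d ^ 4 = 1] (mod 2 ^ j)" using cong_pow[OF d(1), of 4] by simp
  show "[d ^ 4 = 1] (mod 5)" using cong_pow[OF d(2), of 4] by (simp add: cong_def)
qed

lemma d_5: "[5 * d = 5] (mod N)"
  using d(1) by (metis cong_cmult_leftI mult_1_right)

lemma T_d_power_4: "T (d * (d * (d * (d * k)))) = T k"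
  using T_cong[OF cong_scalar_right[OF d_power_4, of k]] by (simp add: power4_eq_xxxx mult.assoc)

lemma T_d_5: "T (d * (5 * k)) = T (5 * k)"
  using T_cong[OF cong_scalar_right[OF d_5, of k]] by (simp add: mult_ac)

lemma odd_not_N_dvd: "odd k \<Longrightarrow> \<not> N dvd 2 * k"
proof
  assume "odd k" "N dvd 2 * k"
  moreover have "4 dvd N" unfolding two_power_j by simp
  ultimately have "4 dvd 2 * k" by (metis dvd_trans)
  with \<open>odd k\<close> show False by presburger
qed

lemma sin_cos_nz: "odd k \<Longrightarrow> sin (pi * of_int k / of_int N) \<noteq> 0" "odd k \<Longrightarrow> cos (pi * of_int k / of_int N) \<noteq> 0"
  using sin_cos_eq_0_int[of k N] odd_not_N_dvd[of k] by fastforce+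

text \<open>This is the identity \<open>tan (5 * x) = \<Prod>m<5. tan (x + m * pi / 5)\<close>.\<close>

lemma T_distribution:
  assumes v: "coprime v 10"
  shows "T (5 * (g * v)) = T (g * v) + T (d * (g * v)) + T (d * (d * (g * v))) + T (d * (d * (d * (g * v)))) + T (5 * v)"
proof -
  let ?u = "g * v"
  have u: "coprime ?u 10" using v even_g_d by simp
  have odd: "odd (5 * ?u)" using u unfolding coprime_10_iff by simp
  \<comment> \<open>All five residues agree with \<open>g * v\<close> modulo \<open>2 ^ j\<close>,
    the last one because \<open>g\<close> is \<open>5\<close> there, and they exhaust the classes
    modulo 5. Hence they are \<open>g * v + 2 ^ j * m\<close> with \<open>m\<close> running through
    all residues modulo 5, as in the formula.\<close>
  define w where "w b = (if b < 4 then d ^ b * ?u else 5 * v)" for b :: nat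
  have w2: "[w b = ?u] (mod 2 ^ j)" for b
  proof (cases "b < 4")
    case True
    have "[d ^ b = 1 ^ b] (mod 2 ^ j)" using d(1) by (rule cong_pow)
    then have "[d ^ b * ?u = 1 * ?u] (mod 2 ^ j)" by (intro cong_scalar_right) simp
    then show ?thesis using True by (simp add: w_def)
  next
    case False
    then show ?thesis using g(1) by (simp add: w_def cong_scalar_right cong_sym)
  qed
  define t where "t b = (if b < 4 then 2 ^ b else 0 :: int)" for b :: nat
  have w5: "[w b = t b * ?u] (mod 5)" for b
    using cong_scalar_right[OF cong_pow[OF d(2), of b], of ?u] by (simp add: w_def t_def cong_0_iff)
  have inj: "b = b'" if "b < 5" "b' < 5" "[w b = w b'] (mod 5)" for b b'
  proof -
    have "[t b * ?u = t b' * ?u] (mod 5)"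
      by (rule cong_trans[OF cong_trans[OF cong_sym[OF w5] that(3)] w5])
    then have "[t b = t b'] (mod 5)"
      by (rule cong_mult_rcancel[THEN iffD1, rotated])
         (use u in \<open>simp add: coprime_mult_right_iff[of _ 2 5, simplified]\<close>)
    moreover have "b = 0 \<or> b = 1 \<or> b = 2 \<or> b = 3 \<or> b = 4" "b' = 0 \<or> b' = 1 \<or> b' = 2 \<or> b' = 3 \<or> b' = 4"
      using that by auto
    ultimately show ?thesis by (elim disjE) (simp_all add: t_def cong_def)
  qed
  define m where "m b = ((w b - ?u) div 2 ^ j) mod 5" for b
  have Tm: "T (w b) = log_tan (pi * of_int ?u / of_int N + of_int (m b) * pi / 5)" 
    and mw: "[w b = ?u + 2 ^ j * m b] (mod N)" for b
  proof -
    obtain q where q: "w b = ?u + 2 ^ j * q" using w2[of b] by (metis cong_iff_lin cong_sym)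
    then have "m b = q mod 5" by (simp add: m_def)
    then have "[q = m b] (mod 5)" by (simp add: cong_def)
    then have "[2 ^ j * q = 2 ^ j * m b] (mod 2 ^ j * 5)" by (rule cong_cmult_leftI)
    then show mw: "[w b = ?u + 2 ^ j * m b] (mod N)" unfolding q by (simp add: mult.commute cong_add_lcancel)
    have "pi * of_int (?u + 2 ^ j * m b) / of_int N = pi * of_int ?u / of_int N + of_int (m b) * pi / 5"
      by (simp add: field_simps)
    then show "T (w b) = log_tan (pi * of_int ?u / of_int N + of_int (m b) * pi / 5)"
      using T_cong[OF mw] by (simp add: T_def)
  qed
  have inj_m: "inj_on m {..<5}"
  proof (rule inj_onI)
    fix b b' assume "b \<in> {..<5}" "b' \<in> {..<5}" "m b = m b'"
    then have "[w b = w b'] (mod N)" using cong_trans[OF mw[of b]] cong_sym[OF mw[of b']] by simp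
    then show "b = b'" using inj \<open>b \<in> {..<5}\<close> \<open>b' \<in> {..<5}\<close> cong_N_D(2) by auto
  qed
  have img: "m ` {..<5} = {0..<5}"
  proof (rule card_subset_eq)
    show "m ` {..<5} \<subseteq> {0..<5}" by (auto simp: m_def)
    show "card (m ` {..<5}) = card {0..<5::int}" by (simp add: card_image[OF inj_m])
  qed simp
  let ?x = "pi * of_int ?u / of_int N"
  have x5: "pi * of_int (5 * ?u) / of_int N = 5 * ?x" by simp
  have "tan (5 * ?x) \<noteq> 0" using sin_cos_nz[OF odd] unfolding x5 tan_def by simp
  then have "T (5 * ?u) = (\<Sum>m\<in>{0..<5::int}. log_tan (?x + of_int m * pi / 5))"
    unfolding T_def x5 by (rule log_tan_5)
  also have "\<dots> = (\<Sum>b<5. T (w b))"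
    unfolding img[symmetric] sum.reindex[OF inj_m] by (simp add: Tm)
  also have "\<dots> = T (w 0) + T (w 1) + T (w 2) + T (w 3) + T (w 4)"
    by (simp add: numeral_eq_Suc)
  finally show ?thesis by (simp add: w_def power2_eq_square power3_eq_cube mult.assoc)
qed

end

section \<open>Nonvanishing of the components\<close>

lemma fifth_quadratic_powers:
  fixes X :: real
  assumes "16 * X\<^sup>2 - 12 * X + 1 = 0"
  shows "X\<^sup>2 = (12 * X - 1) / 16" "X * X\<^sup>2 = (128 * X - 12) / 256"
proof -
  show X2: "X\<^sup>2 = (12 * X - 1) / 16" using assms by simp
  have "X * X\<^sup>2 = X * ((12 * X - 1) / 16)" by (simp only: X2)
  also have "\<dots> = (12 * X\<^sup>2 - X) / 16" by (simp add: power2_eq_square algebra_simps)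
  finally show "X * X\<^sup>2 = (128 * X - 12) / 256" unfolding X2 by (simp add: field_simps)
qed

context level begin

text \<open>Everything follows from \<open>d\<^sup>2\<close> being \<open>1\<close> modulo
  \<open>2 ^ j\<close> and \<open>-1\<close> modulo 5: \<open>g\<close> and
  \<open>d\<^sup>2 * g\<close> agree modulo \<open>2 ^ j\<close>, where both are \<open>5\<close>,
  and are opposite modulo 5.\<close>

lemma nonvanishing_angles:
  obtains c where "\<not> 5 dvd c" "g - d\<^sup>2 * g = 2 ^ j * c"
    "[g + d\<^sup>2 * g = 10] (mod N)" "[d * g + d * d\<^sup>2 * g = 10] (mod N)"
    "[d * g - d * d\<^sup>2 * g = 2 ^ j * (2 * c)] (mod N)"
proof -
  have d2: "[d\<^sup>2 = 1] (mod 2 ^ j)" "[d\<^sup>2 = 4] (mod 5)"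
    using cong_pow[OF d(1), of 2] cong_pow[OF d(2), of 2] by simp_all
  have "[g - d\<^sup>2 * g = g - 1 * g] (mod 2 ^ j)" by (intro cong_diff cong_scalar_right d2 cong_refl)
  then obtain c where c: "g - d\<^sup>2 * g = 2 ^ j * c" by (auto simp: cong_0_iff elim: dvdE)
  have "[g - d\<^sup>2 * g = 1 - 4 * 1] (mod 5)" by (intro cong_diff cong_mult d2 g)
  then have "[2 ^ j * c = 2] (mod 5)" unfolding c by (simp add: cong_def)
  then have nd: "\<not> 5 dvd c" by (auto simp: cong_def)
  have s: "[g + d\<^sup>2 * g = 10] (mod N)"
  proof (rule cong_N)
    have "[g + d\<^sup>2 * g = 5 + 1 * 5] (mod 2 ^ j)" by (intro cong_add cong_mult d2 g)
    then show "[g + d\<^sup>2 * g = 10] (mod 2 ^ j)" by simp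
    have "[g + d\<^sup>2 * g = 1 + 4 * 1] (mod 5)" by (intro cong_add cong_mult d2 g)
    then show "[g + d\<^sup>2 * g = 10] (mod 5)" by (simp add: cong_def)
  qed
  have "[d * (g + d\<^sup>2 * g) = d * 10] (mod N)" using s by (rule cong_scalar_left)
  also have "[d * 10 = 10] (mod N)" using cong_scalar_left[OF d_5, of 2] by (simp add: mult_ac)
  finally have s': "[d * g + d * d\<^sup>2 * g = 10] (mod N)" by (simp add: algebra_simps)
  have "[2 ^ j * (d * c) = 2 ^ j * (2 * c)] (mod 2 ^ j * 5)"
    by (intro cong_cmult_leftI cong_scalar_right d)
  moreover have "d * g - d * d\<^sup>2 * g = 2 ^ j * (d * c)"
    using arg_cong[OF c, of "\<lambda>x. d * x"] by (simp add: algebra_simps)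
  ultimately have "[d * g - d * d\<^sup>2 * g = 2 ^ j * (2 * c)] (mod N)" by (simp add: mult.commute)
  then show ?thesis using that nd c s s' by blast
qed

text \<open>
  \<open>Q\<close> and \<open>R\<close> are the components of \<open>T\<close> on which \<open>d\<close> acts as \<open>-1\<close> and with square \<open>-1\<close>.
\<close>

definition Q :: "int \<Rightarrow> real" where
  "Q v = T v - T (d * v) + T (d * (d * v)) - T (d * (d * (d * v)))"

definition R :: "int \<Rightarrow> real" where
  "R v = T v - T (d * (d * v))"

lemma odd_d_g: "odd d" "odd g"
  using even_g_d unfolding coprime_10_iff by auto

text \<open>The angle is \<open>pi / (4 * 2 ^ (j - 3))\<close>, at most \<open>pi / 4\<close>, and
  at most \<open>pi / 8\<close> for \<open>j \<ge> 4\<close>. The bound \<open>17/20\<close> comes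
  from \<open>7/10 \<le> sqrt 2 / 2\<close> and is good enough to give
  \<open>4 * X * M > 1 - M\<close> for \<open>X > 1/20\<close> in the proof for the component
  \<open>R\<close>.\<close>

lemma cos_sq_ten: "1/2 \<le> (cos (pi * of_int 10 / of_int N))\<^sup>2"
  "j \<ge> 4 \<Longrightarrow> 17/20 \<le> (cos (pi * of_int 10 / of_int N))\<^sup>2"
proof -
  define y where "y = pi * of_int 10 / of_int N"
  have y: "y = pi / (4 * 2 ^ (j - 3))" unfolding y_def two_power_j by (simp add: field_simps)
  have dbl: "(cos y)\<^sup>2 = (1 + cos (2 * y)) / 2" using cos_double_cos[of y] by simp
  have y0: "0 \<le> y" unfolding y by simp
  have "y \<le> pi / (4 * 1)" unfolding y by (intro divide_left_mono mult_left_mono) auto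
  then have "0 \<le> cos (2 * y)" using y0 by (intro cos_ge_zero) auto
  then show "1/2 \<le> (cos (pi * of_int 10 / of_int N))\<^sup>2" using dbl unfolding y_def by simp
  assume "j \<ge> 4"
  then have "(2::real) ^ 1 \<le> 2 ^ (j - 3)" by (intro power_increasing) auto
  then have "y \<le> pi / (4 * 2)" unfolding y by (intro divide_left_mono mult_left_mono) auto
  then have "cos (pi / 4) \<le> cos (2 * y)" using y0 by (intro cos_monotone_0_pi_le) auto
  moreover have "7 / 10 \<le> sqrt 2 / 2" using real_le_rsqrt[of "7/5" 2] by (simp add: power2_eq_square)
  ultimately have "7 / 10 \<le> cos (2 * y)" by (simp add: cos_45)
  then show "17/20 \<le> (cos (pi * of_int 10 / of_int N))\<^sup>2" using dbl unfolding y_def by simp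
qed

lemma angle_c: "pi * of_int (2 ^ j * c) / of_int N = pi * of_int c / 5"
  by simp

text \<open>
  The products \<open>tan x * tan x'\<close> and quotients \<open>tan x / tan x'\<close> depend only on \<open>x + x'\<close> and \<open>x - x'\<close>. For the angles
  belonging to \<open>g\<close> and \<open>d\<^sup>2 * g\<close> the sum is \<open>10 * pi / N\<close>, a small angle, and the difference a multiple of \<open>pi / 5\<close>.
  Multiplication by \<open>d\<close> doubles the difference, while \<open>g ^ (2 ^ (j - 4))\<close> adds \<open>pi / 2\<close> to the sum.
\<close>

lemma Q_nonzero: "Q g \<noteq> 0"
proof -
  obtain c where c: "\<not> 5 dvd c" "g - d\<^sup>2 * g = 2 ^ j * c" "[g + d\<^sup>2 * g = 10] (mod N)"
    "[d * g + d * d\<^sup>2 * g = 10] (mod N)" "[d * g - d * d\<^sup>2 * g = 2 ^ j * (2 * c)] (mod N)"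
    by (rule nonvanishing_angles)
  define ang where "ang k = pi * of_int k / of_int N" for k
  have ang: "ang k + ang l = ang (k + l)" "ang k - ang l = ang (k - l)" for k l
    by (simp_all add: ang_def add_divide_distrib diff_divide_distrib ring_distribs)
  define X where "X = (cos (pi * of_int c / 5))\<^sup>2"
  have X: "16 * X\<^sup>2 - 12 * X + 1 = 0" unfolding X_def by (rule cos_fifth[OF c(1)])
  have x1: "(cos (ang (g - d\<^sup>2 * g)))\<^sup>2 = X" unfolding ang_def c(2) angle_c X_def ..
  have "cos (pi * of_int (2 * c) / 5) = 2 * X - 1"
    using cos_double_cos[of "pi * of_int c / 5"] by (simp add: X_def mult_ac)
  moreover have "(cos (ang (d * g - d * d\<^sup>2 * g)))\<^sup>2 = (cos (pi * of_int (2 ^ j * (2 * c)) / of_int N))\<^sup>2"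
    unfolding ang_def by (rule sq_sin_cos_cong(1)[OF c(5)]) simp
  ultimately have x2: "(cos (ang (d * g - d * d\<^sup>2 * g)))\<^sup>2 = (2 * X - 1)\<^sup>2"
    unfolding angle_c by simp
  define M where "M = (cos (ang 10))\<^sup>2"
  have M: "1/2 \<le> M" using cos_sq_ten(1) unfolding M_def ang_def .
  have m: "(cos (ang (g + d\<^sup>2 * g)))\<^sup>2 = M" "(cos (ang (d * g + d * d\<^sup>2 * g)))\<^sup>2 = M"
    unfolding M_def ang_def by (rule sq_sin_cos_cong; use c in simp)+
  have odd: "odd g" "odd (d\<^sup>2 * g)" "odd (d * g)" "odd (d * d\<^sup>2 * g)" using odd_d_g by simp_all
  note X2 = fifth_quadratic_powers(1)[OF X] and X3 = fifth_quadratic_powers(2)[OF X]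
  have p1: "X \<noteq> (2 * X - 1)\<^sup>2"
  proof
    assume "X = (2 * X - 1)\<^sup>2"
    then have "4 * X\<^sup>2 - 5 * X + 1 = 0" by (simp add: power2_eq_square algebra_simps)
    then have "4 * ((12 * X - 1) / 16) - 5 * X + 1 = 0" by (simp only: X2)
    then have "X = 3/8" by (simp add: field_simps)
    show False using X unfolding \<open>X = 3/8\<close> by (simp add: power2_eq_square)
  qed
  \<comment> \<open>The square of \<open>cos (pi / 5) * cos (2 * pi / 5) = 1/4\<close>; the bound on
    \<open>M\<close> keeps \<open>M\<^sup>2\<close> away from it.\<close>
  have p2: "X * (2 * X - 1)\<^sup>2 = 1/16"
  proof -
    have "X * (2 * X - 1)\<^sup>2 = 4 * (X * X\<^sup>2) - 4 * X\<^sup>2 + X" by (simp add: power2_eq_square algebra_simps)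
    also have "\<dots> = 1/16" by (subst X3, subst X2) (simp add: field_simps)
    finally show ?thesis .
  qed
  have "(1/2)\<^sup>2 \<le> M\<^sup>2" using M by (intro power_mono) auto
  then have p3: "X * (2 * X - 1)\<^sup>2 \<noteq> M\<^sup>2" unfolding p2 by (simp add: power2_eq_square)
  have cnz: "cos (ang k) \<noteq> 0" if "odd k" for k using sin_cos_nz[OF that] by (simp add: ang_def)
  have "M \<noteq> 0" using M by auto
  have ne: "\<bar>tan (ang g) * tan (ang (d\<^sup>2 * g))\<bar> \<noteq> \<bar>tan (ang (d * g)) * tan (ang (d * d\<^sup>2 * g))\<bar>"
    by (rule tan_mult_tan_ne[where M = M]; (unfold ang x1 x2)?)
       (use m p1 p3 cnz odd \<open>M \<noteq> 0\<close> in \<open>simp_all only:, simp_all\<close>)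
  have tnz: "tan (ang k) \<noteq> 0" if "odd k" for k using sin_cos_nz[OF that] by (simp add: ang_def tan_def)
  have "T g + T (d\<^sup>2 * g) = ln \<bar>tan (ang g) * tan (ang (d\<^sup>2 * g))\<bar>"
    "T (d * g) + T (d * d\<^sup>2 * g) = ln \<bar>tan (ang (d * g)) * tan (ang (d * d\<^sup>2 * g))\<bar>"
    unfolding T_def log_tan_def ang_def[symmetric] by (rule ln_abs_mult[symmetric]; rule tnz; use odd in simp)+
  moreover have "ln \<bar>tan (ang g) * tan (ang (d\<^sup>2 * g))\<bar> \<noteq> ln \<bar>tan (ang (d * g)) * tan (ang (d * d\<^sup>2 * g))\<bar>"
    using ne tnz odd by simp
  ultimately have "T g + T (d\<^sup>2 * g) \<noteq> T (d * g) + T (d * d\<^sup>2 * g)" by simp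
  then show ?thesis by (simp add: Q_def power2_eq_square mult.assoc)
qed


lemma R_nonzero: "R g \<noteq> 0"
proof -
  obtain c where c: "\<not> 5 dvd c" "g - d\<^sup>2 * g = 2 ^ j * c" "[g + d\<^sup>2 * g = 10] (mod N)"
    by (rule nonvanishing_angles)
  define ang where "ang k = pi * of_int k / of_int N" for k
  have ang: "ang k + ang l = ang (k + l)" "ang k - ang l = ang (k - l)" for k l
    by (simp_all add: ang_def add_divide_distrib diff_divide_distrib ring_distribs)
  have odd: "odd g" "odd (d\<^sup>2 * g)" using odd_d_g by simp_all
  have nz: "sin (ang k) \<noteq> 0" "cos (ang k) \<noteq> 0" if "odd k" for k
    using sin_cos_nz[OF that] by (simp_all add: ang_def)
  have "\<not> N dvd 2 * 10" 
  proof
    assume "N dvd 2 * 10"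
    then have "N \<le> 2 * 10" by (rule zdvd_imp_le) simp
    moreover have "(1::int) \<le> 2 ^ (j - 3)" by simp
    ultimately show False unfolding two_power_j by linarith
  qed
  moreover have "N dvd 2 * 10" if "sin (ang 10) = 0"
    using that unfolding ang_def by (intro sin_cos_eq_0_int disjI1) simp_all
  ultimately have "(sin (ang 10))\<^sup>2 \<noteq> 0" by auto
  moreover have "(sin (ang (g + d\<^sup>2 * g)))\<^sup>2 = (sin (ang 10))\<^sup>2"
    unfolding ang_def by (rule sq_sin_cos_cong(2)[OF c(3)]) simp
  ultimately have S: "sin (ang (g + d\<^sup>2 * g)) \<noteq> 0" by (metis zero_eq_power2)
  have "sin (pi * of_int c / of_int 5) \<noteq> 0"
  proof
    assume "sin (pi * of_int c / of_int 5) = 0"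
    then have "5 dvd 2 * c" using sin_cos_eq_0_int[of c 5] by simp
    then show False using c(1) by presburger
  qed
  then have P: "sin (ang (g - d\<^sup>2 * g)) \<noteq> 0" unfolding ang_def c(2) angle_c by simp
  have S': "sin (ang g + ang g) \<noteq> 0" using nz odd_d_g(2) sin_double[of "ang g"] by simp
  have ang0: "ang 0 = 0" by (simp add: ang_def)
  \<comment> \<open>Taking \<open>y = y'\<close> makes the right-hand side \<open>0\<close>, and
    both inequalities only ask that certain sines do not vanish.\<close>
  have "log_tan (ang g) - log_tan (ang (d\<^sup>2 * g)) \<noteq> log_tan (ang g) - log_tan (ang g)"
    by (rule log_tan_diff_ne) (use nz odd S P S' ang0 in \<open>simp_all only: ang(2) ang(1)[of g "d\<^sup>2 * g"], simp_all\<close>)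
  then show ?thesis by (simp add: R_def T_def ang_def power2_eq_square mult.assoc)
qed

text \<open>On \<open>R\<close> both \<open>d\<close> and \<open>g ^ (2 ^ (j - 4))\<close> have
  square \<open>-1\<close>. The combination with sign \<open>s\<close> is the part on which
  \<open>d\<close> acts as \<open>s\<close> times \<open>g ^ (2 ^ (j - 4))\<close>, so that
  \<open>d\<close> becomes an element of \<open>Z[w]\<close>; the domain argument then asks for one
  nonzero value of each part.\<close>

lemma R_combination_nonzero:
  assumes j4: "j \<ge> 4" and s: "s = 1 \<or> s = (-1 :: real)"
  shows "R (d * g) + s * R (g ^ (2 ^ (j - 4)) * g) \<noteq> 0"
proof -
  obtain c where c: "\<not> 5 dvd c" "g - d\<^sup>2 * g = 2 ^ j * c" "[g + d\<^sup>2 * g = 10] (mod N)"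
    "[d * g + d * d\<^sup>2 * g = 10] (mod N)" "[d * g - d * d\<^sup>2 * g = 2 ^ j * (2 * c)] (mod N)"
    by (rule nonvanishing_angles)
  define q where "q = g ^ (2 ^ (j - 4))"
  obtain i where i: "j = i + 4" using j4 by (metis le_add_diff_inverse2)
  have qs: "[q * g + d\<^sup>2 * (q * g) = 10 + 5 * 2 ^ (j - 1)] (mod N)"
  proof -
    have "[q * (g + d\<^sup>2 * g) = q * 10] (mod N)" using c(3) by (rule cong_scalar_left)
    have "[q = 1 + 2 ^ (i + 2)] (mod 2 ^ (i + 3))"
    proof -
      have "[g = 5] (mod 2 ^ (i + 3))" using g(1) by (rule cong_dvd_modulus) (simp add: i le_imp_power_dvd)
      then have "[q = 5 ^ (2 ^ i)] (mod 2 ^ (i + 3))" unfolding q_def i by (simp add: cong_pow)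
      then show ?thesis using five_power_twopower cong_trans by blast
    qed
    then have "[10 * q = 10 * (1 + 2 ^ (i + 2))] (mod 10 * 2 ^ (i + 3))" by (rule cong_cmult_leftI)
    moreover have "10 * 2 ^ (i + 3) = N" "10 * (1 + 2 ^ (i + 2)) = (10 + 5 * 2 ^ (j - 1) :: int)"
      by (simp_all add: i power_add)
    ultimately have "[10 * q = 10 + 5 * 2 ^ (j - 1)] (mod N)" by (simp only:)
    with \<open>[q * (g + d\<^sup>2 * g) = q * 10] (mod N)\<close> have "[q * (g + d\<^sup>2 * g) = 10 + 5 * 2 ^ (j - 1)] (mod N)"
      unfolding mult.commute[of q 10] by (rule cong_trans)
    then show ?thesis by (simp add: algebra_simps)
  qed
  have qd: "[q * g - d\<^sup>2 * (q * g) = 2 ^ j * c] (mod N)"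
  proof -
    have "[q = 1 ^ (2 ^ (j - 4))] (mod 5)" unfolding q_def using g(2) by (rule cong_pow)
    then have "[2 ^ j * (q * c) = 2 ^ j * (1 * c)] (mod 2 ^ j * 5)" by (intro cong_cmult_leftI cong_scalar_right) simp
    moreover have "q * g - d\<^sup>2 * (q * g) = 2 ^ j * (q * c)"
      using arg_cong[OF c(2), of "\<lambda>x. q * x"] by (simp only: right_diff_distrib mult_ac)
    ultimately show ?thesis by (simp add: mult.commute)
  qed
  define ang where "ang k = pi * of_int k / of_int N" for k
  have ang: "ang k + ang l = ang (k + l)" "ang k - ang l = ang (k - l)" for k l
    by (simp_all add: ang_def add_divide_distrib diff_divide_distrib ring_distribs)
  define X where "X = (cos (pi * of_int c / 5))\<^sup>2"
  have X: "16 * X\<^sup>2 - 12 * X + 1 = 0" unfolding X_def by (rule cos_fifth[OF c(1)])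
  define M where "M = (cos (ang 10))\<^sup>2"
  have M: "17/20 \<le> M" using cos_sq_ten(2)[OF j4] unfolding M_def ang_def .
  have S: "(sin (ang (d * g + d * d\<^sup>2 * g)))\<^sup>2 = 1 - M"
    unfolding M_def ang_def sin_squared_eq[symmetric] by (rule sq_sin_cos_cong(2)[OF c(4)]) simp
  have S': "(sin (ang (q * g + d\<^sup>2 * (q * g))))\<^sup>2 = M"
  proof -
    have "(sin (ang (q * g + d\<^sup>2 * (q * g))))\<^sup>2 = (sin (pi * of_int (10 + 5 * 2 ^ (j - 1)) / of_int N))\<^sup>2"
      unfolding ang_def by (rule sq_sin_cos_cong(2)[OF qs]) simp
    also have "pi * of_int (10 + 5 * 2 ^ (j - 1)) / of_int N = ang 10 + pi / 2"
      unfolding two_power_j ang_def by (simp add: field_simps)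
    also have "sin (ang 10 + pi / 2) = cos (ang 10)" by (simp add: sin_add)
    finally show ?thesis unfolding M_def .
  qed
  have s2: "(sin (pi * of_int c / 5))\<^sup>2 = 1 - X" unfolding X_def by (rule sin_squared_eq)
  have Q: "(sin (ang (q * g - d\<^sup>2 * (q * g))))\<^sup>2 = 1 - X"
    unfolding s2[symmetric] ang_def sq_sin_cos_cong(2)[OF qd zero_less_mult_iff[THEN iffD2]]
    using sq_sin_cos_cong(2)[OF qd] by (simp add: angle_c del: of_int_diff of_int_mult)
  have P: "(sin (ang (d * g - d * d\<^sup>2 * g)))\<^sup>2 = 4 * X * (1 - X)"
  proof -
    have "(sin (ang (d * g - d * d\<^sup>2 * g)))\<^sup>2 = (sin (pi * of_int (2 ^ j * (2 * c)) / of_int N))\<^sup>2"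
      unfolding ang_def by (rule sq_sin_cos_cong(2)[OF c(5)]) simp
    also have "pi * of_int (2 ^ j * (2 * c)) / of_int N = 2 * (pi * of_int c / 5)" unfolding angle_c by simp
    also have "(sin (2 * (pi * of_int c / 5)))\<^sup>2 = 4 * X * (1 - X)"
      unfolding sin_double[of "pi * of_int c / 5"]
      by (simp add: power_mult_distrib sin_squared_eq X_def)
    finally show ?thesis .
  qed
  note X2 = fifth_quadratic_powers(1)[OF X] and X3 = fifth_quadratic_powers(2)[OF X]
  have Xge: "1/20 < X"
  proof (rule ccontr)
    assume "\<not> 1/20 < X"
    then have "16 * X\<^sup>2 + 2/5 \<le> 0" using X by simp
    then show False using zero_le_power2[of X] by linarith
  qed
  have X1: "1 - X \<noteq> 0" using X by auto
  have "1/20 * M < X * M" using Xge M by (intro mult_strict_right_mono) auto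
  then have "4 * X * M \<noteq> 1 - M" using M by linarith
  then have "(4 * X * M) * (1 - X) \<noteq> (1 - M) * (1 - X)" using X1 by (metis mult_right_cancel)
  then have n1: "4 * X * (1 - X) * M \<noteq> (1 - M) * (1 - X)" by (simp add: mult_ac)
  \<comment> \<open>The square of \<open>sin (pi / 5) * sin (2 * pi / 5)\<close>. Its value
    \<open>5/16\<close> exceeds \<open>1/4\<close>, the largest possible value of
    \<open>(1 - M) * M\<close>.\<close>
  have "4 * X * (1 - X) * (1 - X) = 4 * X - 8 * X\<^sup>2 + 4 * (X * X\<^sup>2)"
    by (simp add: power2_eq_square algebra_simps)
  also have "\<dots> = 5/16" by (subst X3, subst X2) (simp add: field_simps)
  finally have PQ: "4 * X * (1 - X) * (1 - X) = 5/16" .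
  have "(1 - M) * M \<le> 1/4" using zero_le_power2[of "M - 1/2"] by (simp add: power2_eq_square algebra_simps)
  then have n2: "(1 - M) * M \<noteq> 4 * X * (1 - X) * (1 - X)" unfolding PQ by simp
  have odd: "odd (d * g)" "odd (d * d\<^sup>2 * g)" "odd (q * g)" "odd (d\<^sup>2 * (q * g))" using odd_d_g by (simp_all add: q_def)
  have nz: "sin (ang k) \<noteq> 0" "cos (ang k) \<noteq> 0" if "odd k" for k
    using sin_cos_nz[OF that] by (simp_all add: ang_def)
  have S2: "(sin (ang (d\<^sup>2 * (q * g) + q * g)))\<^sup>2 = M" using S' by (simp only: add.commute)
  have "ang (d\<^sup>2 * (q * g) - q * g) = - ang (q * g - d\<^sup>2 * (q * g))" by (simp flip: ang)
  then have Q2: "(sin (ang (d\<^sup>2 * (q * g) - q * g)))\<^sup>2 = 1 - X" using Q by simp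
  \<comment> \<open>Exchanging \<open>q * g\<close> and \<open>d\<^sup>2 * (q * g)\<close> changes
    the sign of \<open>R (q * g)\<close>, so the two inequalities cover both values of
    \<open>s\<close>.\<close>
  have 1: "log_tan (ang (d * g)) - log_tan (ang (d * d\<^sup>2 * g)) \<noteq> log_tan (ang (q * g)) - log_tan (ang (d\<^sup>2 * (q * g)))"
    by (rule log_tan_diff_ne; (unfold ang S S' P Q)?) (rule nz odd n1 n2)+
  have 2: "log_tan (ang (d * g)) - log_tan (ang (d * d\<^sup>2 * g)) \<noteq> log_tan (ang (d\<^sup>2 * (q * g))) - log_tan (ang (q * g))"
    by (rule log_tan_diff_ne; (unfold ang S S2 P Q2)?) (rule nz odd n1 n2)+
  have "T k = log_tan (ang k)" for k by (simp add: T_def ang_def)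
  then show ?thesis using 1 2 s by (auto simp: R_def q_def[symmetric] power2_eq_square mult.assoc)
qed


section \<open>From relations between logarithms to equations between class sums\<close>

text \<open>Applying the relation to the multipliers \<open>m c\<close> with weights
  \<open>wt c\<close> projects it to a component described by \<open>f\<close>. There class
  \<open>c\<close> acts as \<open>n0 c + n1 c * g ^ p\<close>, an element of the group ring of the
  powers of \<open>g\<close>, and \<open>negacyclic_relation\<close> replaces \<open>g\<close> by
  \<open>w\<close>.\<close>

lemma relation_transfer:
  fixes f F :: "int \<Rightarrow> real" and w :: complex
  assumes rel: "\<And>u. coprime u 10 \<Longrightarrow> (\<Sum>i\<in>I. T (u * (e (b i) * g ^ a i))) = 0"
    and f: "\<And>v. coprime v 10 \<Longrightarrow> f (g ^ h * v) = - f v" and vv: "coprime vv 10" "f vv \<noteq> 0"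
    and F: "\<And>v. F v = (\<Sum>c\<in>C. wt c * T (m c * v))" "\<And>c. c \<in> C \<Longrightarrow> coprime (m c) 10"
    and Fe: "\<And>c v. c < 5 \<Longrightarrow> coprime v 10 \<Longrightarrow>
      F (e c * v) = of_int (n0 c) * f v + of_int (n1 c) * f (g ^ p * v)"
    and b: "\<And>i. i \<in> I \<Longrightarrow> b i < 5" and w: "w ^ h = -1"
  shows "(\<Sum>i\<in>I. (of_int (n0 (b i)) + of_int (n1 (b i)) * w ^ p) * w ^ a i) = 0"
proof -
  \<comment> \<open>The Boolean coordinate splits every index into its \<open>n0\<close> term and
    its \<open>n1\<close> term, whose exponent is larger by \<open>p\<close>.\<close>
  define n where "n z = (if snd z then n1 (b (fst z)) else n0 (b (fst z)))" for z
  define a' where "a' z = (if snd z then a (fst z) + p else a (fst z))" for z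
  define f' where "f' k = complex_of_real (f (g ^ k * vv))" for k
  have cg: "coprime (g ^ k) 10" for k using even_g_d(1) by simp
  have "(\<Sum>z\<in>I \<times> UNIV. of_int (n z) * w ^ a' z) = 0"
  proof (rule negacyclic_relation[where f = f' and m = "j - 3"])
    show "f' (k + h) = - f' k" for k
      using f[of "g ^ k * vv"] vv(1) cg[of k] by (simp add: f'_def power_add mult_ac)
    show "f' 0 \<noteq> 0" using vv by (simp add: f'_def)
    show "w ^ h = -1" by (rule w)
    fix k
    have "(\<Sum>i\<in>I. of_int (n0 (b i)) * f (g ^ (k + a i) * vv) + of_int (n1 (b i)) * f (g ^ (k + (a i + p)) * vv))
      = (\<Sum>i\<in>I. F (e (b i) * (g ^ (k + a i) * vv)))"
    proof (rule sum.cong[OF refl])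
      fix i assume "i \<in> I"
      have "coprime (g ^ (k + a i) * vv) 10" using cg[of "k + a i"] vv(1) by simp
      from Fe[OF b[OF \<open>i \<in> I\<close>] this]
      show "of_int (n0 (b i)) * f (g ^ (k + a i) * vv) + of_int (n1 (b i)) * f (g ^ (k + (a i + p)) * vv)
        = F (e (b i) * (g ^ (k + a i) * vv))"
        by (simp add: power_add mult_ac)
    qed
    also have "\<dots> = (\<Sum>i\<in>I. \<Sum>c\<in>C. wt c * T ((m c * (g ^ k * vv)) * (e (b i) * g ^ a i)))"
      unfolding F by (simp add: power_add mult_ac)
    also have "\<dots> = (\<Sum>c\<in>C. wt c * (\<Sum>i\<in>I. T ((m c * (g ^ k * vv)) * (e (b i) * g ^ a i))))"
      unfolding sum_distrib_left by (rule sum.swap)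
    also have "\<dots> = 0"
    proof (rule sum.neutral, rule ballI)
      fix c assume "c \<in> C"
      then have "coprime (m c * (g ^ k * vv)) 10" using F(2) cg[of k] vv(1) by simp
      from rel[OF this] show "wt c * (\<Sum>i\<in>I. T ((m c * (g ^ k * vv)) * (e (b i) * g ^ a i))) = 0" by simp
    qed
    finally have E: "(\<Sum>i\<in>I. of_int (n0 (b i)) * f (g ^ (k + a i) * vv) + of_int (n1 (b i)) * f (g ^ (k + (a i + p)) * vv)) = 0" .
    have "(\<Sum>z\<in>I \<times> UNIV. of_int (n z) * f' (k + a' z)) = (\<Sum>i\<in>I. \<Sum>t\<in>UNIV. of_int (n (i, t)) * f' (k + a' (i, t)))"
      by (simp add: sum.cartesian_product)
    also have "\<dots> = of_real (\<Sum>i\<in>I. of_int (n0 (b i)) * f (g ^ (k + a i) * vv) + of_int (n1 (b i)) * f (g ^ (k + (a i + p)) * vv))"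
      by (simp add: UNIV_bool n_def a'_def f'_def add.commute)
    finally show "(\<Sum>z\<in>I \<times> UNIV. of_int (n z) * f' (k + a' z)) = 0" unfolding E by simp
  qed
  also have "(\<Sum>z\<in>I \<times> UNIV. of_int (n z) * w ^ a' z) = (\<Sum>i\<in>I. \<Sum>t\<in>UNIV. of_int (n (i, t)) * w ^ a' (i, t))"
    by (simp add: sum.cartesian_product)
  also have "\<dots> = (\<Sum>i\<in>I. (of_int (n0 (b i)) + of_int (n1 (b i)) * w ^ p) * w ^ a i)"
    by (rule sum.cong) (simp_all add: UNIV_bool n_def a'_def power_add algebra_simps)
  finally show ?thesis .
qed

lemma e_simps: "e 0 = 1" "e (Suc 0) = d" "e 2 = d * d" "e 3 = d * (d * d)" "e 4 = 5"
  by (simp_all add: e_def power2_eq_square power3_eq_cube mult.assoc)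

lemma less_5_cases: "(c :: nat) < 5 \<Longrightarrow> c = 0 \<or> c = 1 \<or> c = 2 \<or> c = 3 \<or> c = 4"
  by auto

lemma T_dd_5: "T (d * (d * (5 * k))) = T (5 * k)" "T (d * (d * (d * (5 * k)))) = T (5 * k)"
  using T_d_5[of k] T_d_5[of "d * k"] T_d_5[of "d * (d * k)"] by (simp_all add: mult_ac)

lemma Q_e: "c < 5 \<Longrightarrow> Q (e c * v) = (if c < 4 then (-1) ^ c else 0) * Q v"
  by (drule less_5_cases, elim disjE)
     (simp_all add: e_simps Q_def T_d_power_4 T_d_5 T_dd_5 mult.assoc power3_eq_cube)

lemma R_e: "c < 5 \<Longrightarrow> R (e c * v) =
  (if c = 0 then 1 else if c = 2 then -1 else 0) * R v + (if c = 1 then 1 else if c = 3 then -1 else 0) * R (d * v)"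
  by (drule less_5_cases, elim disjE)
     (simp_all add: e_simps R_def T_d_power_4 T_d_5 T_dd_5 mult.assoc)

lemma T_g_power_h': "odd v \<Longrightarrow> T (d * (g ^ h * v)) = - T (d * v)"
  "odd v \<Longrightarrow> T (d * (d * (g ^ h * v))) = - T (d * (d * v))"
  "odd v \<Longrightarrow> T (d * (d * (d * (g ^ h * v)))) = - T (d * (d * (d * v)))"
  using T_g_power_h[of "d * v"] T_g_power_h[of "d * (d * v)"] T_g_power_h[of "d * (d * (d * v))"] odd_d_g
  by (simp_all add: mult_ac)

lemma Q_g_power_h: "odd v \<Longrightarrow> Q (g ^ h * v) = - Q v"
  by (simp add: Q_def T_g_power_h' T_g_power_h)

lemma R_g_power_h: "odd v \<Longrightarrow> R (g ^ h * v) = - R v"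
  by (simp add: R_def T_g_power_h' T_g_power_h)

lemma T_5_nonzero: "T 5 \<noteq> 0"
proof
  assume T0: "T 5 = 0"
  define x where "x = pi / 2 ^ j"
  have x: "pi * of_int 5 / of_int N = x" by (simp add: x_def)
  have nz: "sin x \<noteq> 0" "cos x \<noteq> 0" using sin_cos_nz[of 5] unfolding x by simp_all
  have "\<bar>tan x\<bar> = 1" using T0 nz unfolding T_def x log_tan_def by (simp add: tan_def)
  then have "\<bar>sin x\<bar> = \<bar>cos x\<bar>" using nz by (simp add: tan_def field_simps)
  then have "(sin x)\<^sup>2 = (cos x)\<^sup>2" by (metis power2_abs)
  then have "cos (2 * x) = 0" by (simp add: cos_double)
  moreover have "0 < cos (2 * x)"
  proof (rule cos_gt_zero_pi)
    have "(2::real) ^ 3 \<le> 2 ^ j" using j by (intro power_increasing) auto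
    then have "x \<le> pi / 2 ^ 3" unfolding x_def by (intro divide_left_mono) auto
    then have "8 * x \<le> pi" by simp
    then show "2 * x < pi / 2" using pi_gt_zero by linarith
    show "- (pi / 2) < 2 * x" using pi_gt_zero by (simp add: x_def less_trans[of _ 0])
  qed
  ultimately show False by simp
qed

definition A :: "'i set \<Rightarrow> ('i \<Rightarrow> nat) \<Rightarrow> ('i \<Rightarrow> nat) \<Rightarrow> complex \<Rightarrow> nat \<Rightarrow> complex" where
  "A I a b w c = (\<Sum>i\<in>{i\<in>I. b i = c}. w ^ a i)"

lemma sum_classes:
  assumes "finite I" "\<And>i. i \<in> I \<Longrightarrow> b i < 5"
  shows "(\<Sum>i\<in>I. \<phi> (b i) * w ^ a i) = \<phi> 0 * A I a b w 0 + \<phi> 1 * A I a b w 1 + \<phi> 2 * A I a b w 2 + \<phi> 3 * A I a b w 3 + \<phi> 4 * A I a b w 4"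
proof -
  have "(\<Sum>i\<in>I. \<phi> (b i) * w ^ a i) = (\<Sum>c\<in>{..<5}. \<Sum>i\<in>{i\<in>I. b i = c}. \<phi> (b i) * w ^ a i)"
    using assms by (intro sum.group[symmetric]) auto
  also have "\<dots> = (\<Sum>c\<in>{..<5}. \<phi> c * A I a b w c)"
    by (simp add: A_def sum_distrib_left)
  finally show ?thesis by (simp add: numeral_eq_Suc)
qed

text \<open>
  The three equations come from the projections of the relation on which \<open>d\<close> acts as \<open>1\<close>, as \<open>-1\<close> and with
  square \<open>-1\<close>; the last one needs a separate treatment for \<open>j = 3\<close>, where \<open>w = -1\<close> has no square root among the
  powers of \<open>w\<close>.
\<close>

lemma class_sums:
  fixes w :: complex
  assumes I: "finite I"
    and rel: "\<And>u. coprime u 10 \<Longrightarrow> (\<Sum>i\<in>I. T (u * (e (b i) * g ^ a i))) = 0"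
    and b: "\<And>i. i \<in> I \<Longrightarrow> b i < 5" and w: "w ^ h = -1"
  shows "A I a b w 1 = A I a b w 0" "A I a b w 2 = A I a b w 0" "A I a b w 3 = A I a b w 0"
    "w * A I a b w 4 = A I a b w 0 * (1 - w)"
proof -
  let ?A = "A I a b w"
  have w0: "w \<noteq> 0" using w by (auto simp: power_0_left)
  have cd: "coprime (d ^ c) 10" for c using even_g_d(2) by simp
  \<comment> \<open>The component fixed by \<open>d\<close>, written through
    \<open>f v = T (5 * v)\<close>. By the distribution relation a class below 4 acts as
    \<open>g - 1\<close>; since \<open>d\<close> fixes multiples of 5, class 4 yields the same term
    four times and acts as \<open>4 * g\<close>.\<close>
  have "(\<Sum>i\<in>I. (of_int ((\<lambda>c. if c < 4 then -1 else 0) (b i)) + of_int ((\<lambda>c. if c < 4 then 1 else 4) (b i)) * w ^ 1) * w ^ a i) = 0"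
  proof (rule relation_transfer[OF rel _ _ _ _ _ _ b w, where f = "\<lambda>v. T (5 * v)" and vv = 1
      and F = "\<lambda>v. \<Sum>c<4. 1 * T ((g * d ^ c) * v)" and C = "{..<4::nat}" and wt = "\<lambda>_. 1" and m = "\<lambda>c. g * d ^ c"])
    fix v :: int assume v: "coprime v 10"
    then have "odd (5 * v)" by (simp add: coprime_10_iff)
    from T_g_power_h[OF this] show "T (5 * (g ^ h * v)) = - T (5 * v)" by (simp add: mult_ac)
    fix c :: nat assume "c < 5"
    show "(\<Sum>k<4. 1 * T ((g * d ^ k) * (e c * v))) =
      of_int (if c < 4 then -1 else 0) * T (5 * v) + of_int (if c < 4 then 1 else 4) * T (5 * (g ^ 1 * v))"
    proof (cases "c < 4")
      case True
      have d5: "T (5 * (d ^ c * k)) = T (5 * k)" for k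
      proof (induction c arbitrary: k)
        case (Suc c)
        show ?case using Suc[of "d * k"] T_d_5[of k] by (simp add: mult_ac)
      qed simp
      have "coprime (d ^ c * v) 10" using v cd by simp
      from T_distribution[OF this] True d5[of v] d5[of "g * v"] show ?thesis
        by (simp add: e_def numeral_eq_Suc mult_ac)
    next
      case False
      then have "e c = 5" by (simp add: e_def)
      then show ?thesis using False T_d_5[of "g * v"] T_dd_5[of "g * v"]
        by (simp add: numeral_eq_Suc mult_ac)
    qed
  qed (use T_5_nonzero even_g_d cd in auto)
  then have E1: "(w - 1) * (?A 0 + ?A 1 + ?A 2 + ?A 3) + 4 * w * ?A 4 = 0"
    by (subst (asm) sum_classes[OF I b, where \<phi> = "\<lambda>c. of_int ((\<lambda>c. if c < 4 then -1 else 0) c) + of_int ((\<lambda>c. if c < 4 then 1 else 4) c) * w ^ 1"])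
       (simp_all add: algebra_simps)
  \<comment> \<open>On \<open>Q\<close> a class \<open>c\<close> below 4 acts as
    \<open>(-1) ^ c\<close>, and class 4 as \<open>0\<close>, since the alternating sum over powers
    of \<open>d\<close> cancels on multiples of 5.\<close>
  have "(\<Sum>i\<in>I. (of_int ((\<lambda>c. if c < 4 then (-1) ^ c else 0) (b i)) + of_int ((\<lambda>c. 0) (b i)) * w ^ 0) * w ^ a i) = 0"
  proof (rule relation_transfer[OF rel _ _ _ _ _ _ b w, where f = Q and vv = g
      and F = Q and C = "{..<4::nat}" and wt = "\<lambda>c. (-1) ^ c" and m = "\<lambda>c. d ^ c"])
    show "Q v = (\<Sum>c<4. (-1) ^ c * T (d ^ c * v))" for v
      by (simp add: Q_def numeral_eq_Suc mult.assoc)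
    show "Q (e c * v) = of_int (if c < 4 then (-1) ^ c else 0) * Q v + of_int 0 * Q (g ^ 0 * v)" if "c < 5" for c v
      using Q_e[OF that] by simp
  qed (use Q_nonzero even_g_d cd Q_g_power_h in \<open>auto simp: coprime_10_iff\<close>)
  then have E2: "?A 0 - ?A 1 + ?A 2 - ?A 3 = 0"
    by (subst (asm) sum_classes[OF I b, where \<phi> = "\<lambda>c. of_int ((\<lambda>c. if c < 4 then (-1) ^ c else 0) c) + of_int ((\<lambda>c. 0) c) * w ^ 0"])
       (simp_all add: algebra_simps)
  have "?A 2 = ?A 0 \<and> ?A 3 = ?A 1"
  proof (cases "j \<ge> 4")
    case True
    define p :: nat where "p = 2 ^ (j - 4)"
    have hp: "h = p + p" unfolding p_def using True by (simp add: numeral_eq_Suc Suc_diff_Suc flip: mult_2 power_Suc)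
    have E3: "?A 0 - ?A 2 + of_int s * w ^ p * (?A 1 - ?A 3) = 0" if s: "s = 1 \<or> s = -1" for s :: int
    proof -
      have gp: "R (g ^ p * (g ^ p * v)) = - R v" if "odd v" for v
        using R_g_power_h[OF that] unfolding hp by (simp add: power_add mult.assoc)
      have "(\<Sum>i\<in>I. (of_int ((\<lambda>c. if c = 0 then 1 else if c = 2 then -1 else 0) (b i))
          + of_int ((\<lambda>c. if c = 1 then s else if c = 3 then -s else 0) (b i)) * w ^ p) * w ^ a i) = 0"
      proof (rule relation_transfer[OF rel _ _ _ _ _ _ b w, where f = "\<lambda>v. R (d * v) + of_int s * R (g ^ p * v)" and vv = g
          and F = "\<lambda>v. R (d * v) + of_int s * R (g ^ p * v)" and C = "{..<4::nat}"
          and wt = "\<lambda>c. if c = 0 then 1 else if c = 1 then -1 else if c = 2 then of_int s else - of_int s"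
          and m = "\<lambda>c. if c = 0 then d else if c = 1 then d * (d * d) else if c = 2 then g ^ p else d * (d * g ^ p)"])
        fix v
        show "R (d * v) + of_int s * R (g ^ p * v) = (\<Sum>c<4::nat. (if c = 0 then 1 else if c = 1 then -1 else if c = 2 then of_int s else - of_int s)
          * T ((if c = 0 then d else if c = 1 then d * (d * d) else if c = 2 then g ^ p else d * (d * g ^ p)) * v))"
          by (simp add: R_def numeral_eq_Suc algebra_simps)
        assume "coprime v 10"
        then have odd: "odd v" by (simp add: coprime_10_iff)
        then have odd': "odd (d * v)" "odd (g ^ p * v)" using odd_d_g by simp_all
        show "R (d * (g ^ h * v)) + of_int s * R (g ^ p * (g ^ h * v)) = - (R (d * v) + of_int s * R (g ^ p * v))"
          using R_g_power_h[OF odd'(1)] R_g_power_h[OF odd'(2)] by (simp add: mult_ac)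
        fix c :: nat assume "c < 5"
        show "R (d * (e c * v)) + of_int s * R (g ^ p * (e c * v)) =
          of_int (if c = 0 then 1 else if c = 2 then -1 else 0) * (R (d * v) + of_int s * R (g ^ p * v)) +
          of_int (if c = 1 then s else if c = 3 then -s else 0) * (R (d * (g ^ p * v)) + of_int s * R (g ^ p * (g ^ p * v)))"
          using R_e[OF \<open>c < 5\<close>, of "d * v"] R_e[OF \<open>c < 5\<close>, of "g ^ p * v"] gp[OF odd] R_e[of 2 v] less_5_cases[OF \<open>c < 5\<close>] s
          by (elim disjE) (simp_all add: e_simps mult_ac)
      qed (use R_combination_nonzero[OF True, of "of_int s"] s even_g_d cd in \<open>auto simp: p_def\<close>)
      then show ?thesis
        by (subst (asm) sum_classes[OF I b, where \<phi> = "\<lambda>c. of_int ((\<lambda>c. if c = 0 then 1 else if c = 2 then -1 else 0) c)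
          + of_int ((\<lambda>c. if c = 1 then s else if c = 3 then -s else 0) c) * w ^ p"])
          (simp_all add: algebra_simps)
    qed
    have sum_diff: "x = 0" "y = 0" if "x + y = 0" "x - y = 0" for x y :: complex
      using that by (auto simp flip: mult_2)
    have "(?A 0 - ?A 2) + w ^ p * (?A 1 - ?A 3) = 0" "(?A 0 - ?A 2) - w ^ p * (?A 1 - ?A 3) = 0"
      using E3[of 1] E3[of "-1"] by simp_all
    from sum_diff[OF this] show ?thesis using w0 by simp
  next
    case False
    then have h: "h = 1" and w1: "w = -1" using j w by (auto simp: le_antisym)
    have Rg: "R (g ^ k * v) = (-1) ^ k * R v" if "odd v" for k v
    proof (induction k)
      case (Suc k)
      then show ?case using R_g_power_h[of "g ^ k * v"] that odd_d_g(2) unfolding h by (simp add: mult.assoc)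
    qed simp
    define x where "x c = (\<Sum>i\<in>{i\<in>I. b i = c}. (-1) ^ a i :: real)" for c
    have xA: "?A c = of_real (x c)" for c by (simp add: A_def x_def w1)
    have lin: "(x 0 - x 2) * R v + (x 1 - x 3) * R (d * v) = 0" if v: "coprime v 10" for v
    proof -
      have odd: "odd v" "odd (d * v)" using v odd_d_g by (simp_all add: coprime_10_iff)
      have "0 = (\<Sum>i\<in>I. T (v * (e (b i) * g ^ a i))) - (\<Sum>i\<in>I. T ((d * (d * v)) * (e (b i) * g ^ a i)))"
        using rel[OF v] rel[of "d * (d * v)"] v even_g_d by simp
      also have "\<dots> = (\<Sum>i\<in>I. R (e (b i) * (g ^ a i * v)))"
        by (simp add: sum_subtractf R_def mult_ac)
      also have "\<dots> = (\<Sum>i\<in>I. (-1) ^ a i * R (e (b i) * v))"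
      proof (rule sum.cong[OF refl])
        fix i assume "i \<in> I"
        show "R (e (b i) * (g ^ a i * v)) = (-1) ^ a i * R (e (b i) * v)"
          unfolding R_e[OF b[OF \<open>i \<in> I\<close>]] using Rg[OF odd(1), of "a i"] Rg[OF odd(2), of "a i"] by (simp add: algebra_simps)
      qed
      also have "\<dots> = (\<Sum>c\<in>{..<5}. \<Sum>i\<in>{i\<in>I. b i = c}. (-1) ^ a i * R (e (b i) * v))"
        using I b by (intro sum.group[symmetric]) auto
      also have "\<dots> = (\<Sum>c\<in>{..<5}. x c * R (e c * v))"
        by (simp add: x_def sum_distrib_right)
      also have "\<dots> = x 0 * R (e 0 * v) + x 1 * R (e 1 * v) + x 2 * R (e 2 * v) + x 3 * R (e 3 * v) + x 4 * R (e 4 * v)"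
        by (simp add: numeral_eq_Suc)
      also have "\<dots> = (x 0 - x 2) * R v + (x 1 - x 3) * R (d * v)"
        using R_e[of 0 v] R_e[of 1 v] R_e[of 2 v] R_e[of 3 v] R_e[of 4 v] by (simp add: left_diff_distrib)
      finally show ?thesis by simp
    qed
    define X where "X = x 0 - x 2"
    define Y where "Y = x 1 - x 3"
    have "X * R g + Y * R (d * g) = 0" "X * R (d * g) + Y * R (d * (d * g)) = 0"
      using lin[of g] lin[of "d * g"] even_g_d unfolding X_def Y_def by simp_all
    moreover have "R (d * (d * g)) = - R g" using R_e[of 2 g] by (simp add: e_simps mult.assoc)
    \<comment> \<open>As \<open>d\<close> has square \<open>-1\<close> on \<open>R\<close>, the pair
      \<open>(X, Y)\<close> acts like the complex number \<open>X + \<i> * Y\<close>, and its norm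
      kills \<open>R g\<close>.\<close>
    ultimately have "X * (X * R g + Y * R (d * g)) - Y * (X * R (d * g) - Y * R g) = 0" by simp
    then have "(X\<^sup>2 + Y\<^sup>2) * R g = 0" by (simp add: algebra_simps power2_eq_square)
    then have "X = 0" "Y = 0" using R_nonzero by (simp_all add: sum_power2_eq_zero_iff)
    then show ?thesis unfolding xA X_def Y_def by simp
  qed
  then have A2: "?A 2 = ?A 0" and A3: "?A 3 = ?A 1" by auto
  show A1: "?A 1 = ?A 0" using E2 unfolding A2 A3 by (simp add: algebra_simps flip: mult_2)
  show "?A 2 = ?A 0" "?A 3 = ?A 0" using A1 A2 A3 by simp_all
  have "4 * (w * ?A 4 - ?A 0 * (1 - w)) = 0" using E1 unfolding A2 A3 A1 by (simp add: algebra_simps)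
  then show "w * ?A 4 = ?A 0 * (1 - w)" by simp
qed

end

section \<open>Coding odd residues and classifying the relations of one level\<close>

lemma mod_5_power_2:
  assumes "\<not> 5 dvd (k :: int)"
  shows "\<exists>b < 4. [k = 2 ^ b] (mod 5)"
proof -
  have "k mod 5 = 1 \<or> k mod 5 = 2 \<or> k mod 5 = 4 \<or> k mod 5 = 3" using assms by presburger
  then have "[k = 2 ^ 0] (mod 5) \<or> [k = 2 ^ 1] (mod 5) \<or> [k = 2 ^ 2] (mod 5) \<or> [k = 2 ^ 3] (mod 5)"
    by (auto simp: cong_def)
  moreover have "(0::nat) < 4" "(1::nat) < 4" "(2::nat) < 4" "(3::nat) < 4" by auto
  ultimately show ?thesis by blast
qed

context level begin

lemma two_h: "2 * h = 2 ^ (j - 2)"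
proof -
  obtain i where "j = i + 3" using j by (metis le_add_diff_inverse2)
  then show ?thesis by simp
qed

lemma j_minus_2_plus_2: "j - 2 + 2 = j"
  using j by simp

lemma code_exists:
  assumes "odd k"
  shows "\<exists>a b s. a < 2 * h \<and> b < 5 \<and> (s = 1 \<or> s = -1) \<and> [s * k = e b * g ^ a] (mod N)"
proof (cases "5 dvd k")
  case False
  obtain a s where a: "a < 2 ^ (j - 2)" and s: "s \<in> {1, -1}" and "[s * k = 5 ^ a] (mod 2 ^ (j - 2 + 2))"
    using odd_cong_five_power[OF assms] by blast
  then have k2: "[s * k = 5 ^ a] (mod 2 ^ j)" by (simp only: j_minus_2_plus_2)
  have "\<not> 5 dvd s * k" using False s by auto
  then obtain b where b: "b < 4" "[s * k = 2 ^ b] (mod 5)" using mod_5_power_2 by blast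
  have "[s * k = d ^ b * g ^ a] (mod N)"
  proof (rule cong_N)
    have "[d ^ b * g ^ a = 1 ^ b * 5 ^ a] (mod 2 ^ j)" by (intro cong_mult cong_pow d g)
    then show "[s * k = d ^ b * g ^ a] (mod 2 ^ j)" using k2 by (simp add: cong_def)
    have "[d ^ b * g ^ a = 2 ^ b * 1 ^ a] (mod 5)" by (intro cong_mult cong_pow d g)
    then show "[s * k = d ^ b * g ^ a] (mod 5)" using b by (simp add: cong_def)
  qed
  then show ?thesis using a b s unfolding two_h
    by (intro exI[of _ a] exI[of _ b] exI[of _ s]) (auto simp: e_def)
next
  case True
  then obtain k' where k': "k = 5 * k'" by (rule dvdE)
  then have "odd k'" using assms by simp
  then obtain a s where a: "a < 2 ^ (j - 2)" and s: "s \<in> {1, -1}" and "[s * k' = 5 ^ a] (mod 2 ^ (j - 2 + 2))"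
    using odd_cong_five_power by blast
  then have k2: "[s * k' = 5 ^ a] (mod 2 ^ j)" by (simp only: j_minus_2_plus_2)
  have "[g ^ a = 5 ^ a] (mod 2 ^ j)" by (intro cong_pow g)
  then have "[s * k' = g ^ a] (mod 2 ^ j)" using k2 by (simp add: cong_def)
  then have "[5 * (s * k') = 5 * g ^ a] (mod N)" by (rule cong_cmult_leftI)
  then have "[s * k = e 4 * g ^ a] (mod N)" by (simp add: k' e_simps mult_ac)
  then show ?thesis using a s unfolding two_h
    by (intro exI[of _ a] exI[of _ 4] exI[of _ s]) auto
qed

lemma cong_sign_eq:
  assumes "[s * k = t * l] (mod N)" "s = 1 \<or> s = -1" "t = 1 \<or> t = -1"
    and "0 < k" "2 * k < N" "0 < l" "2 * l < N"
  shows "k = l"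
proof -
  have "N dvd s * k - t * l" using assms(1) by (simp add: cong_iff_dvd_diff)
  then have "N dvd k - l \<or> N dvd k + l" using assms(2,3)
  proof (elim disjE; simp)
    assume "N dvd - k - l"
    then show "N dvd k - l \<or> N dvd k + l" using dvd_minus_iff[of N "k + l"] by simp
  next
    assume "N dvd l - k"
    then show "N dvd k - l \<or> N dvd k + l" using dvd_minus_iff[of N "k - l"] by simp
  qed
  then show ?thesis
  proof
    assume "N dvd k - l"
    then show ?thesis using dvd_imp_le_int[of "k - l" N] assms by fastforce
  next
    assume "N dvd k + l"
    then show ?thesis using zdvd_imp_le[of N "k + l"] assms by linarith
  qed
qed

text \<open>Adding \<open>h\<close> to the exponent adds half the modulus, that is
  \<open>pi / 2\<close> to the angle. Folding the result back by a sign into the range below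
  \<open>N / 2\<close> gives the complementary angle.\<close>

lemma opposite_code:
  assumes "[s * k = e b * g ^ a] (mod N)" "[t * l = e b * g ^ (a + h)] (mod N)"
    "s = 1 \<or> s = -1" "t = 1 \<or> t = -1" "0 < k" "2 * k < N" "0 < l" "2 * l < N" "odd k" "odd l"
  shows "k = 5 * 2 ^ (j - 1) - l" "l = 5 * 2 ^ (j - 1) - k"
proof -
  let ?H = "5 * 2 ^ (j - 1) :: int"
  have N2: "N = 2 * ?H" unfolding two_power_j by simp
  have Hk: "0 < ?H - k" "2 * (?H - k) < N" using assms(5,6) unfolding N2 by simp_all
  have "odd (s * k)" using assms by auto
  have "[t * l = g ^ h * (e b * g ^ a)] (mod N)" using assms(2) by (simp add: power_add mult_ac)
  also have "[g ^ h * (e b * g ^ a) = g ^ h * (s * k)] (mod N)" by (rule cong_scalar_left[OF cong_sym[OF assms(1)]])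
  also have "[g ^ h * (s * k) = s * k + ?H] (mod N)" by (rule odd_add_half[OF \<open>odd (s * k)\<close> g_power_h])
  finally have tl: "[t * l = s * k + ?H] (mod N)" .
  have "l = ?H - k"
  proof (cases "s = 1")
    case True
    have "s * k + ?H - (-1) * (?H - k) = N" unfolding True N2 by simp
    then have "[s * k + ?H = (-1) * (?H - k)] (mod N)" by (simp only: cong_iff_dvd_diff dvd_refl)
    from cong_sign_eq[OF cong_trans[OF tl this] assms(4) _ assms(7,8) Hk] show ?thesis by simp
  next
    case False
    then have "s * k + ?H = 1 * (?H - k)" using assms(3) by auto
    from cong_sign_eq[OF tl[unfolded this] assms(4) _ assms(7,8) Hk] show ?thesis by simp
  qed
  then show "l = 5 * 2 ^ (j - 1) - k" "k = 5 * 2 ^ (j - 1) - l" by simp_all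
qed

text \<open>
  If the common value of the class sums is nonzero, all five classes are inhabited. With at most six terms, two of
  which coincide, comparing absolute values puts the coinciding terms into class 4 and forces \<open>w = -1\<close>.
\<close>

lemma level_classification:
  assumes I: "finite I" "card I \<le> 6"
    and k: "\<And>i. i \<in> I \<Longrightarrow> odd (k i) \<and> 0 < k i \<and> 2 * k i < N"
    and rel: "\<And>u. coprime u 10 \<Longrightarrow> (\<Sum>i\<in>I. T (u * k i)) = 0"
    and pq: "p \<noteq> q" "card I \<le> 4 \<or> (p \<in> I \<and> q \<in> I \<and> k p = k q)"
  shows "(\<forall>y. card {i\<in>I. k i = y} = card {i\<in>I. k i = 5 * 2 ^ (j - 1) - y}) \<or>
    (j = 3 \<and> p \<in> I \<and> q \<in> I \<and> card I = 6 \<and>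
      (k p = 15 \<and> k q = 15 \<and> k ` (I - {p, q}) = {1, 7, 9, 17} \<or>
       k p = 5 \<and> k q = 5 \<and> k ` (I - {p, q}) = {3, 11, 13, 19}))"
proof -
  obtain ca cb cs where code: "\<And>k. odd k \<Longrightarrow> ca k < 2 * h \<and> cb k < 5 \<and> (cs k = 1 \<or> cs k = -1) \<and>
    [cs k * k = e (cb k) * g ^ ca k] (mod N)"
    using code_exists by metis
  define a where "a i = ca (k i)" for i
  define b where "b i = cb (k i)" for i
  define s where "s i = cs (k i)" for i
  have c: "a i < 2 * h" "b i < 5" "s i = 1 \<or> s i = -1" "[s i * k i = e (b i) * g ^ a i] (mod N)" if "i \<in> I" for i
    using code[of "k i"] k[OF that] by (auto simp: a_def b_def s_def)
  have rel': "(\<Sum>i\<in>I. T (u * (e (b i) * g ^ a i))) = 0" if u: "coprime u 10" for u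
  proof -
    have "T (u * (e (b i) * g ^ a i)) = T (u * k i)" if i: "i \<in> I" for i
    proof -
      have "[u * (s i * k i) = u * (e (b i) * g ^ a i)] (mod N)" by (intro cong_scalar_left c(4) i)
      then have "T (u * (e (b i) * g ^ a i)) = T (u * (s i * k i))" by (metis T_cong)
      then show ?thesis using c(3)[OF i] T_minus[of "u * k i"] by auto
    qed
    then show ?thesis using rel[OF u] by simp
  qed
  obtain w :: complex where w: "w ^ h = -1" using ex_root_minus_one by blast
  let ?A = "A I a b w"
  note cs = class_sums[OF I(1) rel' c(2) w]
  have w1: "w \<noteq> 1" using w by auto
  have w0: "w \<noteq> 0" using w by (auto simp: power_0_left)
  show ?thesis
  proof (cases "?A 0 = 0")
    case True
    have A0: "?A n = 0" if "n < 5" for n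
      using less_5_cases[OF that] cs True w0 by auto
    have opp: "card {i\<in>I. b i = n \<and> a i = x} = card {i\<in>I. b i = n \<and> a i = x + h}" if "n < 5" "x < h" for n x
    proof -
      have "card {i \<in> {i\<in>I. b i = n}. a i = x} = card {i \<in> {i\<in>I. b i = n}. a i = x + h}"
        by (rule vanishing_sum_roots[OF _ _ w _ that(2)])
           (use I c(1) A0[OF that(1)] in \<open>auto simp: A_def\<close>)
      then show ?thesis by simp
    qed
    \<comment> \<open>One inequality is enough: \<open>y\<close> and its complement may be
      exchanged, which gives the reverse one.\<close>
    have le: "card {i\<in>I. k i = y} \<le> card {i\<in>I. k i = 5 * 2 ^ (j - 1) - y}" for y
    proof (cases "\<exists>i0\<in>I. k i0 = y")
      case False
      then have "{i\<in>I. k i = y} = {}" by auto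
      then show ?thesis by (simp only: card.empty)
    next
      case True
      then obtain i0 where i0: "i0 \<in> I" "k i0 = y" by blast
      have same: "{i\<in>I. k i = y} \<subseteq> {i\<in>I. b i = b i0 \<and> a i = a i0}"
        using i0 by (auto simp: a_def b_def)
      show ?thesis
      proof (cases "a i0 < h")
        case True
        have "card {i\<in>I. k i = y} \<le> card {i\<in>I. b i = b i0 \<and> a i = a i0}"
          using same I by (intro card_mono) auto
        also have "\<dots> = card {i\<in>I. b i = b i0 \<and> a i = a i0 + h}"
          using opp[OF c(2)[OF i0(1)] True] .
        also have "\<dots> \<le> card {i\<in>I. k i = 5 * 2 ^ (j - 1) - y}"
        proof (intro card_mono subsetI)
          fix i assume "i \<in> {i\<in>I. b i = b i0 \<and> a i = a i0 + h}"
          then have i: "i \<in> I" "b i = b i0" "a i = a i0 + h" by auto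
          have "k i = 5 * 2 ^ (j - 1) - k i0"
            using opposite_code(2)[of "s i0" "k i0" "b i0" "a i0" "s i" "k i"] c(3,4)[OF i(1)] c(3,4)[OF i0(1)] k[OF i(1)] k[OF i0(1)] i by auto
          then show "i \<in> {i\<in>I. k i = 5 * 2 ^ (j - 1) - y}" using i i0 by simp
        qed (use I in simp)
        finally show ?thesis .
      next
        case False
        define x where "x = a i0 - h"
        have x: "a i0 = x + h" "x < h" using False c(1)[OF i0(1)] by (auto simp: x_def)
        have "card {i\<in>I. k i = y} \<le> card {i\<in>I. b i = b i0 \<and> a i = x + h}"
          using same I unfolding x(1) by (intro card_mono) auto
        also have "\<dots> = card {i\<in>I. b i = b i0 \<and> a i = x}"
          using opp[OF c(2)[OF i0(1)] x(2)] by simp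
        also have "\<dots> \<le> card {i\<in>I. k i = 5 * 2 ^ (j - 1) - y}"
        proof (intro card_mono subsetI)
          fix i assume "i \<in> {i\<in>I. b i = b i0 \<and> a i = x}"
          then have i: "i \<in> I" "b i = b i0" "a i = x" by auto
          have "k i = 5 * 2 ^ (j - 1) - k i0"
            using opposite_code(1)[of "s i" "k i" "b i0" x "s i0" "k i0"] c(3,4)[OF i(1)] c(3,4)[OF i0(1)] k[OF i(1)] k[OF i0(1)] i x by auto
          then show "i \<in> {i\<in>I. k i = 5 * 2 ^ (j - 1) - y}" using i i0 by simp
        qed (use I in simp)
        finally show ?thesis .
      qed
    qed
    have "card {i\<in>I. k i = y} = card {i\<in>I. k i = 5 * 2 ^ (j - 1) - y}" for y
      using le[of y] le[of "5 * 2 ^ (j - 1) - y"] by simp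
    then show ?thesis by blast
  next
    case False
    define n where "n m = card {i\<in>I. b i = m}" for m
    have "(\<Sum>m\<in>{..<5}. \<Sum>i\<in>{i\<in>I. b i = m}. 1) = (\<Sum>i\<in>I. 1::nat)"
      using I c(2) by (intro sum.group) auto
    then have nsum: "n 0 + n 1 + n 2 + n 3 + n 4 = card I" by (simp add: n_def numeral_eq_Suc)
    have npos: "n m \<ge> 1" if "m < 5" for m
    proof -
      have "?A m \<noteq> 0" using less_5_cases[OF that] cs False w1 by auto
      then have "{i\<in>I. b i = m} \<noteq> {}" unfolding A_def by (metis sum.empty)
      then show ?thesis using I by (simp add: n_def Suc_le_eq card_gt_0_iff)
    qed
    have pos: "n 0 \<ge> 1" "n 1 \<ge> 1" "n 2 \<ge> 1" "n 3 \<ge> 1" "n 4 \<ge> 1" using npos by simp_all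
    then have pI: "p \<in> I" "q \<in> I" "k p = k q" using pq(2) nsum by auto
    then have bpq: "b q = b p" "a q = a p" by (simp_all add: a_def b_def)
    have "norm w ^ h = 1" using w by (metis norm_minus_cancel norm_one norm_power)
    then have nw: "norm w = 1" using power_eq_imp_eq_base[of "norm w" h 1] by simp
    have n1: "norm (?A m) = 1" if nm: "n m = 1" for m
    proof -
      obtain i where i: "{i\<in>I. b i = m} = {i}" using nm unfolding n_def by (rule card_1_singletonE)
      show ?thesis unfolding A_def i by (simp add: norm_power nw)
    qed
    have sub: "{p, q} \<subseteq> {i\<in>I. b i = b p}" using pI bpq by auto
    have npq: "2 \<le> n (b p)" using card_mono[OF _ sub] I pq(1) by (simp add: n_def)
    have n2: "norm (?A (b p)) = 2" if "n (b p) = 2"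
    proof -
      have pqe: "{p, q} = {i\<in>I. b i = b p}"
        by (rule card_subset_eq) (use that sub pq(1) I in \<open>simp_all add: n_def\<close>)
      have "?A (b p) = 2 * w ^ a p" unfolding A_def pqe[symmetric] using pq(1) bpq by simp
      then show ?thesis by (simp add: norm_mult norm_power nw)
    qed
    \<comment> \<open>Five inhabited classes and six terms leave two terms for the class of
      \<open>p\<close> and \<open>q\<close> and one for each other class. In a class below 4 a sum
      of norm 2 would equal a sum of norm 1.\<close>
    have b4: "b p = 4"
    proof (rule ccontr)
      assume "b p \<noteq> 4"
      then have bp: "b p = 0 \<or> b p = 1 \<or> b p = 2 \<or> b p = 3" using less_5_cases[OF c(2)[OF pI(1)]] by auto
      then have "n (b p) = 2" using npq pos nsum I(2) by (elim disjE) auto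
      moreover have "\<exists>m < 4. n m = 1" using bp npq pos nsum I(2)
      proof (elim disjE)
        assume "b p = 0"
        then have "n 1 = 1" using npq pos nsum I(2) by simp
        then show ?thesis by (intro exI[of _ 1]) simp
      qed (use npq pos nsum I(2) in \<open>auto intro!: exI[of _ 0]\<close>)
      then obtain m where m: "m < 4" "n m = 1" by blast
      ultimately have "norm (?A (b p)) = 2" "norm (?A m) = 1" using n1 n2 by auto
      moreover have "?A (b p) = ?A 0" using bp cs by auto
      moreover have "?A m = ?A 0" using m(1) cs less_5_cases[of m] by auto
      ultimately show False by simp
    qed
    have ns: "n 4 = 2" "n 0 = 1" "n 1 = 1" "n 2 = 1" "n 3 = 1" and cI: "card I = 6"
      using npq pos nsum I(2) unfolding b4 by simp_all
    have "norm (w * ?A 4) = 2" using n2 ns nw unfolding b4 by (simp add: norm_mult)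
    then have "norm (1 - w) = 2" using n1[OF ns(2)] by (simp add: cs norm_mult)
    have wm: "w = -1"
    proof -
      have "(Re w)\<^sup>2 + (Im w)\<^sup>2 = 1" using nw by (metis cmod_power2 power_one)
      moreover have "(1 - Re w)\<^sup>2 + (Im w)\<^sup>2 = 4" using \<open>norm (1 - w) = 2\<close> cmod_power2[of "1 - w"] by simp
      ultimately have "Re w = -1" by (simp add: power2_eq_square algebra_simps)
      then have "Im w = 0" using \<open>(Re w)\<^sup>2 + (Im w)\<^sup>2 = 1\<close> by simp
      then show ?thesis using \<open>Re w = -1\<close> by (simp add: complex_eq_iff)
    qed
    have j3: "j = 3"
    proof (rule ccontr)
      assume "j \<noteq> 3"
      then have "even h" using j by simp
      then show False using w unfolding wm by simp
    qed
    then have h1: "h = 1" and N40: "N = 40" by simp_all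
    obtain i0 where i0: "{i\<in>I. b i = 0} = {i0}" using ns(2) unfolding n_def by (rule card_1_singletonE)
    obtain i1 where i1: "{i\<in>I. b i = 1} = {i1}" using ns(3) unfolding n_def by (rule card_1_singletonE)
    obtain i2 where i2: "{i\<in>I. b i = 2} = {i2}" using ns(4) unfolding n_def by (rule card_1_singletonE)
    obtain i3 where i3: "{i\<in>I. b i = 3} = {i3}" using ns(5) unfolding n_def by (rule card_1_singletonE)
    note i = i0 i1 i2 i3
    have iI: "i0 \<in> I" "b i0 = 0" "i1 \<in> I" "b i1 = 1" "i2 \<in> I" "b i2 = 2" "i3 \<in> I" "b i3 = 3" using i by auto
    have pqe: "{p, q} = {i\<in>I. b i = 4}"
      by (rule card_subset_eq) (use ns sub pq(1) I b4 in \<open>simp_all add: n_def\<close>)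
    have "I - {p, q} = {i\<in>I. b i \<noteq> 4}" unfolding pqe by auto
    also have "\<dots> = {i\<in>I. b i = 0} \<union> {i\<in>I. b i = 1} \<union> {i\<in>I. b i = 2} \<union> {i\<in>I. b i = 3}"
      using c(2) less_5_cases by fastforce
    finally have Ipq: "I - {p, q} = {i0, i1, i2, i3}" unfolding i by blast
    have Ai: "?A 0 = (-1) ^ a i0" "?A 1 = (-1) ^ a i1" "?A 2 = (-1) ^ a i2" "?A 3 = (-1) ^ a i3" "?A 4 = 2 * (-1) ^ a p"
      unfolding A_def i pqe[symmetric] wm using pq(1) bpq by simp_all
    have a01: "a i = 0 \<or> a i = 1" if "i \<in> I" for i using c(1)[OF that] unfolding h1 by auto
    have sign_inj: "x = y" if "x = 0 \<or> x = 1" "y = 0 \<or> y = 1" "(-1 :: complex) ^ x = (-1) ^ y" for x y :: nat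
      using that by auto
    note cs' = cs[unfolded Ai]
    have "- (2 * (-1) ^ a p) = (-1) ^ a i0 * (2 :: complex)" using cs'(4) unfolding wm by (simp only: mult_minus1 diff_minus_eq_add one_add_one)
    then have ap: "a p = 1 - a i0" using a01[OF iI(1)] a01[OF pI(1)] by (elim disjE) simp_all
    note aeq = sign_inj[OF a01[OF iI(3)] a01[OF iI(1)] cs'(1)] sign_inj[OF a01[OF iI(5)] a01[OF iI(1)] cs'(2)]
      sign_inj[OF a01[OF iI(7)] a01[OF iI(1)] cs'(3)] ap
    \<comment> \<open>For \<open>j = 3\<close> the generators are determined modulo 40 by their
      residues modulo 8 and 5.\<close>
    have gm: "[g = 21] (mod 40)" and dm: "[d = 17] (mod 40)"
    proof -
      have "[g = 21] (mod N)" by (rule cong_N) (use g in \<open>simp_all add: j3 cong_def\<close>)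
      then show "[g = 21] (mod 40)" by (simp only: N40)
      have "[d = 17] (mod N)" by (rule cong_N) (use d in \<open>simp_all add: j3 cong_def\<close>)
      then show "[d = 17] (mod 40)" by (simp only: N40)
    qed
    \<comment> \<open>The code determines \<open>k i\<close> up to sign modulo 40, and of
      \<open>m\<close> and \<open>40 - m\<close> the one below 20 is taken.\<close>
    have val: "k i = (if m < 20 then m else 40 - m)"
      if i: "i \<in> I" and m: "[e (b i) * g ^ a i = m] (mod 40)" "0 < m" "m < 40" "m \<noteq> 20" for i m
    proof -
      have sm: "[s i * k i = m] (mod N)" using c(4)[OF i] m(1) unfolding N40 by (rule cong_trans)
      show ?thesis
      proof (cases "m < 20")
        case True
        from cong_sign_eq[of "s i" "k i" 1 m] sm c(3)[OF i] k[OF i] m True show ?thesis by (simp add: N40)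
      next
        case False
        have "[m = (-1) * (40 - m)] (mod N)" unfolding N40 by (simp add: cong_iff_dvd_diff)
        from cong_sign_eq[OF cong_trans[OF sm this] c(3)[OF i]] k[OF i] m False show ?thesis by (simp add: N40)
      qed
    qed
    have em: "[e 0 * g ^ x = 1 * 21 ^ x] (mod 40)" "[e 1 * g ^ x = 17 * 21 ^ x] (mod 40)" "[e 2 * g ^ x = (17 * 17) * 21 ^ x] (mod 40)"
      "[e 3 * g ^ x = (17 * (17 * 17)) * 21 ^ x] (mod 40)" "[e 4 * g ^ x = 5 * 21 ^ x] (mod 40)" for x
      unfolding One_nat_def e_simps by (intro cong_mult cong_pow cong_refl gm dm)+
    have "k p = 15 \<and> k q = 15 \<and> k ` (I - {p, q}) = {1, 7, 9, 17} \<or> k p = 5 \<and> k q = 5 \<and> k ` (I - {p, q}) = {3, 11, 13, 19}"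
      using a01[OF iI(1)]
    proof
      assume a0: "a i0 = 0"
      have "k i0 = 1" using val[OF iI(1), of 1] em(1)[of 0] by (simp add: iI a0)
      moreover have "k i1 = 17" using val[OF iI(3), of 17] em(2)[of 0] by (simp add: iI a0 aeq)
      moreover have "k i2 = 9" using val[OF iI(5), of 9] em(3)[of 0] by (simp add: iI a0 aeq cong_def)
      moreover have "k i3 = 7" using val[OF iI(7), of 33] em(4)[of 0] by (simp add: iI a0 aeq cong_def)
      moreover have "k p = 15" using val[OF pI(1), of 25] em(5)[of 1] by (simp add: b4 a0 aeq cong_def)
      ultimately show ?thesis unfolding Ipq using pI by auto
    next
      assume a0: "a i0 = 1"
      have "k i0 = 19" using val[OF iI(1), of 21] em(1)[of 1] by (simp add: iI a0)
      moreover have "k i1 = 3" using val[OF iI(3), of 37] em(2)[of 1] by (simp add: iI a0 aeq cong_def)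
      moreover have "k i2 = 11" using val[OF iI(5), of 29] em(3)[of 1] by (simp add: iI a0 aeq cong_def)
      moreover have "k i3 = 13" using val[OF iI(7), of 13] em(4)[of 1] by (simp add: iI a0 aeq cong_def)
      moreover have "k p = 5" using val[OF pI(1), of 5] em(5)[of 0] by (simp add: b4 a0 aeq cong_def)
      ultimately show ?thesis unfolding Ipq using pI by auto
    qed
    then show ?thesis using j3 pI cI by blast
  qed
qed

end

section \<open>Balanced families of angles\<close>

text \<open>Counting is with multiplicity because one angle is repeated. Since \<open>pi / 4\<close>
  is its own complement, it may occur an odd number of times.\<close>

definition balanced :: "nat set \<Rightarrow> (nat \<Rightarrow> real) \<Rightarrow> bool" where
  "balanced I z \<longleftrightarrow> (\<forall>y. card {i\<in>I. z i = y} = card {i\<in>I. z i = pi / 2 - y})"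

text \<open>
  Here \<^term>\<open>z 0\<close> stands for \<^term>\<open>pi / 2 - x 0\<close>, so the two alternatives belong to \<^term>\<open>x 0 = pi / 8\<close>
  and \<^term>\<open>x 0 = 3 * pi / 8\<close>.
\<close>

definition exceptional :: "(nat \<Rightarrow> real) \<Rightarrow> bool" where
  "exceptional z \<longleftrightarrow>
    z 0 = 15 / 40 * pi \<and> z ` {2..5} = {1 / 40 * pi, 7 / 40 * pi, 9 / 40 * pi, 17 / 40 * pi} \<or>
    z 0 = 5 / 40 * pi \<and> z ` {2..5} = {3 / 40 * pi, 11 / 40 * pi, 13 / 40 * pi, 19 / 40 * pi}"

lemma balancedI:
  assumes "\<And>i. i \<in> I \<Longrightarrow> card {i'\<in>I. z i' = z i} = card {i'\<in>I. z i' = pi / 2 - z i}"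
  shows "balanced I z"
  unfolding balanced_def
proof
  fix y
  consider i where "i \<in> I" "y = z i" | i where "i \<in> I" "pi / 2 - y = z i"
    | "\<forall>i\<in>I. z i \<noteq> y \<and> z i \<noteq> pi / 2 - y" by metis
  then show "card {i\<in>I. z i = y} = card {i\<in>I. z i = pi / 2 - y}"
  proof cases
    case 1
    then show ?thesis using assms by simp
  next
    case 2
    then have "y = pi / 2 - z i" by simp
    then show ?thesis using assms[OF 2(1)] by simp
  next
    case 3
    then have "{i\<in>I. z i = y} = {}" "{i\<in>I. z i = pi / 2 - y} = {}" by auto
    then show ?thesis by (simp only:)
  qed
qed

lemma balanced_multiplesI:
  assumes c: "c \<noteq> 0" "pi / 2 = c * of_int H" and z: "\<And>i. i \<in> I \<Longrightarrow> z i = c * of_int (k i)"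
    and card: "\<And>i. i \<in> I \<Longrightarrow> card {i'\<in>I. k i' = k i} = card {i'\<in>I. k i' = H - k i}"
  shows "balanced I z"
proof (rule balancedI)
  fix i assume i: "i \<in> I"
  have "z i' = z i \<longleftrightarrow> k i' = k i" "z i' = pi / 2 - z i \<longleftrightarrow> k i' = H - k i" if "i' \<in> I" for i'
  proof -
    have e: "pi / 2 - z i = c * of_int (H - k i)" using c(2) z[OF i] by (simp add: right_diff_distrib)
    show "z i' = z i \<longleftrightarrow> k i' = k i" unfolding z[OF i] z[OF that] using c(1) by simp
    show "z i' = pi / 2 - z i \<longleftrightarrow> k i' = H - k i" unfolding e z[OF that] using c(1)
      by (metis mult_left_cancel of_int_eq_iff)
  qed
  then have "{i'\<in>I. z i' = z i} = {i'\<in>I. k i' = k i}" "{i'\<in>I. z i' = pi / 2 - z i} = {i'\<in>I. k i' = H - k i}"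
    by blast+
  then show "card {i'\<in>I. z i' = z i} = card {i'\<in>I. z i' = pi / 2 - z i}" using card[OF i] by simp
qed

lemma sum_signed_indicator:
  assumes "finite I" "a \<noteq> b"
  shows "(\<Sum>i\<in>I. if k i = a then 1 else if k i = b then -1 else 0 :: real) =
    real (card {i\<in>I. k i = a}) - real (card {i\<in>I. k i = b})"
proof -
  have "(\<Sum>i\<in>I. if k i = a then 1 else if k i = b then -1 else 0 :: real) =
    (\<Sum>i\<in>I. (if k i = a then 1 else 0) - (if k i = b then 1 else 0))"
    by (rule sum.cong) (use assms(2) in auto)
  then show ?thesis using assms(1) by (simp add: sum_subtractf flip: sum.inter_filter)
qed

lemma balanced_Un:
  assumes "balanced I z" "balanced J z" "I \<inter> J = {}" "finite I" "finite J"
  shows "balanced (I \<union> J) z"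
proof -
  have "card {i\<in>I \<union> J. z i = y} = card {i\<in>I. z i = y} + card {i\<in>J. z i = y}" for y
  proof -
    have "{i\<in>I \<union> J. z i = y} = {i\<in>I. z i = y} \<union> {i\<in>J. z i = y}" by auto
    then show ?thesis using assms by (simp only:) (intro card_Un_disjoint; auto)
  qed
  then show ?thesis using assms unfolding balanced_def by simp
qed

lemma exists_level_generators:
  "\<exists>(g :: int) (d :: int). [g = 5] (mod 2 ^ j) \<and> [g = 1] (mod 5) \<and> [d = 1] (mod 2 ^ j) \<and> [d = 2] (mod 5)"
  using binary_chinese_remainder_int[of "2 ^ j" 5 5 1] binary_chinese_remainder_int[of "2 ^ j" 5 1 2] by auto

lemma top_level:
  assumes j: "j \<ge> 3" and I: "I \<subseteq> {..<6}" "0 \<in> I \<longleftrightarrow> 1 \<in> I" and z01: "z 0 = z 1"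
    and k: "\<And>i. i \<in> I \<Longrightarrow> odd (k i) \<and> z i = pi * of_int (k i) / of_int (5 * 2 ^ j)"
    and z: "\<And>i. i \<in> I \<Longrightarrow> 0 < z i \<and> z i < pi / 2"
    and rel: "\<And>u :: int. coprime u 10 \<Longrightarrow> (\<Sum>i\<in>I. log_tan (of_int u * z i)) = 0"
  shows "balanced I z \<or> exceptional z"
proof -
  obtain g d :: int where gd: "[g = 5] (mod 2 ^ j)" "[g = 1] (mod 5)" "[d = 1] (mod 2 ^ j)" "[d = 2] (mod 5)"
    using exists_level_generators by blast
  interpret level j g d by unfold_locales (use j gd in auto)
  define H :: int where "H = 5 * 2 ^ (j - 1)"
  have N2: "N = 2 * H" unfolding two_power_j H_def by simp
  have H0: "0 < H" unfolding H_def by simp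
  have zk: "z i = (pi / of_int N) * of_int (k i)" if "i \<in> I" for i using k[OF that] by simp
  have fin: "finite I" using I(1) finite_subset by blast
  have c6: "card I \<le> 6" using card_mono[OF _ I(1)] by simp
  have kb: "odd (k i) \<and> 0 < k i \<and> 2 * k i < N" if i: "i \<in> I" for i
  proof -
    have "0 < pi / of_int N * of_int (k i)" "pi / of_int N * of_int (k i) < pi / of_int N * of_int H"
      using z[OF i] H0 unfolding zk[OF i] N2 by (simp_all add: field_simps)
    moreover have "0 < pi / of_int N" by simp
    ultimately have "0 < (of_int (k i) :: real)" "(of_int (k i) :: real) < of_int H"
      by (metis zero_less_mult_pos, metis mult_less_cancel_left_pos)
    then show ?thesis using k[OF i] unfolding N2 by simp
  qed
  have Tk: "T (u * k i) = log_tan (of_int u * z i)" if "i \<in> I" for u i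
    unfolding T_def zk[OF that] by (simp add: mult_ac)
  have relT: "(\<Sum>i\<in>I. T (u * k i)) = 0" if "coprime u 10" for u
    using rel[OF that] Tk by simp
  have "card I \<le> 4 \<or> (0 \<in> I \<and> 1 \<in> I \<and> k 0 = k 1)"
  proof (cases "0 \<in> I")
    case True
    then show ?thesis using I(2) zk[of 0] zk[of 1] z01 by simp
  next
    case False
    then have "I \<subseteq> {..<6} - {0, 1}" using I by auto
    then have "card I \<le> card ({..<6} - {0, 1::nat})" by (intro card_mono) auto
    then show ?thesis by (simp add: card_Diff_subset)
  qed
  from level_classification[OF fin c6 kb relT _ this, simplified]
  consider "\<forall>y. card {i\<in>I. k i = y} = card {i\<in>I. k i = H - y}"
    | "j = 3" "card I = 6" "k 0 = 15 \<and> k ` (I - {0, 1}) = {1, 7, 9, 17} \<or> k 0 = 5 \<and> k ` (I - {0, 1}) = {3, 11, 13, 19}"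
    unfolding H_def by auto
  then show ?thesis
  proof cases
    case 1
    have "balanced I z"
      by (rule balanced_multiplesI[of "pi / of_int N" H I z k]) (use 1 zk N2 H0 in \<open>simp_all add: field_simps\<close>)
    then show ?thesis ..
  next
    case 2
    have I6: "I = {..<6}" by (rule card_subset_eq) (use I 2 in auto)
    then have I2: "I - {0, 1} = {2..5}" by auto
    have z40: "z i = of_int (k i) / 40 * pi" if "i < 6" for i using zk[of i] that I6 2 by simp
    have "z ` {2..5} = (\<lambda>k. of_int k / 40 * pi) ` (k ` {2..5})"
      unfolding image_image by (rule image_cong) (use z40 in auto)
    then show ?thesis using 2(3) z40[of 0] unfolding exceptional_def I2 by auto
  qed
qed

section \<open>The lowest levels and the induction over levels\<close>

lemma log_tan_neg: "0 < x \<Longrightarrow> x < pi / 4 \<Longrightarrow> log_tan x < 0"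
proof -
  assume "0 < x" "x < pi / 4"
  then have "0 < tan x" "tan x < tan (pi / 4)" by (auto intro!: tan_gt_zero tan_monotone)
  then show ?thesis by (simp add: log_tan_def tan_45)
qed

lemma log_tan_mono: "0 < x \<Longrightarrow> x < y \<Longrightarrow> y < pi / 2 \<Longrightarrow> log_tan x < log_tan y"
proof -
  assume "0 < x" "x < y" "y < pi / 2"
  then have "0 < tan x" "tan x < tan y" by (auto intro!: tan_gt_zero tan_monotone)
  then show ?thesis by (simp add: log_tan_def)
qed

text \<open>Modulo 4 there are no units besides \<open>1\<close> and \<open>-1\<close>, so a direct
  argument replaces the cyclic group generated by \<open>g\<close>. Multiplication by 3 sends
  \<open>(T1, T3)\<close> to \<open>(T3, - T1)\<close>, a quarter turn, and the two relations
  combine to \<open>(P\<^sup>2 + Q\<^sup>2) * T1 = 0\<close>. The value \<open>k i = 5\<close> is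
  the angle \<open>pi / 4\<close>, which has logarithm \<open>0\<close> and is its own
  complement.\<close>

lemma level_two:
  assumes I: "finite I"
    and k: "\<And>i. i \<in> I \<Longrightarrow> odd (k i) \<and> z i = pi * of_int (k i) / 20"
    and z: "\<And>i. i \<in> I \<Longrightarrow> 0 < z i \<and> z i < pi / 2"
    and rel: "(\<Sum>i\<in>I. log_tan (z i)) = 0" "(\<Sum>i\<in>I. log_tan (3 * z i)) = 0"
  shows "balanced I z"
proof -
  define T1 where "T1 = log_tan (pi * 1 / 20)"
  define T3 where "T3 = log_tan (pi * 3 / 20)"
  have T1: "T1 < 0" unfolding T1_def by (rule log_tan_neg) (simp_all add: pi_gt_zero)
  have T5: "log_tan (pi * 5 / 20) = 0" by (simp add: log_tan_def tan_45)
  have T7: "log_tan (pi * 7 / 20) = - T3" using log_tan_half_pi_minus[of "pi * 3 / 20"] by (simp add: T3_def field_simps)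
  have T9: "log_tan (pi * 9 / 20) = - T1" using log_tan_half_pi_minus[of "pi * 1 / 20"] by (simp add: T1_def field_simps)
  have T15: "log_tan (3 * (pi * 5 / 20)) = 0" using log_tan_add_half_pi[of "pi * 5 / 20"] T5 by (simp add: field_simps)
  have T21: "log_tan (3 * (pi * 7 / 20)) = T1" using log_tan_add_int_pi[of "pi * 1 / 20" 1] by (simp add: T1_def field_simps)
  have T27: "log_tan (3 * (pi * 9 / 20)) = - T3" using log_tan_add_int_pi[of "pi * 7 / 20" 1] T7 by (simp add: field_simps)
  have T3': "log_tan (3 * (pi * 1 / 20)) = T3" by (simp add: T3_def mult.commute)
  have T9': "log_tan (3 * (pi * 3 / 20)) = - T1" using T9 by (simp add: field_simps)
  have ks: "k i \<in> {1, 3, 5, 7, 9}" if i: "i \<in> I" for i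
  proof -
    have "0 < real_of_int (k i)" "real_of_int (k i) < 10"
      using z[OF i] k[OF i] by (auto simp: field_simps zero_less_mult_iff)
    then have "0 < k i" "k i < 10" by linarith+
    moreover have "odd (k i)" using k[OF i] by simp
    ultimately have "k i = 1 \<or> k i = 3 \<or> k i = 5 \<or> k i = 7 \<or> k i = 9" by presburger
    then show ?thesis by simp
  qed
  define p where "p i = (if k i = 1 then 1 else if k i = 9 then -1 else 0 :: real)" for i
  define q where "q i = (if k i = 3 then 1 else if k i = 7 then -1 else 0 :: real)" for i
  have val: "log_tan (z i) = p i * T1 + q i * T3" "log_tan (3 * z i) = p i * T3 - q i * T1" if i: "i \<in> I" for i
  proof -
    have zi: "z i = pi * of_int (k i) / 20" using k[OF i] by simp
    show "log_tan (z i) = p i * T1 + q i * T3" "log_tan (3 * z i) = p i * T3 - q i * T1"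
      using ks[OF i] unfolding zi p_def q_def
      by (elim insertE emptyE; simp only: of_int_1 of_int_numeral T1_def[symmetric] T3_def[symmetric] T5 T7 T9 T15 T21 T27 T3' T9'; simp)+
  qed
  define P where "P = sum p I"
  define Q where "Q = sum q I"
  have "P * T1 + Q * T3 = 0" "P * T3 - Q * T1 = 0"
    using rel by (simp_all add: val P_def Q_def sum.distrib sum_subtractf sum_distrib_right)
  then have "P * (P * T1 + Q * T3) - Q * (P * T3 - Q * T1) = 0" by simp
  then have "(P\<^sup>2 + Q\<^sup>2) * T1 = 0" by (simp add: algebra_simps power2_eq_square)
  then have PQ: "P = 0" "Q = 0" using T1 by (simp_all add: sum_power2_eq_zero_iff)
  have c: "card {i\<in>I. k i = 1} = card {i\<in>I. k i = 9}" "card {i\<in>I. k i = 3} = card {i\<in>I. k i = 7}"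
    using PQ sum_signed_indicator[OF I, of 1 9 k] sum_signed_indicator[OF I, of 3 7 k] unfolding P_def Q_def p_def q_def by simp_all
  show ?thesis
    by (rule balanced_multiplesI[of "pi / 20" 10 I z k]) (use k ks c in fastforce)+
qed

text \<open>Even and odd \<open>k\<close> are treated together. Multiplication by 3 sends
  \<open>(T1, T2)\<close> to \<open>(- T2, - T1)\<close>, so the relation persists when
  \<open>P\<close> and \<open>Q\<close> are exchanged; \<open>T1 < T2 < 0\<close> excludes both
  \<open>T1 = T2\<close> and \<open>T1 = - T2\<close>.\<close>

lemma level_one:
  assumes I: "finite I"
    and k: "\<And>i. i \<in> I \<Longrightarrow> z i = pi * of_int (k i) / 10"
    and z: "\<And>i. i \<in> I \<Longrightarrow> 0 < z i \<and> z i < pi / 2"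
    and rel: "(\<Sum>i\<in>I. log_tan (z i)) = 0" "(\<Sum>i\<in>I. log_tan (3 * z i)) = 0"
  shows "balanced I z"
proof -
  define T1 where "T1 = log_tan (pi * 1 / 10)"
  define T2 where "T2 = log_tan (pi * 2 / 10)"
  have T12: "T1 < T2" "T2 < 0" unfolding T1_def T2_def
    by (rule log_tan_mono; simp add: pi_gt_zero) (rule log_tan_neg; simp add: pi_gt_zero)
  have T3: "log_tan (pi * 3 / 10) = - T2" using log_tan_half_pi_minus[of "pi * 2 / 10"] by (simp add: T2_def field_simps)
  have T4: "log_tan (pi * 4 / 10) = - T1" using log_tan_half_pi_minus[of "pi * 1 / 10"] by (simp add: T1_def field_simps)
  have T3': "log_tan (3 * (pi * 1 / 10)) = - T2" using T3 by (simp add: field_simps)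
  have T6: "log_tan (3 * (pi * 2 / 10)) = - T1" using log_tan_add_half_pi[of "pi * 1 / 10"] by (simp add: T1_def field_simps)
  have T9: "log_tan (3 * (pi * 3 / 10)) = T1" using log_tan_add_half_pi[of "pi * 4 / 10"] T4 by (simp add: field_simps)
  have T12': "log_tan (3 * (pi * 4 / 10)) = T2" using log_tan_add_int_pi[of "pi * 2 / 10" 1] by (simp add: T2_def field_simps)
  have ks: "k i \<in> {1, 2, 3, 4}" if i: "i \<in> I" for i
  proof -
    have "0 < real_of_int (k i)" "real_of_int (k i) < 5"
      using z[OF i] k[OF i] by (auto simp: field_simps zero_less_mult_iff)
    then have "0 < k i" "k i < 5" by linarith+
    then show ?thesis by auto
  qed
  define p where "p i = (if k i = 1 then 1 else if k i = 4 then -1 else 0 :: real)" for i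
  define q where "q i = (if k i = 2 then 1 else if k i = 3 then -1 else 0 :: real)" for i
  have val: "log_tan (z i) = p i * T1 + q i * T2" "log_tan (3 * z i) = - p i * T2 - q i * T1" if i: "i \<in> I" for i
  proof -
    have zi: "z i = pi * of_int (k i) / 10" using k[OF i] by simp
    show "log_tan (z i) = p i * T1 + q i * T2" "log_tan (3 * z i) = - p i * T2 - q i * T1"
      using ks[OF i] unfolding zi p_def q_def
      by (elim insertE emptyE; simp only: of_int_1 of_int_numeral T1_def[symmetric] T2_def[symmetric] T3 T4 T3' T6 T9 T12'; simp)+
  qed
  define P where "P = sum p I"
  define Q where "Q = sum q I"
  have "P * T1 + Q * T2 = 0" "- P * T2 - Q * T1 = 0"
    using rel by (simp_all add: val P_def Q_def sum.distrib sum_subtractf sum_distrib_right sum_negf)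
  then have "(P - Q) * (T1 - T2) = 0" by (simp add: algebra_simps)
  then have "P = Q" using T12 by simp
  with \<open>P * T1 + Q * T2 = 0\<close> have "Q * (T1 + T2) = 0" by (simp add: algebra_simps)
  then have PQ: "P = 0" "Q = 0" using T12 \<open>P = Q\<close> by simp_all
  have c: "card {i\<in>I. k i = 1} = card {i\<in>I. k i = 4}" "card {i\<in>I. k i = 2} = card {i\<in>I. k i = 3}"
    using PQ sum_signed_indicator[OF I, of 1 4 k] sum_signed_indicator[OF I, of 2 3 k] unfolding P_def Q_def p_def q_def by simp_all
  show ?thesis
    by (rule balanced_multiplesI[of "pi / 10" 5 I z k]) (use k ks c in fastforce)+
qed

text \<open>The index set varies since the induction passes to the angles with even
  \<open>k\<close>. The two copies of the doubled angle have the same \<open>k\<close> and stay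
  together, which the condition on \<open>0\<close> and \<open>1\<close> records.
  \<open>exceptional\<close> refers to all of \<open>z\<close>, because an exceptional level already
  involves all six angles.\<close>

lemma relation_classification:
  assumes "j \<ge> 1" and I: "I \<subseteq> {..<6}" "0 \<in> I \<longleftrightarrow> 1 \<in> I" and z01: "z 0 = z 1"
    and k: "\<And>i. i \<in> I \<Longrightarrow> z i = pi * of_int (k i) / of_int (5 * 2 ^ j)"
    and z: "\<And>i. i \<in> I \<Longrightarrow> 0 < z i \<and> z i < pi / 2"
    and rel: "\<And>u :: int. coprime u 10 \<Longrightarrow> (\<Sum>i\<in>I. log_tan (of_int u * z i)) = 0"
  shows "balanced I z \<or> exceptional z"
  using assms
proof (induction j arbitrary: I k rule: nat_induct_at_least)
  case base
  have fin: "finite I" using base.prems(1) finite_subset by blast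
  have "balanced I z"
    by (rule level_one[OF fin _ base.prems(5), where k = k])
       (use base.prems(4) base.prems(6)[of 1] base.prems(6)[of 3] in \<open>auto simp: coprime_10_iff\<close>)
  then show ?case ..
next
  case (Suc j)
  note I = Suc.prems(1,2) and z01 = Suc.prems(3) and k = Suc.prems(4) and z = Suc.prems(5) and rel = Suc.prems(6)
  have fin: "finite I" using I(1) finite_subset by blast
  define t where "t = {i\<in>I. odd (k i)}"
  define l where "l = {i\<in>I. even (k i)}"
  have tl: "I = t \<union> l" "t \<inter> l = {}" "finite t" "finite l" using fin by (auto simp: t_def l_def)
  have k01: "k 0 = k 1" if "0 \<in> I"
    using k[of 0] k[of 1] that I(2) z01 by simp
  have t01: "0 \<in> t \<longleftrightarrow> 1 \<in> t" and l01: "0 \<in> l \<longleftrightarrow> 1 \<in> l"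
    using I(2) k01 by (auto simp: t_def l_def)
  have split: "(\<Sum>i\<in>t. log_tan (of_int u * z i)) = 0 \<and> (\<Sum>i\<in>l. log_tan (of_int u * z i)) = 0" if u: "coprime u 10" for u :: int
  proof -
    define v where "v = 1 + 5 * (2::int) ^ j"
    have "odd v" using Suc.hyps unfolding v_def by simp
    moreover have "\<not> 5 dvd v" unfolding v_def by presburger
    ultimately have "coprime (u * v) 10" using u by (simp add: coprime_10_iff prime_dvd_mult_iff)
    note r2 = rel[OF this]
    have vz: "of_int (u * v) * z i = of_int u * z i + of_int (u * k i) * pi / 2" if "i \<in> I" for i
      unfolding k[OF that] v_def by (simp add: field_simps)
    have "log_tan (of_int (u * v) * z i) = - log_tan (of_int u * z i)" if "i \<in> t" for i
    proof -
      have "odd (u * k i)" "i \<in> I" using that u by (auto simp: t_def coprime_10_iff)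
      from this(1) obtain m where "u * k i = 2 * m + 1" by (rule oddE)
      then have "of_int (u * v) * z i = (of_int u * z i + of_int m * pi) + pi / 2"
        unfolding vz[OF \<open>i \<in> I\<close>] by (simp add: field_simps)
      then show ?thesis by (simp only: log_tan_add_half_pi log_tan_add_int_pi)
    qed
    moreover have "log_tan (of_int (u * v) * z i) = log_tan (of_int u * z i)" if "i \<in> l" for i
    proof -
      have "even (u * k i)" "i \<in> I" using that by (auto simp: l_def)
      from this(1) obtain m where "u * k i = 2 * m" by (rule evenE)
      then have "of_int (u * v) * z i = of_int u * z i + of_int m * pi"
        unfolding vz[OF \<open>i \<in> I\<close>] by simp
      then show ?thesis by (simp only: log_tan_add_int_pi)
    qed
    ultimately have "- (\<Sum>i\<in>t. log_tan (of_int u * z i)) + (\<Sum>i\<in>l. log_tan (of_int u * z i)) = 0"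
      using r2 unfolding tl(1) sum.union_disjoint[OF tl(3,4,2)] by (simp add: sum_negf)
    then show ?thesis using rel[OF u] unfolding tl(1) sum.union_disjoint[OF tl(3,4,2)] by simp
  qed
  have top: "balanced t z \<or> exceptional z"
  proof (cases "j = 1")
    case True
    have "balanced t z"
    proof (rule level_two[of t k])
      fix i assume "i \<in> t"
      then show "odd (k i) \<and> z i = pi * of_int (k i) / 20" "0 < z i \<and> z i < pi / 2"
        using k[of i] z[of i] True by (simp_all add: t_def)
    qed (use tl(3) split[of 1] split[of 3] in \<open>simp_all add: coprime_10_iff\<close>)
    then show ?thesis ..
  next
    case False
    then have "Suc j \<ge> 3" using Suc.hyps by simp
    then show ?thesis
    proof (rule top_level[where k = k])
      fix i assume "i \<in> t"
      then show "odd (k i) \<and> z i = pi * of_int (k i) / of_int (5 * 2 ^ Suc j)" "0 < z i \<and> z i < pi / 2"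
        using k[of i] z[of i] by (simp_all add: t_def)
    next
      show "t \<subseteq> {..<6}" using I(1) by (auto simp: t_def)
    qed (use t01 z01 split in blast)+
  qed
  have "balanced l z \<or> exceptional z"
  proof (rule Suc.IH[where k = "\<lambda>i. k i div 2"])
    fix i assume i: "i \<in> l"
    then have "even (k i)" by (simp add: l_def)
    then obtain m where "k i = 2 * m" by (rule evenE)
    then show "z i = pi * of_int (k i div 2) / of_int (5 * 2 ^ j)"
      using k[of i] i by (simp add: l_def field_simps)
  next
    show "l \<subseteq> {..<6}" using I(1) by (auto simp: l_def)
    show "0 < z i \<and> z i < pi / 2" if "i \<in> l" for i using z[of i] that by (simp add: l_def)
  qed (use l01 z01 split in blast)+
  then show ?case using top balanced_Un[of t z l] tl by auto
qed

lemma den_dvd_multiple: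
  assumes x: "x \<in> G" "den x dvd n" "n > 0"
  obtains k where "x = pi * of_int k / of_nat n"
proof -
  obtain q :: rat where q: "x = of_rat q * pi" using x(1) by (auto simp: G_def)
  obtain a b where ab: "quotient_of q = (a, b)" by (cases "quotient_of q")
  then have b: "b > 0" "q = of_int a / of_int b"
    using quotient_of_denom_pos quotient_of_div by blast+
  have "nat b dvd n" using x(2) ab unfolding q den_of_rat by simp
  then obtain c where c: "n = nat b * c" by (rule dvdE)
  then have "real n = real_of_int b * real c" "c > 0" using b(1) x(3) by (simp, cases c, simp_all)
  moreover have "x = pi * (real_of_int a / real_of_int b)" using q b(2) by (simp add: of_rat_divide)
  ultimately have "x = pi * of_int (a * int c) / of_nat n" using b(1) by (simp add: field_simps)
  then show ?thesis by (rule that)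
qed

lemma permutation_of_four:
  assumes "distinct [p1, p2, p3, p4 :: nat]" "{p1, p2, p3, p4} \<subseteq> {1..4}"
  obtains \<sigma> where "\<sigma> permutes {1..4}" "\<sigma> 1 = p1" "\<sigma> 2 = p2" "\<sigma> 3 = p3" "\<sigma> 4 = p4"
proof -
  define \<sigma> where "\<sigma> = (\<lambda>i. if i = 1 then p1 else if i = 2 then p2 else if i = 3 then p3 else if i = 4 then p4 else i)"
  have dom: "{1..4::nat} = {1, 2, 3, 4}" by auto
  have "\<sigma> ` {1..4} \<subseteq> {1..4}" using assms(2) unfolding dom by (auto simp: \<sigma>_def)
  moreover have "inj_on \<sigma> {1..4}" using assms(1) unfolding dom by (auto simp: \<sigma>_def inj_on_def)
  ultimately have "bij_betw \<sigma> {1..4} {1..4}" by (simp add: bij_betw_def endo_inj_surj)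
  then have "\<sigma> permutes {1..4}" by (rule bij_imp_permutes) (auto simp: \<sigma>_def)
  then show ?thesis by (rule that) (simp_all add: \<sigma>_def)
qed

section \<open>Splitting balanced families into complementary pairs\<close>

lemma balanced_remove:
  assumes I: "finite I" and bal: "balanced I z" and p: "p \<in> I" "q \<in> I" "p \<noteq> q" "z p + z q = pi / 2"
  shows "balanced (I - {p, q}) z"
proof -
  have count: "card {i\<in>I. z i = y} = card {i\<in>I - {p, q}. z i = y} + ((if z p = y then 1 else 0) + (if z q = y then 1 else 0))" for y
  proof -
    have *: "card {i\<in>J. z i = y} = (\<Sum>i\<in>J. if z i = y then 1 else 0)" if "finite J" for J
      using that by (simp flip: sum.inter_filter)
    have "I = (I - {p, q}) \<union> {p, q}" using p by auto
    then have "(\<Sum>i\<in>I. if z i = y then 1 else 0) = (\<Sum>i\<in>I - {p, q}. if z i = y then 1 else 0) + (\<Sum>i\<in>{p, q}. if z i = y then 1 else (0::nat))"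
      using I by (metis (no_types, lifting) Diff_disjoint finite_Diff finite.emptyI finite_insert inf_commute sum.union_disjoint)
    then show ?thesis unfolding *[OF I] *[OF finite_Diff[OF I]] using p(3) by simp
  qed
  show ?thesis unfolding balanced_def
  proof
    fix y
    have "z p = y \<longleftrightarrow> z q = pi / 2 - y" "z q = y \<longleftrightarrow> z p = pi / 2 - y" using p(4) by linarith+
    then have "(if z p = y then 1 else 0 :: nat) = (if z q = pi / 2 - y then 1 else 0)"
      "(if z q = y then 1 else 0 :: nat) = (if z p = pi / 2 - y then 1 else 0)" by simp_all
    moreover have "card {i\<in>I. z i = y} = card {i\<in>I. z i = pi / 2 - y}" using bal unfolding balanced_def by blast
    ultimately show "card {i\<in>I - {p, q}. z i = y} = card {i\<in>I - {p, q}. z i = pi / 2 - y}"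
      using count[of y] count[of "pi / 2 - y"] by linarith
  qed
qed

lemma balanced_partner':
  assumes I: "finite I" and bal: "balanced I z" and i: "i \<in> I" "z i \<noteq> pi / 4"
  shows "\<exists>q\<in>I. q \<noteq> i \<and> z i + z q = pi / 2"
proof -
  have "{q\<in>I. z q = z i} \<noteq> {}" using i by auto
  then have "card {q\<in>I. z q = z i} \<noteq> 0" using I by simp
  then have "card {q\<in>I. z q = pi / 2 - z i} \<noteq> 0" using bal unfolding balanced_def by metis
  then have "{q\<in>I. z q = pi / 2 - z i} \<noteq> {}" by (metis card.empty)
  then obtain q where "q \<in> I" "z q = pi / 2 - z i" by blast
  then show ?thesis using i(2) by (intro bexI[of _ q]) auto
qed

lemma balanced_even_card:
  assumes "finite I" "balanced I z" "\<And>i. i \<in> I \<Longrightarrow> z i \<noteq> pi / 4"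
  shows "even (card I)"
  using assms
proof (induction "card I" arbitrary: I rule: less_induct)
  case less
  show ?case
  proof (cases "I = {}")
    case False
    then obtain i where i: "i \<in> I" by blast
    then obtain q where q: "q \<in> I" "q \<noteq> i" "z i + z q = pi / 2"
      using balanced_partner' less.prems by blast
    have "card (I - {i, q}) = card I - 2" using i q less.prems(1) by (simp add: card_Diff_subset)
    moreover have "2 \<le> card I" using card_mono[of I "{i, q}"] i q less.prems(1) by simp
    moreover have "even (card (I - {i, q}))"
      using less.hyps[of "I - {i, q}"] balanced_remove[OF less.prems(1,2) i q(1)] q less.prems calculation by auto
    ultimately show ?thesis by simp
  qed simp
qed

text \<open>Only \<open>pi / 4\<close> can lack a partner. If it occurred just once, deleting it
  would leave a balanced family of odd size without \<open>pi / 4\<close>, but such a family splits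
  into pairs.\<close>

lemma balanced_partner:
  assumes I: "finite I" "even (card I)" and bal: "balanced I z" and i: "i \<in> I"
  obtains q where "q \<in> I" "q \<noteq> i" "z i + z q = pi / 2"
proof (cases "z i = pi / 4 \<and> (\<forall>q\<in>I - {i}. z q \<noteq> pi / 4)")
  case True
  have "balanced (I - {i}) z" unfolding balanced_def
  proof
    fix y
    have "{q \<in> I - {i}. z q = y} = (if y = pi / 4 then {} else {q\<in>I. z q = y})" for y
      using True by auto
    moreover have "y = pi / 4 \<longleftrightarrow> pi / 2 - y = pi / 4" by auto
    ultimately show "card {q \<in> I - {i}. z q = y} = card {q \<in> I - {i}. z q = pi / 2 - y}"
      using bal unfolding balanced_def by simp
  qed
  then have "even (card (I - {i}))" using True I by (intro balanced_even_card) auto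
  moreover have "card I \<noteq> 0" using I i by auto
  ultimately have False using I i by simp
  then show ?thesis ..
next
  case False
  then show ?thesis using balanced_partner'[OF I(1) bal i] that by fastforce
qed

lemma balanced_pair:
  assumes "balanced {p, q} z" "p \<noteq> q"
  shows "z p + z q = pi / 2"
  by (rule balanced_partner[OF _ _ assms(1), of p]) (use assms(2) in auto)

text \<open>The alternatives depend on whether the two copies of the doubled angle are matched with
  each other, which makes it \<open>pi / 4\<close>, or with two of the remaining four
  angles.\<close>

lemma balanced_cases:
  assumes z: "z 0 = z 1" and bal: "balanced {..<6} z"
  obtains p1 p2 p3 p4 where "distinct [p1, p2, p3, p4]" "{p1, p2, p3, p4} = {2..5}"
    "z 0 + z p1 = pi / 2 \<and> z 0 + z p2 = pi / 2 \<and> z p3 + z p4 = pi / 2 \<or>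
     z 0 = pi / 4 \<and> z p1 + z p2 = pi / 2 \<and> z p3 + z p4 = pi / 2"
proof -
  obtain a where a: "a \<in> {..<6}" "a \<noteq> 0" "z 0 + z a = pi / 2"
    by (rule balanced_partner[OF _ _ bal, of 0]) auto
  have bal': "balanced ({..<6} - {0, a}) z" using balanced_remove[OF _ bal _ a(1) _ a(3)] a(2) by auto
  show ?thesis
  proof (cases "a = 1")
    case True
    have I: "{..<6} - {0, a} = {2..5::nat}" unfolding True by auto
    obtain p where p: "p \<in> {2..5}" "p \<noteq> 2" "z 2 + z p = pi / 2"
      by (rule balanced_partner[OF _ _ bal'[unfolded I], of 2]) auto
    have bal2: "balanced ({2..5} - {2, p}) z" using balanced_remove[OF _ bal' _ _ _ p(3)] p unfolding I by auto
    have "card ({2..5} - {2, p}) = 2" using p by (simp add: card_Diff_subset)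
    then obtain r s where rs: "{2..5} - {2, p} = {r, s}" "r \<noteq> s" by (auto simp: card_2_iff)
    then have "z r + z s = pi / 2" using bal2 balanced_pair by auto
    moreover have "z 0 = pi / 4" using a z True by simp
    moreover have "r \<in> {2..5} - {2, p}" "s \<in> {2..5} - {2, p}" unfolding rs by simp_all
    moreover have "{2, p} \<union> ({2..5} - {2, p}) = {2..5}" using p by auto
    ultimately show ?thesis using that[of 2 p r s] p rs by auto
  next
    case False
    have "even (card ({..<6} - {0, a}))" using a by (simp add: card_Diff_subset)
    moreover have "1 \<in> {..<6} - {0, a}" using False by simp
    ultimately obtain b where b: "b \<in> {..<6} - {0, a}" "b \<noteq> 1" "z 1 + z b = pi / 2"
      using balanced_partner[OF _ _ bal'] by (metis finite_Diff finite_lessThan)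
    have "balanced ({..<6} - {0, a} - {1, b}) z" using balanced_remove[OF _ bal' _ b(1) _ b(3)] b(2) False by auto
    moreover have I: "{..<6} - {0, a} - {1, b} = {2..5} - {a, b}" by auto
    ultimately have bal2: "balanced ({2..5} - {a, b}) z" by simp
    have ab: "a \<in> {2..5}" "b \<in> {2..5}" "a \<noteq> b" using a b False by auto
    have "card ({2..5} - {a, b}) = 2" using ab by (simp add: card_Diff_subset)
    then obtain r s where rs: "{2..5} - {a, b} = {r, s}" "r \<noteq> s" by (auto simp: card_2_iff)
    then have "z r + z s = pi / 2" using bal2 balanced_pair by auto
    moreover have "r \<in> {2..5} - {a, b}" "s \<in> {2..5} - {a, b}" unfolding rs by simp_all
    moreover have "{a, b} \<union> ({2..5} - {a, b}) = {2..5}" using ab by auto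
    ultimately show ?thesis using that[of a b r s] a b z ab rs by auto
  qed
qed

section \<open>The conjugate relations of the six angles and the resulting solutions\<close>

lemma relation_conj_int:
  assumes n: "n = 5 * 2 ^ r" and I: "finite I"
    and k: "\<And>i. i \<in> I \<Longrightarrow> z i = pi * of_int (k i) / of_nat n"
    and z: "\<And>i. i \<in> I \<Longrightarrow> 0 < z i \<and> z i < pi / 2"
    and rel: "(\<Prod>i\<in>I. (tan (z i))\<^sup>2) = 1" and u: "coprime u (10 :: int)"
  shows "(\<Sum>i\<in>I. log_tan (of_int u * z i)) = 0"
proof -
  \<comment> \<open>Conjugation uses natural exponents; \<open>log_tan\<close> is even, so
    \<open>u\<close> may be replaced by its absolute value.\<close>
  define v where "v = nat \<bar>u\<bar>"
  have uv: "log_tan (of_int u * z i) = log_tan (of_nat v * z i)" for i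
    using log_tan_minus[of "of_int u * z i"] by (cases "u \<ge> 0") (simp_all add: v_def)
  have v10: "coprime (int v) 10" using u by (simp add: v_def)
  then have vn: "coprime (int v) (int n)"
    unfolding n using coprime_10_iff by (simp add: coprime_mult_right_iff coprime_power_right_iff coprime_divisors[OF dvd_refl _ v10])
  have n0: "n > 0" by (simp add: n)
  have kpos: "0 < k i" "2 * k i < int n" if i: "i \<in> I" for i
  proof -
    have "0 < real_of_int (k i)" "2 * real_of_int (k i) < real n"
      using z[OF i] n0 unfolding k[OF i] by (auto simp: field_simps zero_less_mult_iff)
    then show "0 < k i" "2 * k i < int n" by linarith+
  qed
  have nz: "sin (of_nat w * z i) \<noteq> 0 \<and> cos (of_nat w * z i) \<noteq> 0" if i: "i \<in> I" and w: "coprime (int w) (int n)" for w i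
  proof (rule ccontr)
    assume "\<not> (sin (of_nat w * z i) \<noteq> 0 \<and> cos (of_nat w * z i) \<noteq> 0)"
    moreover have "of_nat w * z i = pi * of_int (int w * k i) / of_int (int n)" using k[OF i] by simp
    ultimately have "int n dvd 2 * (int w * k i)" using sin_cos_eq_0_int[of "int w * k i" "int n"] n0 by auto
    then have "int n dvd int w * (2 * k i)" by (simp add: mult_ac)
    then have "int n dvd 2 * k i" using w by (simp add: coprime_dvd_mult_right_iff coprime_commute)
    then show False using zdvd_imp_le[of "int n" "2 * k i"] kpos[OF i] by simp
  qed
  have prod1: "(\<Prod>i\<in>I. (tan (of_nat v * z i))\<^sup>2) = 1"
  proof (rule tan_relation_conj[where k = "\<lambda>i. nat (k i)"])
    show "coprime v n" using vn by simp
    show "z i = pi * of_nat (nat (k i)) / of_nat n" if "i \<in> I" for i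
      using k[OF that] kpos[OF that] by simp
    show "cos (z i) \<noteq> 0" if "i \<in> I" for i using nz[OF that, of 1] by simp
  qed (use I n0 rel nz vn in auto)
  have tnz: "tan (of_nat v * z i) \<noteq> 0" if "i \<in> I" for i
    using nz[OF that vn] by (simp add: tan_def)
  have "ln (\<Prod>i\<in>I. (tan (of_nat v * z i))\<^sup>2) = (\<Sum>i\<in>I. ln ((tan (of_nat v * z i))\<^sup>2))"
    by (rule ln_prod) (use I tnz in auto)
  also have "\<dots> = (\<Sum>i\<in>I. 2 * log_tan (of_nat v * z i))"
  proof (rule sum.cong[OF refl])
    fix i assume "i \<in> I"
    have "(tan (of_nat v * z i))\<^sup>2 = \<bar>tan (of_nat v * z i)\<bar> ^ 2" by simp
    then show "ln ((tan (of_nat v * z i))\<^sup>2) = 2 * log_tan (of_nat v * z i)"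
      using tnz[OF \<open>i \<in> I\<close>] unfolding log_tan_def by (simp only: ln_realpow zero_less_abs_iff)
  qed
  finally have "(\<Sum>i\<in>I. log_tan (of_nat v * z i)) = 0" unfolding prod1 by (simp flip: sum_distrib_left)
  then show ?thesis by (simp only: uv)
qed

lemma sorted_pair:
  fixes x :: "'a \<Rightarrow> real"
  obtains q1 q2 where "{q1, q2} = {p1, p2}" "x q1 \<le> x q2" "x q1 + x q2 = x p1 + x p2"
  by (metis add.commute insert_commute linear)

lemma of_rat_mult_pi:
  "of_rat s * pi < of_rat t * pi \<longleftrightarrow> s < t" "of_rat s * pi \<le> of_rat t * pi \<longleftrightarrow> s \<le> t"
  "0 < of_rat s * pi \<longleftrightarrow> 0 < s" "pi / 2 = of_rat (1 / 2) * pi" "pi / 4 = of_rat (1 / 4) * pi"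
  by (simp_all add: of_rat_less of_rat_less_eq zero_less_mult_iff of_rat_divide)

lemma complement_of_rat:
  assumes "of_rat t * pi + y = pi / 2"
  shows "y = of_rat (1 / 2 - t) * pi"
proof -
  have "y = pi / 2 - of_rat t * pi" using assms by simp
  then show ?thesis unfolding of_rat_diff left_diff_distrib of_rat_mult_pi(4) .
qed

theorem theorem12p1:
  fixes r n :: nat and x :: "nat \<Rightarrow> real"
  assumes "r > 0" and "n = 2 ^ r * 5"
    and "\<And>i. i \<in> {0..4} \<Longrightarrow> x i \<in> G"
    and "(tan (x 0))\<^sup>2 = tan (x 1) * tan (x 2) * tan (x 3) * tan (x 4)"
    and "\<And>i. i \<in> {0..4} \<Longrightarrow> 0 < x i \<and> x i < pi / 2"
    and "Max {den (x i) | i. i \<in> {0..2}} = n"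
    and "\<And>i. i \<in> {0..4} \<Longrightarrow> den (x i) dvd n"
  shows "\<exists>\<sigma>. \<sigma> permutes {1..4} \<and>
    ((\<exists>s t :: rat. 0 < s \<and> s < 1/2 \<and> 0 < t \<and> t \<le> 1/4 \<and>
        x 0 = of_rat s * pi \<and> x (\<sigma> 1) = of_rat s * pi \<and> x (\<sigma> 2) = of_rat s * pi \<and>
        x (\<sigma> 3) = of_rat t * pi \<and> x (\<sigma> 4) = of_rat (1/2 - t) * pi)
   \<or> (\<exists>s t :: rat. 0 < s \<and> s \<le> t \<and> t \<le> 1/4 \<and>
        x 0 = pi / 4 \<and> x (\<sigma> 1) = of_rat s * pi \<and> x (\<sigma> 2) = of_rat (1/2 - s) * pi \<and>
        x (\<sigma> 3) = of_rat t * pi \<and> x (\<sigma> 4) = of_rat (1/2 - t) * pi)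
   \<or> (x 0 = 1/8 * pi \<and> x (\<sigma> 1) = 1/40 * pi \<and> x (\<sigma> 2) = 7/40 * pi \<and>
        x (\<sigma> 3) = 9/40 * pi \<and> x (\<sigma> 4) = 17/40 * pi)
   \<or> (x 0 = 3/8 * pi \<and> x (\<sigma> 1) = 3/40 * pi \<and> x (\<sigma> 2) = 11/40 * pi \<and>
        x (\<sigma> 3) = 13/40 * pi \<and> x (\<sigma> 4) = 19/40 * pi))"
proof -
  have n: "n = 5 * 2 ^ r" using assms(2) by simp
  have n0: "n > 0" by (simp add: n)
  define z where "z i = (if i < 2 then pi / 2 - x 0 else x (i - 1))" for i :: nat
  have zb: "0 < z i \<and> z i < pi / 2" if "i \<in> {..<6}" for i
    using that assms(5)[of 0] assms(5)[of "i - 1"] by (auto simp: z_def)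
  have "\<exists>k. z i = pi * of_int k / of_nat n" if i: "i \<in> {..<6}" for i
  proof (cases "i < 2")
    case True
    obtain k where k: "x 0 = pi * of_int k / of_nat n"
      using den_dvd_multiple[OF assms(3)[of 0] assms(7)[of 0] n0] by auto
    \<comment> \<open>\<open>r > 0\<close> makes \<open>n\<close> even, so that
      \<open>pi / 2\<close> is a multiple of \<open>pi / n\<close> as well.\<close>
    obtain r' where r': "r = Suc r'" using assms(1) gr0_implies_Suc by blast
    have "z i = pi * of_int (5 * 2 ^ r' - k) / of_nat n"
      using True unfolding z_def k n r' by (simp add: field_simps)
    then show ?thesis by blast
  next
    case False
    then have "i - 1 \<in> {0..4}" using i by auto
    from den_dvd_multiple[OF assms(3)[OF this] assms(7)[OF this] n0]
    show ?thesis using False by (auto simp: z_def)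
  qed
  then obtain k where k: "\<And>i. i \<in> {..<6} \<Longrightarrow> z i = pi * of_int (k i) / of_nat n" by metis
  have rel: "(\<Prod>i\<in>{..<6}. (tan (z i))\<^sup>2) = 1"
  proof -
    have t0: "tan (x 0) \<noteq> 0" using tan_gt_zero[of "x 0"] assms(5)[of 0] by simp
    have "(\<Prod>i\<in>{..<6}. (tan (z i))\<^sup>2) = ((tan (pi / 2 - x 0))\<^sup>2)\<^sup>2 * (tan (x 1) * tan (x 2) * tan (x 3) * tan (x 4))\<^sup>2"
      by (simp add: z_def numeral_eq_Suc power_mult_distrib)
    also have "\<dots> = ((inverse (tan (x 0)))\<^sup>2)\<^sup>2 * ((tan (x 0))\<^sup>2)\<^sup>2" unfolding assms(4) tan_cot ..
    also have "\<dots> = 1" using t0 by (simp add: field_simps)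
    finally show ?thesis .
  qed
  have z01: "z 0 = z 1" and z0: "z 0 = pi / 2 - x 0" by (simp_all add: z_def)
  have zx: "z p = x (p - 1)" if "p \<in> {2..5}" for p using that by (simp add: z_def)
  have "balanced {..<6} z \<or> exceptional z"
  proof (rule relation_classification[where j = r and k = k])
    show "z i = pi * of_int (k i) / of_int (5 * 2 ^ r)" if "i \<in> {..<6}" for i
      using k[OF that] by (simp add: n)
    show "(\<Sum>i<6. log_tan (of_int u * z i)) = 0" if "coprime u 10" for u :: int
      using relation_conj_int[OF n _ k zb rel that] by simp
  qed (use assms(1) zb z01 in auto)
  then show ?thesis
  proof
    assume "balanced {..<6} z"
    then obtain q1 q2 q3 q4 where q: "distinct [q1, q2, q3, q4]" "{q1, q2, q3, q4} = {2..5}"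
      and zq: "z 0 + z q1 = pi / 2 \<and> z 0 + z q2 = pi / 2 \<and> z q3 + z q4 = pi / 2 \<or>
        z 0 = pi / 4 \<and> z q1 + z q2 = pi / 2 \<and> z q3 + z q4 = pi / 2"
      by (rule balanced_cases[OF z01])
    define p where "p q = q - (1::nat)" for q
    have qs: "q1 \<in> {2..5}" "q2 \<in> {2..5}" "q3 \<in> {2..5}" "q4 \<in> {2..5}" using q(2) by blast+
    have p: "distinct [p q1, p q2, p q3, p q4]" "{p q1, p q2, p q3, p q4} \<subseteq> {1..4}"
      using q(1) qs by (auto simp: p_def)
    have zp: "z q1 = x (p q1)" "z q2 = x (p q2)" "z q3 = x (p q3)" "z q4 = x (p q4)"
      using zx qs by (simp_all add: p_def)
    \<comment> \<open>The smaller angle of a pair with sum \<open>pi / 2\<close> is at most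
      \<open>pi / 4\<close>; sorting each pair yields the bounds on \<open>s\<close> and
      \<open>t\<close>.\<close>
    obtain a1 a2 where a: "{a1, a2} = {p q1, p q2}" "x a1 \<le> x a2" "x a1 + x a2 = x (p q1) + x (p q2)"
      by (rule sorted_pair)
    obtain b1 b2 where b: "{b1, b2} = {p q3, p q4}" "x b1 \<le> x b2" "x b1 + x b2 = x (p q3) + x (p q4)"
      by (rule sorted_pair)
    have ab: "distinct [a1, a2, b1, b2]" "{a1, a2, b1, b2} \<subseteq> {1..4}"
      using p a(1) b(1) by (auto simp: doubleton_eq_iff)
    have xb: "x b1 + x b2 = pi / 2" using zq zp b by auto
    have rat: "\<exists>s. x i = of_rat s * pi" if "i \<in> {0..4}" for i
      using assms(3)[OF that] by (auto simp: G_def)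
    obtain t where t: "x b1 = of_rat t * pi" using rat[of b1] ab by auto
    have t0: "0 < t" "t \<le> 1/4"
      using assms(5)[of b1] ab xb b(2) unfolding of_rat_mult_pi(2)[symmetric] of_rat_mult_pi(3)[symmetric] of_rat_mult_pi(5)[symmetric] t[symmetric]
      by auto
    have xb2: "x b2 = of_rat (1/2 - t) * pi" using xb unfolding t by (rule complement_of_rat)
    from zq show ?thesis
    proof
      assume "z 0 + z q1 = pi / 2 \<and> z 0 + z q2 = pi / 2 \<and> z q3 + z q4 = pi / 2"
      then have "x (p q1) = x 0" "x (p q2) = x 0" using zp z0 by auto
      then have xa: "x a1 = x 0" "x a2 = x 0" using a(1) by (auto simp: doubleton_eq_iff)
      obtain s where s: "x 0 = of_rat s * pi" using rat[of 0] by auto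
      have s0: "0 < s" "s < 1/2"
        using assms(5)[of 0] unfolding of_rat_mult_pi(1)[symmetric] of_rat_mult_pi(3)[symmetric] of_rat_mult_pi(4)[symmetric] s[symmetric] by auto
      obtain \<sigma> where "\<sigma> permutes {1..4}" "\<sigma> 1 = a1" "\<sigma> 2 = a2" "\<sigma> 3 = b1" "\<sigma> 4 = b2"
        by (rule permutation_of_four[OF ab])
      then show ?thesis using s s0 t t0 xa xb2 by (intro exI[of _ \<sigma>]) auto
    next
      assume "z 0 = pi / 4 \<and> z q1 + z q2 = pi / 2 \<and> z q3 + z q4 = pi / 2"
      then have x0: "x 0 = pi / 4" and xa: "x a1 + x a2 = pi / 2" using zp z0 a by auto
      obtain s where s: "x a1 = of_rat s * pi" using rat[of a1] ab by auto
      have s0: "0 < s" "s \<le> 1/4"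
        using assms(5)[of a1] ab xa a(2) unfolding of_rat_mult_pi(2)[symmetric] of_rat_mult_pi(3)[symmetric] of_rat_mult_pi(5)[symmetric] s[symmetric]
        by auto
      have xa2: "x a2 = of_rat (1/2 - s) * pi" using xa unfolding s by (rule complement_of_rat)
      show ?thesis
      proof (cases "s \<le> t")
        case True
        obtain \<sigma> where "\<sigma> permutes {1..4}" "\<sigma> 1 = a1" "\<sigma> 2 = a2" "\<sigma> 3 = b1" "\<sigma> 4 = b2"
          by (rule permutation_of_four[OF ab])
        then show ?thesis using s s0 t t0 xa2 xb2 x0 True by (intro exI[of _ \<sigma>]) auto
      next
        case False
        have "distinct [b1, b2, a1, a2]" "{b1, b2, a1, a2} \<subseteq> {1..4}" using ab by auto
        then obtain \<sigma> where "\<sigma> permutes {1..4}" "\<sigma> 1 = b1" "\<sigma> 2 = b2" "\<sigma> 3 = a1" "\<sigma> 4 = a2"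
          by (rule permutation_of_four)
        then show ?thesis using s s0 t t0 xa2 xb2 x0 False by (intro exI[of _ \<sigma>]) auto
      qed
    qed
  next
    assume exc: "exceptional z"
    have img: "z ` {2..5} = x ` {1..4}"
    proof -
      have "{1..4} = (\<lambda>p. p - 1) ` {2..5::nat}" by (auto simp: image_iff intro!: bexI[of _ "Suc _"])
      then show ?thesis using zx by (simp add: image_image)
    qed
    have perm: "\<exists>\<sigma>. \<sigma> permutes {1..4} \<and> x (\<sigma> 1) = v1 \<and> x (\<sigma> 2) = v2 \<and> x (\<sigma> 3) = v3 \<and> x (\<sigma> 4) = v4"
      if "x ` {1..4} = {v1, v2, v3, v4}" "distinct [v1, v2, v3, v4]" for v1 v2 v3 v4
    proof -
      have "v1 \<in> x ` {1..4}" "v2 \<in> x ` {1..4}" "v3 \<in> x ` {1..4}" "v4 \<in> x ` {1..4}" using that(1) by simp_all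
      then obtain p1 p2 p3 p4 where p: "p1 \<in> {1..4}" "x p1 = v1" "p2 \<in> {1..4}" "x p2 = v2"
        "p3 \<in> {1..4}" "x p3 = v3" "p4 \<in> {1..4}" "x p4 = v4" by (elim imageE) metis
      then have "distinct [p1, p2, p3, p4]" "{p1, p2, p3, p4} \<subseteq> {1..4}" using that(2) by auto
      then obtain \<sigma> where "\<sigma> permutes {1..4}" "\<sigma> 1 = p1" "\<sigma> 2 = p2" "\<sigma> 3 = p3" "\<sigma> 4 = p4"
        by (rule permutation_of_four)
      then show ?thesis using p by (intro exI[of _ \<sigma>]) auto
    qed
    from exc[unfolded exceptional_def img] show ?thesis
    proof (elim disjE conjE)
      assume "z 0 = 15 / 40 * pi"
        and v: "x ` {1..4} = {1 / 40 * pi, 7 / 40 * pi, 9 / 40 * pi, 17 / 40 * pi}"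
      then have "x 0 = 1/8 * pi" using z0 by simp
      moreover have "distinct [1 / 40 * pi, 7 / 40 * pi, 9 / 40 * pi, 17 / 40 * pi]" by simp
      ultimately show ?thesis using perm[OF v] by blast
    next
      assume "z 0 = 5 / 40 * pi"
        and v: "x ` {1..4} = {3 / 40 * pi, 11 / 40 * pi, 13 / 40 * pi, 19 / 40 * pi}"
      then have "x 0 = 3/8 * pi" using z0 by simp
      moreover have "distinct [3 / 40 * pi, 11 / 40 * pi, 13 / 40 * pi, 19 / 40 * pi]" by simp
      ultimately show ?thesis using perm[OF v] by blast
    qed
  qed
qed

end
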